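(* Let $k,\ell,m\ge0$ be integers and $F$ a finite abelian group, and let $G=\mathbf{R}^k\times\mathbf{Z}^\ell\times(\mathbf{R}/\mathbf{Z})^m\times F$. Then the inductive dimension and the topological (covering) dimension of $\mathcal{S}(G)$ are both equal to $(k+\ell)(k+m)$, and $\mathcal{S}(G)$ contains a subspace homeomorphic to $\mathbf{R}^{(k+\ell)(k+m)}$.
   Context: $\mathcal{S}(G)$ is the space of closed subgroups with the Chabauty topology. The (small) inductive dimension is defined by $\mathrm{indim}(\emptyset)=-1$ and $\mathrm{indim}(X)\le n$ iff every point has a basis of closed neighbourhoods whose boundaries have inductive dimension $\le n-1$; the covering dimension is the least $n$ such that every open cover has an open refinement in which every point lies in at most $n+1$ members. *)

theory Defs
  imports "HOL-Analysis.Analysis"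
begin

definition chabauty :: "'a topology \<Rightarrow> 'a set topology" where
  "chabauty X = subtopology
     (topology_generated_by
        ({{C. closedin X C \<and> C \<inter> K = {}} | K. compactin X K} \<union>
         {{C. closedin X C \<and> C \<inter> U \<noteq> {}} | U. openin X U}))
     {C. closedin X C}"

text \<open>The group G = R^k x Z^l x (R/Z)^m x F. Coordinates are nat-indexed;
  R^k: real vectors vanishing from index k on; Z^l: integer vectors vanishing from l on;
  (R/Z)^m: realised as the unit circle in C (R/Z \<cong> S^1 via t \<mapsto> exp(2 pi i t)),
  coordinates from m on equal to 1; F: a finite abelian group (type) with the discrete topology.\<close>
type_synonym 'f Gelem = "(nat \<Rightarrow> real) \<times> (nat \<Rightarrow> int) \<times> (nat \<Rightarrow> complex) \<times> 'f"

definition G_carrier :: "nat \<Rightarrow> nat \<Rightarrow> nat \<Rightarrow> 'f Gelem set" where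
  "G_carrier k l m = {(a, b, c, f). (\<forall>i\<ge>k. a i = 0) \<and> (\<forall>i\<ge>l. b i = 0) \<and>
      (\<forall>i<m. cmod (c i) = 1) \<and> (\<forall>i\<ge>m. c i = 1)}"

definition G_top :: "nat \<Rightarrow> nat \<Rightarrow> nat \<Rightarrow> 'f Gelem topology" where
  "G_top k l m = subtopology
     (prod_topology (powertop_real UNIV)
       (prod_topology (product_topology (\<lambda>_. (euclidean :: int topology)) UNIV)
         (prod_topology (product_topology (\<lambda>_. (euclidean :: complex topology)) UNIV)
           (discrete_topology (UNIV :: 'f set)))))
     (G_carrier k l m)"

definition G_add :: "'f::ab_group_add Gelem \<Rightarrow> 'f Gelem \<Rightarrow> 'f Gelem" where
  "G_add x y = (case x of (a, b, c, f) \<Rightarrow> case y of (a', b', c', f') \<Rightarrow>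
      (\<lambda>i. a i + a' i, \<lambda>i. b i + b' i, \<lambda>i. c i * c' i, f + f'))"

definition G_neg :: "'f::ab_group_add Gelem \<Rightarrow> 'f Gelem" where
  "G_neg x = (case x of (a, b, c, f) \<Rightarrow> (\<lambda>i. - a i, \<lambda>i. - b i, \<lambda>i. inverse (c i), - f))"

definition G_zero :: "'f::ab_group_add Gelem" where
  "G_zero = ((\<lambda>_. 0), (\<lambda>_. 0), (\<lambda>_. 1), 0)"

definition closed_subgroups :: "nat \<Rightarrow> nat \<Rightarrow> nat \<Rightarrow> 'f::ab_group_add Gelem set set" where
  "closed_subgroups k l m = {H. H \<subseteq> G_carrier k l m \<and> closedin (G_top k l m) H \<and>
      G_zero \<in> H \<and> (\<forall>x\<in>H. \<forall>y\<in>H. G_add x y \<in> H) \<and> (\<forall>x\<in>H. G_neg x \<in> H)}"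

definition SG :: "nat \<Rightarrow> nat \<Rightarrow> nat \<Rightarrow> 'f::{finite,ab_group_add} Gelem set topology" where
  "SG k l m = subtopology (chabauty (G_top k l m)) (closed_subgroups k l m)"

text \<open>ind_le n X means indim(X) \<le> n - 1 (shift by one so that indices are natural numbers):
  ind_le 0 X iff X is empty; indim(X) \<le> n iff every point has a basis of closed
  neighbourhoods whose boundaries have indim \<le> n - 1.\<close>
primrec ind_le :: "nat \<Rightarrow> 'a topology \<Rightarrow> bool" where
  "ind_le 0 X = (topspace X = {})"
| "ind_le (Suc n) X = (\<forall>x\<in>topspace X. \<forall>U. openin X U \<and> x \<in> U \<longrightarrow>
      (\<exists>N. closedin X N \<and> x \<in> X interior_of N \<and> N \<subseteq> U \<and>
           ind_le n (subtopology X (X frontier_of N))))"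

definition has_ind_dim :: "'a topology \<Rightarrow> nat \<Rightarrow> bool" where
  "has_ind_dim X d \<longleftrightarrow> ind_le (Suc d) X \<and> (\<forall>j\<le>d. \<not> ind_le j X)"

definition cov_le :: "nat \<Rightarrow> 'a topology \<Rightarrow> bool" where
  "cov_le n X \<longleftrightarrow> (\<forall>\<U>. (\<forall>U\<in>\<U>. openin X U) \<and> \<Union>\<U> = topspace X \<longrightarrow>
     (\<exists>\<V>. (\<forall>V\<in>\<V>. openin X V) \<and> \<Union>\<V> = topspace X \<and> (\<forall>V\<in>\<V>. \<exists>U\<in>\<U>. V \<subseteq> U) \<and>
          (\<forall>x\<in>topspace X. finite {V\<in>\<V>. x \<in> V} \<and> card {V\<in>\<V>. x \<in> V} \<le> n + 1)))"

definition has_cov_dim :: "'a topology \<Rightarrow> nat \<Rightarrow> bool" where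
  "has_cov_dim X d \<longleftrightarrow> cov_le d X \<and> (\<forall>j<d. \<not> cov_le j X)"

end

theory Submission
  imports Defs
begin

text \<open>
  Dimension theory. Call a set of a separable metric space decomposable of length \<open>n\<close> (\<open>dec_le n\<close>) if it is a union of \<open>n\<close>
  zero-dimensional subsets. By the countable closed sum theorem for zero-dimensional sets this notion is
  stable under countable closed unions, it is equivalent to inductive dimension at most \<open>n - 1\<close>, and it
  bounds the covering dimension. Conversely a closed cube bounds the covering dimension from below.

  Subgroups. The space of closed subgroups embeds in a space of sequences. A closed subgroup of \<open>G\<close> is
  pulled back to a closed subgroup \<open>V \<oplus> \<Lambda>\<close> of \<open>\<real>\<^sup>n \<times> F\<close>, \<open>n = k + l + m\<close>, that contains the kernel
  \<open>\<int>\<^sup>m\<close> of the covering map, where \<open>V\<close> is a vector space of dimension \<open>a\<close> and \<open>\<Lambda>\<close> has rank \<open>b\<close>. With \<open>V\<close> in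
  reduced form, and up to countably many discrete choices, it is described by \<open>k + m - a\<close> free rows of \<open>a + b\<close> real
  entries, each subject to the \<open>m\<close> independent linear equations saying that the kernel is contained in it.
  As \<open>a + b \<le> n\<close>, this leaves at most \<open>(k + m) * (k + l)\<close> parameters, and the description is locally
  injective and Chabauty continuous. The bound is attained near \<open>\<int>\<^sup>k \<times> \<int>\<^sup>l\<close>.
\<close>

section \<open>Zero-dimensional sets and dimension\<close>

text \<open>Decompositions are glued from countably many closed pieces, but the subgroups of fixed
  ranks do not in general form a closed set. Hence the parameter sets are cut into compact pieces,
  on which a continuous injection is an embedding with closed image. Nondegeneracy of the lattice
  part is an open condition; it enters through an inequality with a fixed constant \<open>c\<close>,
  which is closed and also bounds lattice coordinates uniformly on a piece. Letting \<open>c\<close>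
  run through the naturals loses nothing. The finite group twists the lattice, as a lattice vector
  may carry a nontrivial component in F. This is why the discrete part is not \<int>^b but a
  discrete group \<Gamma> containing \<int>^b, for which there are still only countably many
  possibilities. Rows of integral coordinates contribute no parameters because their entries cannot
  move continuously. The cube directly bounds only the covering dimension; the inductive lower bound
  follows since a bound on the inductive dimension yields a decomposition and so the same bound on
  the covering dimension.\<close>

definition zdim :: "'a::topological_space set \<Rightarrow> bool" where
  "zdim S \<longleftrightarrow> (\<forall>x\<in>S. \<forall>U. open U \<and> x \<in> U \<longrightarrow>
     (\<exists>C. openin (top_of_set S) C \<and> closedin (top_of_set S) C \<and> x \<in> C \<and> C \<subseteq> U))"

lemma zdim_subset:
  assumes "zdim S" "T \<subseteq> S"
  shows "zdim T"
  unfolding zdim_def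
proof (intro ballI allI impI)
  fix x U assume "x \<in> T" "open U \<and> x \<in> U"
  then obtain C where C: "openin (top_of_set S) C" "closedin (top_of_set S) C" "x \<in> C" "C \<subseteq> U"
    using assms unfolding zdim_def by (meson subsetD)
  obtain P Q where P: "open P" "C = S \<inter> P" "closed Q" "C = S \<inter> Q"
    using C(1,2) by (auto simp: openin_open closedin_closed)
  have "openin (top_of_set T) (C \<inter> T)"
    unfolding openin_open using P assms(2) by (intro exI[of _ P]) auto
  moreover have "closedin (top_of_set T) (C \<inter> T)"
    unfolding closedin_closed using P assms(2) by (intro exI[of _ Q]) auto
  ultimately show "\<exists>C. openin (top_of_set T) C \<and> closedin (top_of_set T) C \<and> x \<in> C \<and> C \<subseteq> U"
    using C \<open>x \<in> T\<close> by blast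
qed

text \<open>Clopen sets inside members of the cover already cover \<open>S\<close>, and countably
  many of them suffice by Lindelof. Subtracting the earlier ones leaves open sets because each is
  clopen. Empty parts are allowed so that the index set can always be \<open>nat\<close>.\<close>

lemma zdim_partition:
  fixes S :: "'a::second_countable_topology set"
  assumes "zdim S" "\<And>U. U \<in> \<U> \<Longrightarrow> open U" "S \<subseteq> \<Union>\<U>"
  obtains D :: "nat \<Rightarrow> 'a set" where "\<And>i. openin (top_of_set S) (D i)" "disjoint_family D"
    "(\<Union>i. D i) = S" "\<And>i. D i = {} \<or> (\<exists>U\<in>\<U>. D i \<subseteq> U)"
proof -
  define \<C> where "\<C> = {C. openin (top_of_set S) C \<and> closedin (top_of_set S) C \<and> (\<exists>U\<in>\<U>. C \<subseteq> U)}"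
  have "\<Union>\<C> = S"
  proof
    show "\<Union>\<C> \<subseteq> S" unfolding \<C>_def using openin_imp_subset by fastforce
    show "S \<subseteq> \<Union>\<C>"
    proof
      fix x assume "x \<in> S"
      then obtain U where U: "U \<in> \<U>" "x \<in> U" using assms(3) by blast
      with assms(1) assms(2)[OF U(1)] \<open>x \<in> S\<close> obtain C
        where "openin (top_of_set S) C" "closedin (top_of_set S) C" "x \<in> C" "C \<subseteq> U"
        unfolding zdim_def by meson
      then show "x \<in> \<Union>\<C>" unfolding \<C>_def using U(1) by blast
    qed
  qed
  moreover obtain \<C>' where C': "\<C>' \<subseteq> \<C>" "countable \<C>'" "\<Union>\<C>' = \<Union>\<C>"
    using Lindelof_openin[of \<C> S] unfolding \<C>_def by blast
  ultimately have un: "\<Union>(insert {} \<C>') = S" by simp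
  define A where "A = from_nat_into (insert {} \<C>')"
  have rA: "range A = insert {} \<C>'" unfolding A_def using C'(2) by (simp add: range_from_nat_into)
  have Ai: "A i \<in> insert {} \<C>'" for i using rA by blast
  then have A: "openin (top_of_set S) (A i)" "closedin (top_of_set S) (A i)" for i
    using C'(1) unfolding \<C>_def by (metis (mono_tags, lifting) closedin_empty insert_iff mem_Collect_eq openin_empty subsetD)+
  show thesis
  proof
    show "openin (top_of_set S) (disjointed A i)" for i
      unfolding disjointed_def using A by (intro openin_diff closedin_Union) auto
    show "disjoint_family (disjointed A)" by (rule disjoint_family_disjointed)
    show "(\<Union>i. disjointed A i) = S" using un rA by (simp add: UN_disjointed_eq)
    show "disjointed A i = {} \<or> (\<exists>U\<in>\<U>. disjointed A i \<subseteq> U)" for i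
    proof (cases "A i = {}")
      case True then show ?thesis using disjointed_subset[of A i] by simp
    next
      case False
      then have "A i \<in> \<C>" using Ai[of i] C'(1) by blast
      then obtain U where "U \<in> \<U>" "A i \<subseteq> U" unfolding \<C>_def by blast
      then show ?thesis using disjointed_subset[of A i] by blast
    qed
  qed
qed

text \<open>The partition is taken subordinate to the complements of \<open>A\<close> and
  \<open>B\<close>. No part meets both sets, so the union of the parts that miss \<open>B\<close>
  contains \<open>A\<close>; it is closed since the remaining parts form an open set.\<close>

lemma zdim_separation:
  fixes S :: "'a::second_countable_topology set"
  assumes "zdim S" "closedin (top_of_set S) A" "closedin (top_of_set S) B" "A \<inter> B = {}"
  obtains C where "openin (top_of_set S) C" "closedin (top_of_set S) C" "A \<subseteq> C" "C \<inter> B = {}"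
proof -
  obtain A' B' where AB: "closed A'" "A = S \<inter> A'" "closed B'" "B = S \<inter> B'"
    using assms(2,3) by (auto simp: closedin_closed)
  have "S \<subseteq> \<Union>{-A', -B'}" using AB assms(4) by auto
  then obtain D :: "nat \<Rightarrow> 'a set" where D: "\<And>i. openin (top_of_set S) (D i)" "disjoint_family D"
    "(\<Union>i. D i) = S" "\<And>i. D i = {} \<or> (\<exists>U\<in>{-A', -B'}. D i \<subseteq> U)"
    using zdim_partition[OF assms(1), of "{-A', -B'}"] AB by (auto simp: open_Compl)
  define C where "C = (\<Union>i\<in>{i. D i \<inter> B = {}}. D i)"
  define E where "E = (\<Union>i\<in>{i. D i \<inter> B \<noteq> {}}. D i)"
  have "openin (top_of_set S) E" unfolding E_def using D(1) by auto
  moreover have "S - E = C"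
  proof
    show "S - E \<subseteq> C" using D(3) unfolding C_def E_def by blast
    have "i = j" if "x \<in> D i" "x \<in> D j" for x i j
      using D(2) that unfolding disjoint_family_on_def by blast
    then have "C \<inter> E = {}" unfolding C_def E_def by fastforce
    then show "C \<subseteq> S - E" using D(3) unfolding C_def by blast
  qed
  moreover have "E \<subseteq> S" using D(3) unfolding E_def by blast
  ultimately have "closedin (top_of_set S) C"
    by (metis closedin_diff closedin_topspace topspace_euclidean_subtopology)
  moreover have "openin (top_of_set S) C" unfolding C_def using D(1) by auto
  moreover have "A \<subseteq> C"
  proof
    fix x assume x: "x \<in> A"
    then obtain i where i: "x \<in> D i" using D(3) AB by blast
    have "D i \<subseteq> - B'" using D(4)[of i] x i AB by auto
    then show "x \<in> C" unfolding C_def using i AB by blast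
  qed
  moreover have "C \<inter> B = {}" unfolding C_def by blast
  ultimately show thesis using that by blast
qed

text \<open>Around each point of a part there is a radius within which the whole union belongs to
  that part. Balls of half that radius suffice: if balls about points of two parts met, the larger
  radius would put one centre into the other part.\<close>

lemma disjoint_open_expansion:
  fixes D :: "'i \<Rightarrow> 'a::metric_space set"
  assumes "\<And>i. openin (top_of_set (\<Union>i. D i)) (D i)" "disjoint_family D"
  obtains V where "\<And>i. open (V i)" "\<And>i. D i \<subseteq> V i" "disjoint_family V"
proof -
  have "\<exists>r>0. \<forall>y\<in>(\<Union>j. D j). dist x y < r \<longrightarrow> y \<in> D i" if "x \<in> D i" for i x
    using assms(1)[of i] that unfolding openin_euclidean_subtopology_iff
    by (metis dist_commute)
  then have "\<forall>i x. \<exists>r. x \<in> D i \<longrightarrow> r > 0 \<and> (\<forall>y\<in>(\<Union>j. D j). dist x y < r \<longrightarrow> y \<in> D i)" by blast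
  then obtain r where "\<forall>i x. x \<in> D i \<longrightarrow> r i x > 0 \<and> (\<forall>y\<in>(\<Union>j. D j). dist x y < r i x \<longrightarrow> y \<in> D i)"
    by metis
  then have r: "\<And>i x. x \<in> D i \<Longrightarrow> r i x > 0"
     "\<And>i x y j. \<lbrakk>x \<in> D i; y \<in> D j; dist x y < r i x\<rbrakk> \<Longrightarrow> y \<in> D i"
    by blast+
  define V where "V i = (\<Union>x\<in>D i. ball x (r i x / 2))" for i
  show thesis
  proof
    show "open (V i)" "D i \<subseteq> V i" for i using r(1) unfolding V_def by (auto intro!: bexI)
    show "disjoint_family V"
      unfolding disjoint_family_on_def
    proof (intro ballI impI, rule ccontr)
      fix i j assume ij: "i \<noteq> j" "V i \<inter> V j \<noteq> {}"
      then obtain x y z where x: "x \<in> D i" "dist x z < r i x / 2" and y: "y \<in> D j" "dist y z < r j y / 2"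
        unfolding V_def by auto
      have "dist x y \<le> dist x z + dist y z" by (metis dist_triangle2)
      then have "dist x y < r i x \<or> dist y x < r j y" using x y by (simp add: dist_commute, linarith)
      then have "D i \<inter> D j \<noteq> {}" using r(2) x y by blast
      then show False using assms(2) ij unfolding disjoint_family_on_def by blast
    qed
  qed
qed

lemma Urysohn_metric:
  fixes S :: "'a::metric_space set"
  assumes "closedin (top_of_set S) A" "closedin (top_of_set S) B" "A \<inter> B = {}"
  obtains f :: "'a \<Rightarrow> real" where "continuous_on S f" "\<And>x. x \<in> A \<Longrightarrow> f x = 0" "\<And>x. x \<in> B \<Longrightarrow> f x = 1"
proof -
  have "normal_space (top_of_set S)"
    by (simp add: metrizable_imp_normal_space metrizable_space_euclidean metrizable_space_subtopology)
  then obtain f where "continuous_map (top_of_set S) euclideanreal f" "f ` A \<subseteq> {0}" "f ` B \<subseteq> {1}"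
    using Urysohn_lemma_alt[OF _ assms(1,2)] assms(3) by (metis disjnt_def)
  then show thesis using that[of f] by auto
qed

text \<open>Disjoint closed sets \<open>A n\<close> and \<open>B n\<close> grow from the pair
  \<open>{x}\<close> and \<open>S - U\<close>, while the sets \<open>F n\<close> are shared out one
  by one between the two sides. Relation \<open>Q n\<close> demands relatively open sets between
  consecutive stages, so both unions are open; they are disjoint and exhaust \<open>S\<close>, hence
  clopen.\<close>

lemma zdim_countable_closed_Union:
  fixes F :: "nat \<Rightarrow> 'a::{metric_space,second_countable_topology} set"
  assumes "\<And>i. closedin (top_of_set (\<Union>i. F i)) (F i)" "\<And>i. zdim (F i)"
  shows "zdim (\<Union>i. F i)"
proof -
  define S where "S = (\<Union>i. F i)"
  let ?T = "top_of_set S"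
  define P where "P = (\<lambda>(A, B). closedin ?T A \<and> closedin ?T B \<and> A \<inter> B = {})"
  define Q where "Q n = (\<lambda>(A, B) (A', B'). \<exists>U V. openin ?T U \<and> openin ?T V \<and> A \<subseteq> U \<and> U \<subseteq> A' \<and> B \<subseteq> V
     \<and> V \<subseteq> B' \<and> F n \<subseteq> U \<union> V)" for n
  have step: "\<exists>y. P y \<and> Q n x y" if "P x" for n x
  proof -
    obtain A B where x: "x = (A, B)" by fastforce
    have AB: "closedin ?T A" "closedin ?T B" "A \<inter> B = {}" using that x unfolding P_def by auto
    have Fn: "F n \<subseteq> S" "closedin ?T (F n)" using assms(1)[of n] unfolding S_def by auto
    have c: "closedin (top_of_set (F n)) (F n \<inter> X)" if "closedin ?T X" for X
      using that Fn unfolding closedin_closed by (smt (verit) Int_assoc Int_absorb1 Int_commute)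
    obtain C where C: "openin (top_of_set (F n)) C" "closedin (top_of_set (F n)) C"
       "F n \<inter> A \<subseteq> C" "C \<inter> (F n \<inter> B) = {}"
    proof (rule zdim_separation[OF assms(2) c[OF AB(1)] c[OF AB(2)]])
      show "F n \<inter> A \<inter> (F n \<inter> B) = {}" using AB(3) by blast
    qed
    have C2: "closedin (top_of_set (F n)) (F n - C)" using C(1)
      by (metis closedin_diff closedin_topspace topspace_euclidean_subtopology)
    have "C \<subseteq> F n" using C(1) openin_imp_subset by blast
    have cl: "closedin ?T (A \<union> C)" "closedin ?T (B \<union> (F n - C))"
      using AB C(2) C2 Fn(2) closedin_trans closedin_Un by blast+
    have dj: "(A \<union> C) \<inter> (B \<union> (F n - C)) = {}" using AB C \<open>C \<subseteq> F n\<close> by blast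
    obtain f :: "'a \<Rightarrow> real" where f: "continuous_on S f"
        "\<And>x. x \<in> A \<union> C \<Longrightarrow> f x = 0" "\<And>x. x \<in> B \<union> (F n - C) \<Longrightarrow> f x = 1"
      using Urysohn_metric[OF cl dj] by blast
    \<comment> \<open>The gap between 1/3 and 2/3 gives room for open sets \<open>U\<close>,
      \<open>V\<close> inside closed sets \<open>A'\<close>, \<open>B'\<close> that are still
      disjoint, which is the invariant \<open>P\<close> of the next stage.\<close>
    define U V where "U = S \<inter> f -` {..<1/3}" and "V = S \<inter> f -` {2/3<..}"
    define A' B' where "A' = S \<inter> f -` {..1/3}" and "B' = S \<inter> f -` {2/3..}"
    have "openin ?T U" "openin ?T V" "closedin ?T A'" "closedin ?T B'"
      unfolding U_def V_def A'_def B'_def using f(1)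
      by (auto intro!: continuous_openin_preimage_gen continuous_closedin_preimage)
    moreover have "A' \<inter> B' = {}" "U \<subseteq> A'" "V \<subseteq> B'" unfolding U_def V_def A'_def B'_def by auto
    moreover have "A \<union> C \<subseteq> S" "B \<union> (F n - C) \<subseteq> S" using cl closedin_imp_subset by blast+
    then have "A \<union> C \<subseteq> U" "B \<union> (F n - C) \<subseteq> V" unfolding U_def V_def using f(2,3) by (simp_all add: subset_iff)
    then have "A \<subseteq> U" "B \<subseteq> V" "F n \<subseteq> U \<union> V" by blast+
    ultimately have "P (A', B')" "Q n x (A', B')"
      unfolding P_def Q_def x prod.case by (simp, intro exI[of _ U] exI[of _ V], simp)
    then show ?thesis by blast
  qed
  show ?thesis
    unfolding zdim_def S_def[symmetric]
  proof (intro ballI allI impI)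
    fix x U assume x: "x \<in> S" and U: "open U \<and> x \<in> U"
    have "closedin ?T {x}" using x by (auto simp: closedin_closed intro!: exI[of _ "{x}"])
    moreover have "closedin ?T (S - U)" using U by (auto simp: closedin_closed intro!: exI[of _ "-U"])
    ultimately have P0: "P ({x}, S - U)" unfolding P_def using U by auto
    obtain X where X0: "X 0 = ({x}, S - U)" and X: "\<And>n. P (X n)" "\<And>n. Q n (X n) (X (Suc n))"
    proof -
      have "\<exists>f. \<forall>n. (P (f n) \<and> (n = 0 \<longrightarrow> f n = ({x}, S - U))) \<and> Q n (f n) (f (Suc n))"
        by (rule dependent_nat_choice) (use P0 step in auto)
      then show thesis using that by blast
    qed
    define A B where "A n = fst (X n)" and "B n = snd (X n)" for n
    have PX: "closedin ?T (A n)" "closedin ?T (B n)" "A n \<inter> B n = {}" for n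
      using X(1)[of n] unfolding P_def A_def B_def by (auto simp: case_prod_beta)
    have "\<exists>U V. openin ?T U \<and> openin ?T V \<and> A n \<subseteq> U \<and> U \<subseteq> A (Suc n) \<and> B n \<subseteq> V
     \<and> V \<subseteq> B (Suc n) \<and> F n \<subseteq> U \<union> V" for n
      using X(2)[of n] unfolding Q_def A_def B_def by (auto simp: case_prod_beta)
    then obtain U' V' where UV: "\<And>n. openin ?T (U' n)" "\<And>n. openin ?T (V' n)"
       "\<And>n. A n \<subseteq> U' n" "\<And>n. U' n \<subseteq> A (Suc n)" "\<And>n. B n \<subseteq> V' n" "\<And>n. V' n \<subseteq> B (Suc n)"
       "\<And>n. F n \<subseteq> U' n \<union> V' n" by metis
    define C D where "C = (\<Union>n. U' n)" and "D = (\<Union>n. V' n)"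
    have mA: "A i \<subseteq> A j" if "i \<le> j" for i j by (rule lift_Suc_mono_le[OF _ that]) (use UV in blast)
    have mB: "B i \<subseteq> B j" if "i \<le> j" for i j by (rule lift_Suc_mono_le[OF _ that]) (use UV in blast)
    have CD: "C \<inter> D = {}"
    proof (rule ccontr)
      assume "C \<inter> D \<noteq> {}"
      then obtain i j z where "z \<in> A (Suc i)" "z \<in> B (Suc j)" unfolding C_def D_def using UV by blast
      then have "z \<in> A (max (Suc i) (Suc j))" "z \<in> B (max (Suc i) (Suc j))"
        using mA mB by (meson max.cobounded1 max.cobounded2 subsetD)+
      then show False using PX by blast
    qed
    have o: "openin ?T C" "openin ?T D" unfolding C_def D_def using UV by blast+
    have S: "C \<union> D = S"
    proof
      show "C \<union> D \<subseteq> S" using o openin_imp_subset by blast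
      show "S \<subseteq> C \<union> D" unfolding S_def C_def D_def using UV(7) by blast
    qed
    have "C = S - D" using CD S by blast
    then have "closedin ?T C" using o(2) by (metis closedin_diff closedin_topspace topspace_euclidean_subtopology)
    moreover have "x \<in> C" unfolding C_def using UV(3)[of 0] X0 unfolding A_def by auto
    moreover have "C \<subseteq> U" 
      using UV(5)[of 0] X0 CD o(1) openin_imp_subset[OF o(1)] unfolding B_def D_def by auto
    ultimately show "\<exists>C. openin ?T C \<and> closedin ?T C \<and> x \<in> C \<and> C \<subseteq> U"
      using o(1) by blast
  qed
qed

section \<open>Finite unions of zero-dimensional sets\<close>

primrec dec_le :: "nat \<Rightarrow> 'a::topological_space set \<Rightarrow> bool" where
  "dec_le 0 S = (S = {})"
| "dec_le (Suc n) S = (\<exists>Z Y. S = Z \<union> Y \<and> zdim Z \<and> dec_le n Y)"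

text \<open>The summands need be neither closed nor disjoint, so a decomposition restricts to an
  arbitrary subset.\<close>

lemma dec_le_subset: "dec_le n S \<Longrightarrow> T \<subseteq> S \<Longrightarrow> dec_le n T"
proof (induction n arbitrary: S T)
  case (Suc n)
  then obtain Z Y where "S = Z \<union> Y" "zdim Z" "dec_le n Y" by auto
  then have "T = (T \<inter> Z) \<union> (T \<inter> Y)" "zdim (T \<inter> Z)" "dec_le n (T \<inter> Y)"
    using Suc zdim_subset by (blast, meson inf_le2, meson inf_le2)
  then show ?case by (auto intro: exI[of _ "T \<inter> Z"])
qed simp

lemma dec_le_mono:
  assumes "dec_le n S" "n \<le> m"
  shows "dec_le m S"
proof -
  have "dec_le (n + d) S" for d
  proof (induction d)
    case (Suc d)
    have "zdim {}" by (simp add: zdim_def)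
    with Suc show ?case by (metis Un_empty_left add_Suc_right dec_le.simps(2))
  qed (use assms in simp)
  then show ?thesis using assms(2) by (metis le_add_diff_inverse)
qed

lemma open_countable_Union_closed:
  fixes U :: "'a::metric_space set"
  assumes "open U"
  obtains c :: "nat \<Rightarrow> 'a set" where "\<And>m. closed (c m)" "U = (\<Union>m. c m)"
\<comment> \<open>\<open>infdist\<close> to the empty set is 0, so the formula for
  \<open>c m\<close> below would yield empty sets if \<open>U\<close> were the whole space.\<close>
proof (cases "U = UNIV")
  case True then show thesis using that[of "\<lambda>_. UNIV"] by auto
next
  case False
  define c where "c m = {x. 1 / real (Suc m) \<le> infdist x (-U)}" for m
  have "closed (c m)" for m unfolding c_def by (intro closed_Collect_le continuous_intros)
  moreover have "U = (\<Union>m. c m)"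
  proof (intro set_eqI iffI)
    fix x assume "x \<in> U"
    moreover have "closed (-U)" "-U \<noteq> {}" using assms False by auto
    ultimately have "infdist x (-U) > 0" by (metis ComplD infdist_pos_not_in_closed)
    then obtain m where "1 / real (Suc m) < infdist x (-U)" using nat_approx_posE by blast
    then show "x \<in> (\<Union>m. c m)" unfolding c_def by (auto intro: less_imp_le)
  next
    fix x assume "x \<in> (\<Union>m. c m)"
    then obtain m where "1 / real (Suc m) \<le> infdist x (-U)" unfolding c_def by auto
    moreover have "(0::real) < 1 / real (Suc m)" by simp
    ultimately have "infdist x (-U) \<noteq> 0" by linarith
    then show "x \<in> U" using infdist_zero[of x "-U"] by blast
  qed
  ultimately show thesis using that by blast
qed

text \<open>The given sets overlap, so collecting the summands of each of them gives nothing closed.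
  The disjoint differences \<open>K i\<close> are countable unions of closed traces
  \<open>S \<inter> C i m\<close>. Because the \<open>K i\<close> are disjoint, cutting the union of
  all \<open>Z j\<close> by \<open>C i m\<close> leaves a part of \<open>Z i\<close> alone, and this
  part is closed in that union. The zero-dimensional sum theorem then applies, and the induction
  hypothesis treats the \<open>Y j\<close> in the same way.\<close>

lemma dec_le_countable_closed_Union:
  fixes F :: "nat \<Rightarrow> 'a::{metric_space,second_countable_topology} set"
  assumes "\<And>i. closedin (top_of_set (\<Union>i. F i)) (F i)" "\<And>i. dec_le n (F i)"
  shows "dec_le n (\<Union>i. F i)"
  using assms
proof (induction n arbitrary: F)
  case (Suc n)
  define S where "S = (\<Union>i. F i)"
  define K where "K = disjointed F"
  have KF: "K i \<subseteq> F i" for i unfolding K_def by (rule disjointed_subset)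
  have Kd: "disjoint_family K" unfolding K_def by (rule disjoint_family_disjointed)
  have KS: "(\<Union>i. K i) = S" unfolding K_def S_def by (rule UN_disjointed_eq)
  have "\<exists>C. (\<forall>m::nat. closed (C m)) \<and> K i = S \<inter> (\<Union>m. C m)" for i
  proof -
    have Fc: "closedin (top_of_set S) (F j)" for j using Suc.prems(1) unfolding S_def by simp
    then obtain G where G: "\<And>j. closed (G j)" "\<And>j. F j = S \<inter> G j"
      unfolding closedin_closed by metis
    have "open (- (\<Union>j\<in>{0..<i}. G j))" using G by auto
    then obtain c :: "nat \<Rightarrow> 'a set" where c: "\<And>m. closed (c m)" "- (\<Union>j\<in>{0..<i}. G j) = (\<Union>m. c m)"
      using open_countable_Union_closed by metis
    have "K i = F i - (\<Union>j\<in>{0..<i}. F j)" unfolding K_def disjointed_def ..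
    also have "\<dots> = S \<inter> (G i \<inter> (\<Union>m. c m))" unfolding c(2)[symmetric] G(2) by blast
    finally show ?thesis using c(1) G(1) by (intro exI[of _ "\<lambda>m. G i \<inter> c m"]) auto
  qed
  then obtain C :: "nat \<Rightarrow> nat \<Rightarrow> 'a set" where C: "\<And>i m. closed (C i m)" "\<And>i. K i = S \<inter> (\<Union>m. C i m)"
    by metis
  have "\<exists>Z Y. K i = Z \<union> Y \<and> zdim Z \<and> dec_le n Y" for i
    using dec_le_subset[OF Suc.prems(2) KF, of i] by simp
  then obtain Z Y where ZY: "\<And>i. K i = Z i \<union> Y i" "\<And>i. zdim (Z i)" "\<And>i. dec_le n (Y i)" by metis
  \<comment> \<open>Stated for arbitrary \<open>X i\<close> inside \<open>K i\<close>, since it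
    serves both for the zero-dimensional summands \<open>Z\<close> and for the remainders
    \<open>Y\<close>.\<close>
  have pieces: "(\<Union>r. case prod_decode r of (i, m) \<Rightarrow> (\<Union>j. X j) \<inter> C i m) = (\<Union>j. X j)"
    "\<And>r. closedin (top_of_set (\<Union>j. X j)) (case prod_decode r of (i, m) \<Rightarrow> (\<Union>j. X j) \<inter> C i m)"
    "\<And>i m. (\<Union>j. X j) \<inter> C i m \<subseteq> X i"
    if X: "\<And>i. X i \<subseteq> K i" for X
  proof -
    show "(\<Union>r. case prod_decode r of (i, m) \<Rightarrow> (\<Union>j. X j) \<inter> C i m) = (\<Union>j. X j)"
    proof
      show "(\<Union>j. X j) \<subseteq> (\<Union>r. case prod_decode r of (i, m) \<Rightarrow> (\<Union>j. X j) \<inter> C i m)"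
      proof
        fix x assume x: "x \<in> (\<Union>j. X j)"
        then obtain i m where "x \<in> C i m" using X C(2) by blast
        then show "x \<in> (\<Union>r. case prod_decode r of (i, m) \<Rightarrow> (\<Union>j. X j) \<inter> C i m)"
          using x by (intro UN_I[of "prod_encode (i, m)"]) auto
      qed
    qed (auto split: prod.splits)
    show "closedin (top_of_set (\<Union>j. X j)) (case prod_decode r of (i, m) \<Rightarrow> (\<Union>j. X j) \<inter> C i m)" for r
      using C(1) by (auto simp: closedin_closed split: prod.splits)
    show "(\<Union>j. X j) \<inter> C i m \<subseteq> X i" for i m
    proof
      fix x assume x: "x \<in> (\<Union>j. X j) \<inter> C i m"
      then obtain j where j: "x \<in> X j" by blast
      then have "x \<in> K j" "x \<in> K i" using X x C(2) by blast+
      then have "i = j" using Kd unfolding disjoint_family_on_def by blast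
      then show "x \<in> X i" using j by simp
    qed
  qed
  have ZK: "\<And>i. Z i \<subseteq> K i" and YK: "\<And>i. Y i \<subseteq> K i" using ZY by auto
  have "zdim (\<Union>r. case prod_decode r of (i, m) \<Rightarrow> (\<Union>j. Z j) \<inter> C i m)"
  proof (rule zdim_countable_closed_Union)
    fix r
    obtain i m where r: "prod_decode r = (i, m)" by fastforce
    show "zdim (case prod_decode r of (i, m) \<Rightarrow> (\<Union>j. Z j) \<inter> C i m)"
      unfolding r prod.case by (rule zdim_subset[OF ZY(2) pieces(3)[of Z, OF ZK]])
  qed (simp only: pieces[of Z, OF ZK])
  then have 1: "zdim (\<Union>j. Z j)" by (simp only: pieces[of Z, OF ZK])
  have "dec_le n (\<Union>r. case prod_decode r of (i, m) \<Rightarrow> (\<Union>j. Y j) \<inter> C i m)"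
  proof (rule Suc.IH)
    fix r
    obtain i m where r: "prod_decode r = (i, m)" by fastforce
    show "dec_le n (case prod_decode r of (i, m) \<Rightarrow> (\<Union>j. Y j) \<inter> C i m)"
      unfolding r prod.case by (rule dec_le_subset[OF ZY(3) pieces(3)[of Y, OF YK]])
  qed (simp only: pieces[of Y, OF YK])
  then have 2: "dec_le n (\<Union>j. Y j)" by (simp only: pieces[of Y, OF YK])
  have "S = (\<Union>j. Z j) \<union> (\<Union>j. Y j)" using KS ZY(1) by blast
  then show ?case using 1 2 unfolding S_def[symmetric] by auto
qed simp

lemma dec_le_countable_closed_Union_set:
  fixes \<F> :: "'a::{metric_space,second_countable_topology} set set"
  assumes "countable \<F>" "\<And>F. F \<in> \<F> \<Longrightarrow> closedin (top_of_set (\<Union>\<F>)) F" "\<And>F. F \<in> \<F> \<Longrightarrow> dec_le n F"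
  shows "dec_le n (\<Union>\<F>)"
proof -
  define A where "A = from_nat_into (insert {} \<F>)"
  have rA: "range A = insert {} \<F>" unfolding A_def using assms(1) by (intro range_from_nat_into) auto
  have Ai: "A i \<in> insert {} \<F>" for i using rA by blast
  have u: "(\<Union>i. A i) = \<Union>\<F>" using rA by auto
  have e: "dec_le n ({}::'a set)" by (rule dec_le_mono[of 0]) auto
  have "dec_le n (\<Union>i. A i)"
  proof (rule dec_le_countable_closed_Union)
    show "closedin (top_of_set (\<Union>i. A i)) (A i)" for i
      unfolding u using Ai[of i] assms(2) by auto
    show "dec_le n (A i)" for i using Ai[of i] assms(3) e by auto
  qed
  then show ?thesis unfolding u .
qed

text \<open>The frontier lies in \<open>Y\<close> as soon as it avoids \<open>Z\<close>. A partition
  of \<open>Z\<close> separating a small ball from the outside of a larger one is extended to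
  disjoint open sets of the ambient space; the complement of the outer one has all its points of
  \<open>Z\<close> in its interior.\<close>

lemma dec_imp_ind_le:
  fixes S :: "'a::{metric_space,second_countable_topology} set"
  assumes "dec_le n S"
  shows "ind_le n (top_of_set S)"
  using assms
proof (induction n arbitrary: S)
  case (Suc n)
  let ?T = "top_of_set S"
  from Suc.prems obtain Z Y where ZY: "S = Z \<union> Y" "zdim Z" "dec_le n Y" by auto
  have "\<exists>N. closedin ?T N \<and> x \<in> ?T interior_of N \<and> N \<subseteq> W \<and> ind_le n (subtopology ?T (?T frontier_of N))"
    if xW: "x \<in> S" "openin ?T W" "x \<in> W" for x W
  proof -
    obtain e where e: "e > 0" "ball x e \<inter> S \<subseteq> W" using xW unfolding openin_contains_ball by blast
    have cA: "closedin (top_of_set Z) (Z \<inter> cball x (e/3))" "closedin (top_of_set Z) (Z \<inter> (- ball x (e/2)))"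
      by (intro closedin_closed_Int closed_cball closed_Compl open_ball)+
    have "Z \<inter> cball x (e/3) \<inter> (Z \<inter> (- ball x (e/2))) = {}" using e by auto
    then obtain C where C: "openin (top_of_set Z) C" "closedin (top_of_set Z) C"
      "Z \<inter> cball x (e/3) \<subseteq> C" "C \<inter> (Z \<inter> (- ball x (e/2))) = {}"
      using zdim_separation[OF ZY(2) cA] by blast
    obtain P P' where P: "open P" "C = Z \<inter> P" "closed P'" "C = Z \<inter> P'"
      using C(1,2) by (auto simp: openin_open closedin_closed)
    have Cb: "C \<subseteq> ball x (e/2)" using C(4) P(2) by auto
    \<comment> \<open>\<open>D1\<close> contains a ball about \<open>x\<close>, which makes
      \<open>x\<close> interior, and \<open>D2\<close> all points of \<open>S\<close> farther than
      3e/4, which keeps \<open>N\<close> within distance e. Together they contain \<open>Z\<close>.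
      The open sets \<open>O1\<close>, \<open>O2\<close> show that each is relatively open in their
      union; the radii e/4 < e/3 < e/2 < 2e/3 < 3e/4 leave the strict gaps for that.\<close>
    define D1 D2 where "D1 = (S \<inter> ball x (e/4)) \<union> C" and "D2 = (S \<inter> (- cball x (3*e/4))) \<union> (Z - C)"
    define O1 O2 where "O1 = ball x (e/3) \<union> (P \<inter> ball x (e/2))"
      and "O2 = (- cball x (2*e/3)) \<union> ((- P') \<inter> (- cball x (e/4)))"
    have o: "open O1" "open O2" unfolding O1_def O2_def using P by auto
    have "D1 \<subseteq> O1" unfolding D1_def O1_def using e Cb P by auto
    moreover have "D2 \<subseteq> O2" unfolding D2_def O2_def
    proof (rule Un_least)
      show "S \<inter> - cball x (3 * e / 4) \<subseteq> - cball x (2 * e / 3) \<union> - P' \<inter> - cball x (e / 4)" using e by auto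
      show "Z - C \<subseteq> - cball x (2 * e / 3) \<union> - P' \<inter> - cball x (e / 4)"
      proof
        fix z assume z: "z \<in> Z - C"
        then have "\<not> dist x z \<le> e/3" using C(3) by auto
        then show "z \<in> - cball x (2 * e / 3) \<union> - P' \<inter> - cball x (e / 4)" using z P(4) e by auto
      qed
    qed
    moreover have "D2 \<inter> O1 = {}"
    proof -
      have "(Z - C) \<inter> ball x (e/3) = {}" using C(3) by (auto simp: less_imp_le)
      moreover have "(Z - C) \<inter> P = {}" using P by blast
      moreover have "(- cball x (3*e/4)) \<inter> ball x (e/3) = {}" "(- cball x (3*e/4)) \<inter> ball x (e/2) = {}"
        using e by auto
      ultimately show ?thesis unfolding D2_def O1_def by blast
    qed
    moreover have "D1 \<inter> O2 = {}"
    proof -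
      have "ball x (e/2) \<inter> (- cball x (2*e/3)) = {}" "ball x (e/4) \<inter> (- cball x (2*e/3)) = {}"
        "ball x (e/4) \<inter> (- cball x (e/4)) = {}" using e by auto
      moreover have "C \<inter> - P' = {}" using P by blast
      ultimately show ?thesis unfolding D1_def O2_def using Cb by blast
    qed
    ultimately have sep: "D1 = (D1 \<union> D2) \<inter> O1" "D2 = (D1 \<union> D2) \<inter> O2" by blast+
    define D where "D i = (if i then D1 else D2)" for i
    have uD: "(\<Union>i. D i) = D1 \<union> D2" unfolding D_def by (auto split: if_splits)
    have "openin (top_of_set (\<Union>i. D i)) (D i)" for i
      unfolding uD openin_open D_def using sep o by (cases i) auto
    moreover have "D1 \<inter> D2 = {}" using \<open>D1 \<inter> O2 = {}\<close> \<open>D2 \<subseteq> O2\<close> by blast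
    then have "disjoint_family D" unfolding disjoint_family_on_def D_def by auto
    ultimately obtain V where V: "\<And>i. open (V i)" "\<And>i. D i \<subseteq> V i" "disjoint_family V"
      using disjoint_open_expansion by metis
    have V': "open (V True)" "open (V False)" "D1 \<subseteq> V True" "D2 \<subseteq> V False" "V True \<inter> V False = {}"
      using V(1) V(2)[of True] V(2)[of False] disjoint_family_onD[OF V(3), of True False]
      unfolding D_def by auto
    define N where "N = S - V False"
    have clN: "closedin ?T N" unfolding N_def closedin_closed using V'(2) by (auto intro!: exI[of _ "- V False"])
    have int: "S \<inter> V True \<subseteq> ?T interior_of N"
      by (rule interior_of_maximal) (use V' in \<open>auto simp: N_def openin_open\<close>)
    have "x \<in> ?T interior_of N" using int V'(3) xW(1) e unfolding D1_def by auto
    moreover have "N \<subseteq> W"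
    proof
      fix y assume y: "y \<in> N"
      then have "y \<notin> D2" "y \<in> S" using V' unfolding N_def by auto
      then have "dist x y < e" unfolding D2_def using e by auto
      then show "y \<in> W" using e(2) \<open>y \<in> S\<close> by auto
    qed
    moreover have "?T frontier_of N \<subseteq> Y"
    proof
      fix y assume y: "y \<in> ?T frontier_of N"
      then have yN: "y \<in> N" "y \<notin> ?T interior_of N"
        using clN by (auto simp: frontier_of_def closure_of_closedin)
      have "y \<notin> Z"
      proof
        assume "y \<in> Z"
        then have "y \<in> C" using yN(1) V'(4) unfolding N_def D2_def by blast
        then have "y \<in> S \<inter> V True" using V'(3) ZY(1) \<open>y \<in> Z\<close> unfolding D1_def by blast
        then show False using int yN(2) by blast
      qed
      then show "y \<in> Y" using yN(1) ZY(1) unfolding N_def by blast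
    qed
    then have "ind_le n (top_of_set (?T frontier_of N))" using Suc.IH dec_le_subset ZY(3) by blast
    moreover have "?T frontier_of N \<subseteq> S" using frontier_of_subset_topspace[of ?T N] by simp
    ultimately show ?thesis using clN by (metis subtopology_subtopology Int_absorb1)
  qed
  then show ?case by auto
qed simp

text \<open>Each zero-dimensional summand is covered by pairwise disjoint open sets, so it adds at
  most one member through any point, also through points outside \<open>S\<close>.\<close>

lemma dec_le_refinement:
  fixes S :: "'a::{metric_space,second_countable_topology} set"
  assumes "dec_le n S" "\<And>U. U \<in> \<U> \<Longrightarrow> open U" "S \<subseteq> \<Union>\<U>"
  shows "\<exists>\<V>. (\<forall>V\<in>\<V>. open V \<and> (\<exists>U\<in>\<U>. V \<subseteq> U)) \<and> S \<subseteq> \<Union>\<V> \<and>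
     (\<forall>x. finite {V\<in>\<V>. x \<in> V} \<and> card {V\<in>\<V>. x \<in> V} \<le> n)"
  using assms(1,3)
proof (induction n arbitrary: S)
  case 0
  then show ?case by (intro exI[of _ "{}"]) auto
next
  case (Suc n)
  then obtain Z Y where ZY: "S = Z \<union> Y" "zdim Z" "dec_le n Y" by auto
  have "Y \<subseteq> \<Union>\<U>" "Z \<subseteq> \<Union>\<U>" using Suc.prems(2) ZY(1) by auto
  from Suc.IH[OF ZY(3) this(1)] obtain \<V> where \<V>: "\<And>V. V \<in> \<V> \<Longrightarrow> open V \<and> (\<exists>U\<in>\<U>. V \<subseteq> U)" "Y \<subseteq> \<Union>\<V>"
    "\<And>x. finite {V\<in>\<V>. x \<in> V} \<and> card {V\<in>\<V>. x \<in> V} \<le> n" by auto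
  obtain D :: "nat \<Rightarrow> 'a set" where D: "\<And>i. openin (top_of_set Z) (D i)" "disjoint_family D"
    "(\<Union>i. D i) = Z" "\<And>i. D i = {} \<or> (\<exists>U\<in>\<U>. D i \<subseteq> U)"
    using zdim_partition[OF ZY(2) assms(2) \<open>Z \<subseteq> \<Union>\<U>\<close>] by metis
  have "\<And>i. openin (top_of_set (\<Union>i. D i)) (D i)" using D by simp
  then obtain W where W: "\<And>i. open (W i)" "\<And>i. D i \<subseteq> W i" "disjoint_family W"
    using disjoint_open_expansion[OF _ D(2)] by metis
  have "\<forall>i. \<exists>U. open U \<and> D i \<subseteq> U \<and> (U = {} \<or> U \<in> \<U>)" using D(4) assms(2) by (metis open_empty order_refl)
  then obtain U where U: "\<And>i. open (U i)" "\<And>i. D i \<subseteq> U i" "\<And>i. U i = {} \<or> U i \<in> \<U>" by metis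
  define W' where "W' i = W i \<inter> U i" for i
  \<comment> \<open>Indices with \<open>U i\<close> empty belong to empty parts; they are dropped
    since an empty \<open>U i\<close> need not be a member of the cover.\<close>
  define \<W> where "\<W> = W' ` {i. U i \<noteq> {}}"
  have W'disj: "i = j" if "x \<in> W' i" "x \<in> W' j" for x i j
    using W(3) that unfolding disjoint_family_on_def W'_def by blast
  show ?case
  proof (intro exI[of _ "\<V> \<union> \<W>"] conjI ballI allI)
    fix V assume "V \<in> \<V> \<union> \<W>"
    then show "open V" "\<exists>U\<in>\<U>. V \<subseteq> U"
      using \<V>(1) W(1) U(1) U(3) unfolding \<W>_def W'_def by (blast, blast)
  next
    show "S \<subseteq> \<Union>(\<V> \<union> \<W>)"
    proof
      fix x assume x: "x \<in> S"
      show "x \<in> \<Union>(\<V> \<union> \<W>)"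
      proof (cases "x \<in> Y")
        case True then show ?thesis using \<V>(2) by blast
      next
        case False
        then obtain i where i: "x \<in> D i" using x ZY(1) D(3) by blast
        then have "x \<in> W' i" "U i \<noteq> {}" using W(2) U(2) unfolding W'_def by blast+
        then show ?thesis unfolding \<W>_def by blast
      qed
    qed
  next
    fix x
    have "\<exists>i. {V \<in> \<W>. x \<in> V} \<subseteq> {W' i}" unfolding \<W>_def using W'disj by blast
    then obtain i where i: "{V \<in> \<W>. x \<in> V} \<subseteq> {W' i}" by blast
    then have c: "finite {V \<in> \<W>. x \<in> V}" "card {V \<in> \<W>. x \<in> V} \<le> 1"
      using finite_subset card_mono[OF _ i] by auto
    have e: "{V \<in> \<V> \<union> \<W>. x \<in> V} = {V \<in> \<V>. x \<in> V} \<union> {V \<in> \<W>. x \<in> V}" by blast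
    show "finite {V \<in> \<V> \<union> \<W>. x \<in> V}" unfolding e using \<V>(3) c by blast
    have "card {V \<in> \<V> \<union> \<W>. x \<in> V} \<le> card {V \<in> \<V>. x \<in> V} + card {V \<in> \<W>. x \<in> V}"
      unfolding e by (rule card_Un_le)
    also have "\<dots> \<le> n + 1" using \<V>(3)[of x] c by (intro add_mono) auto
    finally show "card {V \<in> \<V> \<union> \<W>. x \<in> V} \<le> Suc n" by simp
  qed
qed

text \<open>\<open>Suc n\<close> summands give a refinement with at most n + 1 members through a
  point. What is left is the translation between relatively open covers and covers by open sets of
  the ambient space.\<close>

lemma dec_imp_cov_le:
  fixes S :: "'a::{metric_space,second_countable_topology} set"
  assumes "dec_le (Suc n) S"
  shows "cov_le n (top_of_set S)"
  unfolding cov_le_def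
proof (intro allI impI)
  fix \<U> assume \<U>: "(\<forall>U\<in>\<U>. openin (top_of_set S) U) \<and> \<Union>\<U> = topspace (top_of_set S)"
  define \<U>' where "\<U>' = {U. open U \<and> S \<inter> U \<in> \<U>}"
  have "S \<subseteq> \<Union>\<U>'"
  proof
    fix x assume "x \<in> S"
    then obtain U where "U \<in> \<U>" "x \<in> U" using \<U> by auto
    moreover then obtain T where "open T" "U = S \<inter> T" using \<U> by (auto simp: openin_open)
    ultimately show "x \<in> \<Union>\<U>'" unfolding \<U>'_def by auto
  qed
  then obtain \<V> where \<V>: "\<And>V. V \<in> \<V> \<Longrightarrow> open V \<and> (\<exists>U\<in>\<U>'. V \<subseteq> U)" "S \<subseteq> \<Union>\<V>"
    "\<And>x. finite {V\<in>\<V>. x \<in> V} \<and> card {V\<in>\<V>. x \<in> V} \<le> Suc n"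
    using dec_le_refinement[OF assms, of \<U>'] unfolding \<U>'_def by auto
  let ?W = "(\<inter>) S ` \<V>"
  show "\<exists>\<V>. (\<forall>V\<in>\<V>. openin (top_of_set S) V) \<and> \<Union>\<V> = topspace (top_of_set S) \<and> (\<forall>V\<in>\<V>. \<exists>U\<in>\<U>. V \<subseteq> U) \<and>
          (\<forall>x\<in>topspace (top_of_set S). finite {V\<in>\<V>. x \<in> V} \<and> card {V\<in>\<V>. x \<in> V} \<le> n + 1)"
  proof (intro exI[of _ ?W] conjI ballI)
    show "openin (top_of_set S) V" if "V \<in> ?W" for V using that \<V>(1) by auto
    show "\<Union>?W = topspace (top_of_set S)" using \<V>(2) by auto
    show "\<exists>U\<in>\<U>. V \<subseteq> U" if V: "V \<in> ?W" for V
    proof -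
      obtain V' U where "V' \<in> \<V>" "V = S \<inter> V'" "U \<in> \<U>'" "V' \<subseteq> U" using V \<V>(1) by blast
      then show ?thesis unfolding \<U>'_def by (intro bexI[of _ "S \<inter> U"]) auto
    qed
    fix x
    have e: "{V \<in> ?W. x \<in> V} \<subseteq> (\<inter>) S ` {V \<in> \<V>. x \<in> V}" by auto
    show "finite {V \<in> ?W. x \<in> V}" using finite_subset[OF e] \<V>(3) by blast
    have "card {V \<in> ?W. x \<in> V} \<le> card ((\<inter>) S ` {V \<in> \<V>. x \<in> V})"
      using card_mono[OF _ e] \<V>(3) by blast
    also have "\<dots> \<le> card {V \<in> \<V>. x \<in> V}" using card_image_le \<V>(3) by blast
    finally show "card {V \<in> ?W. x \<in> V} \<le> n + 1" using \<V>(3)[of x] by simp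
  qed
qed

text \<open>For every basic open set countably many good neighbourhoods suffice by Lindelof. The
  union \<open>Y\<close> of their countably many frontiers falls under the closed sum theorem and
  the induction hypothesis, while off \<open>Y\<close> these neighbourhoods have no frontier left
  and become clopen, so \<open>S - Y\<close> is zero-dimensional.\<close>

lemma ind_le_imp_dec:
  fixes S :: "'a::{metric_space,second_countable_topology} set"
  assumes "ind_le n (top_of_set S)"
  shows "dec_le n S"
  using assms
proof (induction n arbitrary: S)
  case (Suc n)
  let ?T = "top_of_set S"
  obtain \<B> :: "'a set set" where \<B>: "countable \<B>" "topological_basis \<B>" using ex_countable_basis by blast
  define \<N> where "\<N> B = {N. closedin ?T N \<and> N \<subseteq> B \<and> ind_le n (subtopology ?T (?T frontier_of N))}" for B
  have "\<exists>\<M>. \<M> \<subseteq> \<N> B \<and> countable \<M> \<and> S \<inter> B \<subseteq> (\<Union>N\<in>\<M>. ?T interior_of N)" if "B \<in> \<B>" for B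
  proof -
    have "open B" using that \<B>(2) by (rule topological_basis_open[rotated])
    then have oB: "openin ?T (S \<inter> B)" by auto
    have cover: "S \<inter> B \<subseteq> \<Union>((interior_of) ?T ` \<N> B)"
    proof
      fix x assume "x \<in> S \<inter> B"
      then obtain N where "closedin ?T N" "x \<in> ?T interior_of N" "N \<subseteq> S \<inter> B"
         "ind_le n (subtopology ?T (?T frontier_of N))"
        using Suc.prems[unfolded ind_le.simps, rule_format, of x "S \<inter> B"] oB by auto
      then show "x \<in> \<Union>((interior_of) ?T ` \<N> B)" unfolding \<N>_def by blast
    qed
    obtain \<F> where \<F>: "\<F> \<subseteq> (interior_of) ?T ` \<N> B" "countable \<F>" "\<Union>\<F> = \<Union>((interior_of) ?T ` \<N> B)"
      using Lindelof_openin[of "(interior_of) ?T ` \<N> B" S] by (metis (no_types, lifting) imageE openin_interior_of)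
    then obtain \<M> where "countable \<M>" "\<M> \<subseteq> \<N> B" "\<F> = (interior_of) ?T ` \<M>"
      using countable_subset_image by metis
    then show ?thesis using \<F>(3) cover by (intro exI[of _ \<M>]) auto
  qed
  then obtain \<M> where \<M>: "\<And>B. B \<in> \<B> \<Longrightarrow> \<M> B \<subseteq> \<N> B" "\<And>B. B \<in> \<B> \<Longrightarrow> countable (\<M> B)"
     "\<And>B. B \<in> \<B> \<Longrightarrow> S \<inter> B \<subseteq> (\<Union>N\<in>\<M> B. ?T interior_of N)" by metis
  define \<F> where "\<F> = (frontier_of) ?T ` (\<Union>B\<in>\<B>. \<M> B)"
  define Y where "Y = \<Union>\<F>"
  have FS: "F \<subseteq> S" if "F \<in> \<F>" for F using that frontier_of_subset_topspace[of ?T] unfolding \<F>_def by auto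
  have "dec_le n Y" unfolding Y_def
  proof (rule dec_le_countable_closed_Union_set)
    show "countable \<F>" unfolding \<F>_def using \<B>(1) \<M>(2) by blast
    fix F assume F: "F \<in> \<F>"
    then obtain N B where N: "F = ?T frontier_of N" "B \<in> \<B>" "N \<in> \<N> B" unfolding \<F>_def using \<M>(1) by blast
    have "closedin ?T F" unfolding N by (rule closedin_frontier_of)
    then show "closedin (top_of_set (\<Union>\<F>)) F"
      by (rule closedin_subset_trans) (use F FS in auto)
    have "top_of_set F = subtopology ?T F" using FS[OF F] by (simp add: subtopology_subtopology Int_absorb1)
    then show "dec_le n F" using N Suc.IH unfolding \<N>_def by simp
  qed
  moreover have "zdim (S - Y)"
    unfolding zdim_def
  proof (intro ballI allI impI)
    fix x U assume x: "x \<in> S - Y" and U: "open U \<and> x \<in> U"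
    then obtain B where B: "B \<in> \<B>" "x \<in> B" "B \<subseteq> U" using topological_basisE[OF \<B>(2)] by metis
    then obtain N where N: "N \<in> \<M> B" "x \<in> ?T interior_of N" using \<M>(3)[OF B(1)] x by blast
    have N2: "closedin ?T N" "N \<subseteq> B" using N(1) \<M>(1)[OF B(1)] unfolding \<N>_def by auto
    have "?T frontier_of N \<subseteq> Y" using N(1) B(1) unfolding Y_def \<F>_def by blast
    moreover have "?T frontier_of N = N - ?T interior_of N"
      using N2(1) by (simp add: frontier_of_def closure_of_closedin)
    ultimately have e: "(S - Y) \<inter> N = (S - Y) \<inter> ?T interior_of N"
      using interior_of_subset[of ?T N] by blast
    obtain P Q where P: "closed P" "N = S \<inter> P" "open Q" "?T interior_of N = S \<inter> Q"
      using N2(1) openin_interior_of[of ?T N] unfolding closedin_closed openin_open by blast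
    have "closedin (top_of_set (S - Y)) ((S - Y) \<inter> N)" unfolding closedin_closed P(2) using P(1) by blast
    moreover have "openin (top_of_set (S - Y)) ((S - Y) \<inter> N)" unfolding e openin_open P(4) using P(3) by blast
    ultimately show "\<exists>C. openin (top_of_set (S - Y)) C \<and> closedin (top_of_set (S - Y)) C \<and> x \<in> C \<and> C \<subseteq> U"
      using x N(2) N2(2) B(3) interior_of_subset[of ?T N] by (intro exI[of _ "(S - Y) \<inter> N"]) blast
  qed
  moreover have "S = (S - Y) \<union> Y" using FS unfolding Y_def by blast
  ultimately show ?case by (metis dec_le.simps(2))
qed simp

text \<open>Below \<open>q\<close> the coordinates are either prescribed by \<open>r\<close> or
  irrational. A box with rational endpoints in the irrational coordinates is therefore clopen:
  replacing < by \<le> changes nothing on this set.\<close>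

lemma zdim_rational_pattern:
  fixes R :: "nat set" and r :: "nat \<Rightarrow> real"
  shows "zdim {x. (\<forall>i\<ge>q. x i = 0) \<and> (\<forall>i\<in>R. x i = r i) \<and> (\<forall>i<q. i \<notin> R \<longrightarrow> x i \<notin> \<rat>)}" (is "zdim ?F")
  unfolding zdim_def
proof (intro ballI allI impI)
  fix x U assume x: "x \<in> ?F" and U: "open U \<and> x \<in> U"
  then have "openin (product_topology (\<lambda>i::nat. euclideanreal) UNIV) U" by (simp add: open_fun_def)
  from product_topology_open_contains_basis[OF this conjunct2[OF U]]
  obtain X where X: "x \<in> (\<Pi>\<^sub>E i\<in>UNIV. X i)" "\<And>i. open (X i)" "(\<Pi>\<^sub>E i\<in>UNIV. X i) \<subseteq> U"
    unfolding open_openin[symmetric] by blast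
  have "\<exists>a b. a \<in> \<rat> \<and> b \<in> \<rat> \<and> a < x i \<and> x i < b \<and> {a<..<b} \<subseteq> X i" for i
  proof -
    obtain e where e: "e > 0" "ball (x i) e \<subseteq> X i" using X(1) X(2)[of i] open_contains_ball by (metis PiE_mem UNIV_I)
    obtain a b where "a \<in> \<rat>" "x i - e < a" "a < x i" "b \<in> \<rat>" "x i < b" "b < x i + e"
      using Rats_dense_in_real[of "x i - e" "x i"] Rats_dense_in_real[of "x i" "x i + e"] e(1) by auto
    moreover from this have "{a<..<b} \<subseteq> ball (x i) e" by (auto simp: dist_real_def)
    ultimately show ?thesis using e(2) by blast
  qed
  then obtain a b where ab: "\<And>i. a i \<in> \<rat>" "\<And>i. b i \<in> \<rat>" "\<And>i. a i < x i" "\<And>i. x i < b i" "\<And>i. {a i<..<b i} \<subseteq> X i"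
    by metis
  define J where "J = {..<q} - R"
  define O' where "O' = (\<Inter>i\<in>J. {y :: nat \<Rightarrow> real. a i < y i} \<inter> {y. y i < b i})"
  define C' where "C' = (\<Inter>i\<in>J. {y :: nat \<Rightarrow> real. a i \<le> y i} \<inter> {y. y i \<le> b i})"
  have "open O'" unfolding O'_def J_def
    by (intro open_INT open_Int open_Collect_less continuous_intros ballI continuous_on_product_coordinates finite_Diff finite_lessThan)
  have "closed C'" unfolding C'_def
    by (intro closed_INT closed_Int closed_Collect_le continuous_intros ballI continuous_on_product_coordinates)
  have e: "?F \<inter> O' = ?F \<inter> C'"
  proof -
    have "a i \<noteq> y i \<and> y i \<noteq> b i" if "y \<in> ?F" "i \<in> J" for y i
      using that ab(1,2)[of i] unfolding J_def by auto
    then have "a i < y i \<longleftrightarrow> a i \<le> y i" "y i < b i \<longleftrightarrow> y i \<le> b i" if "y \<in> ?F" "i \<in> J" for y i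
      using that by (meson order_le_less)+
    then show ?thesis unfolding O'_def C'_def by auto
  qed
  show "\<exists>C. openin (top_of_set ?F) C \<and> closedin (top_of_set ?F) C \<and> x \<in> C \<and> C \<subseteq> U"
  proof (intro exI[of _ "?F \<inter> O'"] conjI)
    show "openin (top_of_set ?F) (?F \<inter> O')" using \<open>open O'\<close> by (rule openin_open_Int)
    show "closedin (top_of_set ?F) (?F \<inter> O')" unfolding e using \<open>closed C'\<close> by (rule closedin_closed_Int)
    show "x \<in> ?F \<inter> O'" using x ab(3,4) unfolding O'_def by auto
    show "?F \<inter> O' \<subseteq> U"
    proof
      fix y assume y: "y \<in> ?F \<inter> O'"
      have "y i \<in> X i" for i
      proof (cases "i \<in> J")
        case True then show ?thesis using y ab(5)[of i] unfolding O'_def by auto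
      next
        case False then have "y i = x i" using x y unfolding J_def by (cases "i < q") auto
        then show ?thesis using X(1) by auto
      qed
      then show "y \<in> U" using X(3) by auto
    qed
  qed
qed

text \<open>The summands are the sets \<open>Z s\<close> of points with exactly \<open>s\<close>
  rational coordinates among the first \<open>q\<close>; as \<open>s\<close> runs through 0, ..., q,
  there are \<open>Suc q\<close> of them.\<close>

lemma dec_le_Euclidean:
  "dec_le (Suc q) {x :: nat \<Rightarrow> real. \<forall>i\<ge>q. x i = 0}"
proof -
  let ?E = "{x :: nat \<Rightarrow> real. \<forall>i\<ge>q. x i = 0}"
  let ?rat = "\<lambda>x :: nat \<Rightarrow> real. {i. i < q \<and> x i \<in> \<rat>}"
  define Z where "Z s = {x \<in> ?E. card (?rat x) = s}" for s
  have zZ: "zdim (Z s)" for s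
  proof -
    define F where "F = (\<lambda>(R, r). {x :: nat \<Rightarrow> real. (\<forall>i\<ge>q. x i = 0) \<and> (\<forall>i\<in>R. x i = r i) \<and> (\<forall>i<q. i \<notin> R \<longrightarrow> x i \<notin> \<rat>)})"
    define I where "I = (SIGMA R:{R. R \<subseteq> {..<q} \<and> card R = s}. (\<Pi>\<^sub>E i\<in>R. (\<rat>::real set)))"
    have "countable I" unfolding I_def
    proof (rule countable_SIGMA)
      have "finite {R. R \<subseteq> {..<q} \<and> card R = s}" by simp
      then show "countable {R. R \<subseteq> {..<q} \<and> card R = s}" by (rule countable_finite)
      fix R assume "R \<in> {R. R \<subseteq> {..<q} \<and> card R = s}"
      then have "finite R" using finite_subset by blast
      then show "countable (R \<rightarrow>\<^sub>E (\<rat>::real set))" by (intro countable_PiE) (auto simp: countable_rat)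
    qed
    have ratF: "?rat x = R" if "x \<in> F (R, r)" "(R, r) \<in> I" for x R r
      using that unfolding F_def I_def by (auto simp: PiE_iff)
    have ZF: "Z s = \<Union>(F ` I)"
    proof
      show "Z s \<subseteq> \<Union>(F ` I)"
      proof
        fix x assume x: "x \<in> Z s"
        have "x \<in> F (?rat x, restrict x (?rat x))" using x unfolding F_def Z_def by auto
        moreover have "(?rat x, restrict x (?rat x)) \<in> I" using x unfolding I_def Z_def by auto
        ultimately show "x \<in> \<Union>(F ` I)" by blast
      qed
      show "\<Union>(F ` I) \<subseteq> Z s"
      proof
        fix x assume "x \<in> \<Union>(F ` I)"
        then obtain R r where Rr: "x \<in> F (R, r)" "(R, r) \<in> I" by auto
        then have "x \<in> ?E" "card R = s" unfolding F_def I_def by auto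
        then show "x \<in> Z s" unfolding Z_def using ratF[OF Rr] by simp
      qed
    qed
    have "dec_le (Suc 0) (\<Union>(F ` I))"
    proof (rule dec_le_countable_closed_Union_set)
      show "countable (F ` I)" using \<open>countable I\<close> by simp
      fix G assume "G \<in> F ` I"
      then obtain R r where Rr: "G = F (R, r)" "(R, r) \<in> I" by auto
      then have R: "R \<subseteq> {..<q}" "card R = s" "\<And>i. i \<in> R \<Longrightarrow> r i \<in> \<rat>" unfolding I_def by auto
      \<comment> \<open>A point of \<open>Z s\<close> with rational values prescribed at the
        \<open>s\<close> places of \<open>R\<close> has no room for another rational coordinate. The
        equations alone therefore cut out \<open>G\<close>, which makes it closed in
        \<open>Z s\<close>.\<close>
      have "G = Z s \<inter> (\<Inter>i\<in>R. {x. x i = r i})"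
      proof
        show "G \<subseteq> Z s \<inter> (\<Inter>i\<in>R. {x. x i = r i})"
          using Rr ZF unfolding F_def by blast
        show "Z s \<inter> (\<Inter>i\<in>R. {x. x i = r i}) \<subseteq> G"
        proof
          fix x assume x: "x \<in> Z s \<inter> (\<Inter>i\<in>R. {x. x i = r i})"
          then have "R \<subseteq> ?rat x" using R by auto
          moreover have "card (?rat x) = card R" using x R unfolding Z_def by auto
          ultimately have "R = ?rat x" by (intro card_subset_eq) auto
          then have "\<forall>i<q. i \<notin> R \<longrightarrow> x i \<notin> \<rat>" by blast
          then show "x \<in> G" using x unfolding Rr F_def Z_def by auto
        qed
      qed
      moreover have "closed (\<Inter>i\<in>R. {x :: nat \<Rightarrow> real. x i = r i})"
        by (intro closed_INT ballI closed_Collect_eq continuous_intros continuous_on_product_coordinates)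
      ultimately show "closedin (top_of_set (\<Union>(F ` I))) G" unfolding ZF[symmetric]
        by (simp add: closedin_closed_Int)
      have "zdim G" unfolding Rr F_def prod.case by (rule zdim_rational_pattern)
      then show "dec_le (Suc 0) G" by auto
    qed
    then show ?thesis unfolding ZF[symmetric] by auto
  qed
  have "dec_le n (\<Union>s<n. Z s)" for n
  proof (induction n)
    case (Suc n)
    have "(\<Union>s<Suc n. Z s) = Z n \<union> (\<Union>s<n. Z s)" by (auto simp: less_Suc_eq)
    then show ?case using Suc zZ by (metis dec_le.simps(2))
  qed simp
  then have "dec_le (Suc q) (\<Union>s<Suc q. Z s)" .
  moreover have "?E \<subseteq> (\<Union>s<Suc q. Z s)"
  proof
    fix x assume x: "x \<in> ?E"
    have "card (?rat x) \<le> card {..<q}" by (rule card_mono) auto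
    then show "x \<in> (\<Union>s<Suc q. Z s)" using x unfolding Z_def by auto
  qed
  ultimately show ?thesis using dec_le_subset by blast
qed

section \<open>Topological invariance and the covering dimension of a cube\<close>

text \<open>The induction works because a homeomorphism carries frontiers to frontiers and restricts
  to a homeomorphism between them.\<close>

lemma ind_le_homeomorphic:
  assumes "X homeomorphic_space Y" "ind_le n X"
  shows "ind_le n Y"
  using assms
proof (induction n arbitrary: X Y)
  case 0
  then show ?case using homeomorphic_empty_space by auto
next
  case (Suc n)
  obtain f g where fg: "homeomorphic_maps X Y f g" using Suc.prems(1) unfolding homeomorphic_space_def by blast
  then have hf: "homeomorphic_map X Y f" and hg: "homeomorphic_map Y X g"
    and gf: "\<And>y. y \<in> topspace Y \<Longrightarrow> f (g y) = y" "\<And>y. y \<in> topspace Y \<Longrightarrow> g y \<in> topspace X"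
    using homeomorphic_maps_map[of X Y f g] unfolding homeomorphic_maps_def continuous_map_def by auto
  show ?case unfolding ind_le.simps
  proof (intro ballI allI impI)
    fix y V assume y: "y \<in> topspace Y" and V: "openin Y V \<and> y \<in> V"
    have VY: "V \<subseteq> topspace Y" using V openin_subset by blast
    have "openin X (g ` V)" using V homeomorphic_map_openness[OF hg VY] by simp
    then obtain N where N: "closedin X N" "g y \<in> X interior_of N" "N \<subseteq> g ` V"
        "ind_le n (subtopology X (X frontier_of N))"
      using Suc.prems(2)[unfolded ind_le.simps, rule_format, of "g y" "g ` V"] V gf(2)[OF y] by blast
    have NX: "N \<subseteq> topspace X" using N(1) closedin_subset by blast
    show "\<exists>N. closedin Y N \<and> y \<in> Y interior_of N \<and> N \<subseteq> V \<and> ind_le n (subtopology Y (Y frontier_of N))"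
    proof (intro exI[of _ "f ` N"] conjI)
      show "closedin Y (f ` N)" using N(1) homeomorphic_map_closedness[OF hf NX] by simp
      show "y \<in> Y interior_of f ` N"
        using homeomorphic_map_interior_of[OF hf NX] N(2) gf(1)[OF y] by (metis imageI)
      show "f ` N \<subseteq> V" using N(3) gf(1) VY by fastforce
      have fr: "Y frontier_of (f ` N) = f ` (X frontier_of N)" by (rule homeomorphic_map_frontier_of[OF hf NX])
      have "f ` (topspace X \<inter> (X frontier_of N)) = topspace Y \<inter> (Y frontier_of (f ` N))"
        unfolding fr using frontier_of_subset_topspace[of X N] hf frontier_of_subset_topspace[of Y "f ` N", unfolded fr]
        by (simp add: Int_absorb1)
      then have "homeomorphic_map (subtopology X (X frontier_of N)) (subtopology Y (Y frontier_of (f ` N))) f"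
        by (rule homeomorphic_map_subtopologies[OF hf])
      then show "ind_le n (subtopology Y (Y frontier_of (f ` N)))"
        using Suc.IH N(4) homeomorphic_map_imp_homeomorphic_space by blast
    qed
  qed
qed

lemma cov_leE:
  assumes "cov_le n X" "\<forall>U\<in>\<U>. openin X U" "\<Union>\<U> = topspace X"
  obtains \<V> where "\<And>V. V \<in> \<V> \<Longrightarrow> openin X V" "\<Union>\<V> = topspace X" "\<And>V. V \<in> \<V> \<Longrightarrow> \<exists>U\<in>\<U>. V \<subseteq> U"
     "\<And>x. x\<in>topspace X \<Longrightarrow> finite {V\<in>\<V>. x \<in> V} \<and> card {V\<in>\<V>. x \<in> V} \<le> n + 1"
proof -
  have "(\<forall>U\<in>\<U>. openin X U) \<and> \<Union>\<U> = topspace X" using assms by blast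
  from assms(1)[unfolded cov_le_def, THEN spec, THEN mp, OF this]
  obtain \<V> where "(\<forall>V\<in>\<V>. openin X V) \<and> \<Union>\<V> = topspace X \<and> (\<forall>V\<in>\<V>. \<exists>U\<in>\<U>. V \<subseteq> U) \<and>
     (\<forall>x\<in>topspace X. finite {V\<in>\<V>. x \<in> V} \<and> card {V\<in>\<V>. x \<in> V} \<le> n + 1)" ..
  then show thesis by (intro that[of \<V>]) blast+
qed

lemma cov_le_homeomorphic:
  assumes "X homeomorphic_space Y" "cov_le n X"
  shows "cov_le n Y"
  unfolding cov_le_def
proof (intro allI impI)
  fix \<U> assume \<U>: "(\<forall>U\<in>\<U>. openin Y U) \<and> \<Union>\<U> = topspace Y"
  obtain f g where fg: "homeomorphic_maps X Y f g" using assms(1) unfolding homeomorphic_space_def by blast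
  then have hf: "homeomorphic_map X Y f" and hg: "homeomorphic_map Y X g"
    and gf: "\<And>y. y \<in> topspace Y \<Longrightarrow> f (g y) = y" "\<And>y. y \<in> topspace Y \<Longrightarrow> g y \<in> topspace X"
    and fg': "\<And>x. x \<in> topspace X \<Longrightarrow> g (f x) = x" "\<And>x. x \<in> topspace X \<Longrightarrow> f x \<in> topspace Y"
    using homeomorphic_maps_map[of X Y f g] unfolding homeomorphic_maps_def continuous_map_def by auto
  have 1: "\<forall>U\<in>((`) g) ` \<U>. openin X U"
    using \<U> homeomorphic_map_openness[OF hg] openin_subset by blast
  have "g ` (\<Union>\<U>) = topspace X"
    using \<U> homeomorphic_imp_surjective_map[OF hg] by simp
  then have 2: "\<Union>(((`) g) ` \<U>) = topspace X" by blast
  obtain \<V> where \<V>: "\<And>V. V \<in> \<V> \<Longrightarrow> openin X V" "\<Union>\<V> = topspace X" "\<And>V. V \<in> \<V> \<Longrightarrow> \<exists>U\<in>((`) g) ` \<U>. V \<subseteq> U"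
     "\<And>x. x\<in>topspace X \<Longrightarrow> finite {V\<in>\<V>. x \<in> V} \<and> card {V\<in>\<V>. x \<in> V} \<le> n + 1"
    by (fact cov_leE[OF assms(2) 1 2])
  have VX: "V \<subseteq> topspace X" if "V \<in> \<V>" for V using \<V>(1)[OF that] openin_subset by blast
  show "\<exists>\<V>. (\<forall>V\<in>\<V>. openin Y V) \<and> \<Union>\<V> = topspace Y \<and> (\<forall>V\<in>\<V>. \<exists>U\<in>\<U>. V \<subseteq> U) \<and>
          (\<forall>x\<in>topspace Y. finite {V\<in>\<V>. x \<in> V} \<and> card {V\<in>\<V>. x \<in> V} \<le> n + 1)"
  proof (intro exI[of _ "((`) f) ` \<V>"] conjI ballI)
    show "openin Y V" if "V \<in> ((`) f) ` \<V>" for V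
      using that \<V>(1) homeomorphic_map_openness[OF hf VX] by auto
    have "f ` (\<Union>\<V>) = topspace Y"
      using \<V>(2) homeomorphic_imp_surjective_map[OF hf] by simp
    then show "\<Union>(((`) f) ` \<V>) = topspace Y" by blast
    show "\<exists>U\<in>\<U>. V \<subseteq> U" if V: "V \<in> ((`) f) ` \<V>" for V
    proof -
      obtain V' U where "V' \<in> \<V>" "V = f ` V'" "U \<in> \<U>" "V' \<subseteq> g ` U" using V \<V>(3) by blast
      moreover then have "U \<subseteq> topspace Y" using \<U> openin_subset by blast
      ultimately show ?thesis using gf(1) by (intro bexI[of _ U]) (fastforce, assumption)
    qed
    fix y assume y: "y \<in> topspace Y"
    have e: "{V \<in> ((`) f) ` \<V>. y \<in> V} \<subseteq> (`) f ` {V \<in> \<V>. g y \<in> V}"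
    proof
      fix W assume "W \<in> {V \<in> ((`) f) ` \<V>. y \<in> V}"
      then obtain V x where V: "V \<in> \<V>" "W = f ` V" "y = f x" "x \<in> V" by blast
      then have "g y \<in> V" using fg'(1) VX[OF V(1)] by auto
      then show "W \<in> (`) f ` {V \<in> \<V>. g y \<in> V}" using V by blast
    qed
    note fin = \<V>(4)[OF gf(2)[OF y]]
    show "finite {V \<in> ((`) f) ` \<V>. y \<in> V}" using finite_subset[OF e] fin by blast
    have "card {V \<in> ((`) f) ` \<V>. y \<in> V} \<le> card ((`) f ` {V \<in> \<V>. g y \<in> V})"
      using card_mono[OF _ e] fin by blast
    also have "\<dots> \<le> card {V \<in> \<V>. g y \<in> V}" using card_image_le fin by blast
    finally show "card {V \<in> ((`) f) ` \<V>. y \<in> V} \<le> n + 1" using fin by linarith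
  qed
qed

lemma cov_le_closed_subspace:
  assumes "closedin X C" "cov_le n X"
  shows "cov_le n (subtopology X C)"
  unfolding cov_le_def
proof (intro allI impI)
  fix \<U> assume \<U>: "(\<forall>U\<in>\<U>. openin (subtopology X C) U) \<and> \<Union>\<U> = topspace (subtopology X C)"
  have CX: "C \<subseteq> topspace X" using assms(1) closedin_subset by blast
  have tC: "topspace (subtopology X C) = C" using CX by auto
  \<comment> \<open>Relatively open members are extended to open sets of \<open>X\<close>, and the
    open complement of \<open>C\<close> completes the cover.\<close>
  define \<U>' where "\<U>' = insert (topspace X - C) {U. openin X U \<and> C \<inter> U \<in> \<U>}"
  have 1: "\<forall>U\<in>\<U>'. openin X U" unfolding \<U>'_def using assms(1) by auto
  have 2: "\<Union>\<U>' = topspace X"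
  proof
    show "\<Union>\<U>' \<subseteq> topspace X" using 1 openin_subset by blast
    show "topspace X \<subseteq> \<Union>\<U>'"
    proof
      fix x assume x: "x \<in> topspace X"
      show "x \<in> \<Union>\<U>'"
      proof (cases "x \<in> C")
        case True
        then obtain U where U: "U \<in> \<U>" "x \<in> U" using \<U> tC by blast
        then obtain T where "openin X T" "U = C \<inter> T" using \<U> by (metis Int_commute openin_subtopology)
        then show ?thesis unfolding \<U>'_def using U by blast
      qed (use x in \<open>auto simp: \<U>'_def\<close>)
    qed
  qed
  obtain \<V> where \<V>: "\<And>V. V \<in> \<V> \<Longrightarrow> openin X V" "\<Union>\<V> = topspace X" "\<And>V. V \<in> \<V> \<Longrightarrow> \<exists>U\<in>\<U>'. V \<subseteq> U"
     "\<And>x. x\<in>topspace X \<Longrightarrow> finite {V\<in>\<V>. x \<in> V} \<and> card {V\<in>\<V>. x \<in> V} \<le> n + 1"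
    by (fact cov_leE[OF assms(2) 1 2])
  \<comment> \<open>Empty traces are left out: a member of the refinement inside the complement of
    \<open>C\<close> has an empty trace, for which no member of the original cover is at
    hand.\<close>
  let ?W = "{C \<inter> V | V. V \<in> \<V> \<and> C \<inter> V \<noteq> {}}"
  show "\<exists>\<V>. (\<forall>V\<in>\<V>. openin (subtopology X C) V) \<and> \<Union>\<V> = topspace (subtopology X C) \<and> (\<forall>V\<in>\<V>. \<exists>U\<in>\<U>. V \<subseteq> U) \<and>
          (\<forall>x\<in>topspace (subtopology X C). finite {V\<in>\<V>. x \<in> V} \<and> card {V\<in>\<V>. x \<in> V} \<le> n + 1)"
  proof (intro exI[of _ ?W] conjI ballI)
    show "openin (subtopology X C) V" if V: "V \<in> ?W" for V
    proof -
      obtain V' where V': "V' \<in> \<V>" "V = C \<inter> V'" using V by blast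
      show ?thesis unfolding V'(2) by (rule openin_subtopology_Int2[OF \<V>(1)[OF V'(1)]])
    qed
    have "\<Union>?W = C \<inter> \<Union>\<V>" by blast
    also have "\<dots> = C" unfolding \<V>(2) using CX by (rule Int_absorb2)
    finally show "\<Union>?W = topspace (subtopology X C)" unfolding tC .
    show "\<exists>U\<in>\<U>. V \<subseteq> U" if V: "V \<in> ?W" for V
    proof -
      obtain V' U where V': "V' \<in> \<V>" "V = C \<inter> V'" "V \<noteq> {}" "U \<in> \<U>'" "V' \<subseteq> U" using V \<V>(3) by blast
      then have "U \<noteq> topspace X - C" by blast
      then show ?thesis using V' unfolding \<U>'_def by (intro bexI[of _ "C \<inter> U"]) auto
    qed
    fix x assume "x \<in> topspace (subtopology X C)"
    then have x: "x \<in> topspace X" "x \<in> C" using CX tC by auto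
    have e: "{V \<in> ?W. x \<in> V} \<subseteq> (\<inter>) C ` {V \<in> \<V>. x \<in> V}" by auto
    note fin = \<V>(4)[OF x(1)]
    show "finite {V \<in> ?W. x \<in> V}" using finite_subset[OF e] fin by blast
    have "card {V \<in> ?W. x \<in> V} \<le> card ((\<inter>) C ` {V \<in> \<V>. x \<in> V})" using card_mono[OF _ e] fin by blast
    also have "\<dots> \<le> card {V \<in> \<V>. x \<in> V}" using card_image_le fin by blast
    finally show "card {V \<in> ?W. x \<in> V} \<le> n + 1" using fin by linarith
  qed
qed

text \<open>The distance of sequences is a sum of coordinate distances, truncated at 1, with weights
  1, 1/2, 1/4, ...; the factor 2 is the total weight.\<close>

lemma dist_fun_le:
  fixes x y :: "nat \<Rightarrow> real"
  assumes "\<And>i. \<bar>x i - y i\<bar> \<le> e"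
  shows "dist x y \<le> 2 * e"
proof -
  have s: "summable (\<lambda>n. (1/2::real)^n)" by (rule summable_geometric) simp
  have le: "(1/2)^n * min (dist (x (from_nat n)) (y (from_nat n))) 1 \<le> (1/2)^n * e" for n
    using assms[of "from_nat n"] by (intro mult_left_mono) (auto simp: dist_real_def)
  have "dist x y = (\<Sum>n. (1/2)^n * min (dist (x (from_nat n)) (y (from_nat n))) 1)" unfolding dist_fun_def ..
  also have "\<dots> \<le> (\<Sum>n. (1/2)^n * e)"
  proof (rule suminf_le[OF le])
    show "summable (\<lambda>n. (1/2)^n * min (dist (x (from_nat n)) (y (from_nat n))) 1)"
      by (rule summable_comparison_test'[OF s, of 0]) (auto simp: mult_left_le)
    show "summable (\<lambda>n. (1/2)^n * e)" using s by (rule summable_mult2)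
  qed
  also have "\<dots> = (\<Sum>n. (1/2)^n) * e" using suminf_mult2[OF s] by simp
  also have "\<dots> = 2 * e" by (simp add: suminf_geometric)
  finally show ?thesis .
qed

lemma compact_box_fun:
  fixes a b :: "nat \<Rightarrow> real"
  shows "compact {x :: nat \<Rightarrow> real. \<forall>i. a i \<le> x i \<and> x i \<le> b i}"
proof -
  have "compactin (product_topology (\<lambda>i::nat. euclideanreal) UNIV) (\<Pi>\<^sub>E i\<in>UNIV. {a i..b i})"
    unfolding compactin_PiE by auto
  moreover have "(\<Pi>\<^sub>E i\<in>UNIV. {a i..b i}) = {x. \<forall>i. a i \<le> x i \<and> x i \<le> b i}" by (auto simp: PiE_iff)
  ultimately show ?thesis by (simp add: euclidean_product_topology)
qed

text \<open>Points of n-space are sequences that vanish from \<open>n\<close> on, so that the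
  dimension may be a term such as \<open>(k + l) * (k + m)\<close>.\<close>

definition unit_cube :: "nat \<Rightarrow> (nat \<Rightarrow> real) set" where
  "unit_cube n = {x. (\<forall>i<n. 0 \<le> x i \<and> x i \<le> 1) \<and> (\<forall>i\<ge>n. x i = 0)}"

lemma compact_unit_cube: "compact (unit_cube n)"
proof -
  have "unit_cube n = {x. \<forall>i. 0 \<le> x i \<and> x i \<le> (if i < n then 1 else 0)}"
    unfolding unit_cube_def by (auto simp: not_less intro: antisym)
  then show ?thesis using compact_box_fun[of "\<lambda>_. 0" "\<lambda>i. if i < n then 1 else 0"] by simp
qed

text \<open>Lebesgue's covering theorem: every member of a fine cover is given as colour the first
  coordinate whose upper face it meets, and Kuhn's lemma finds a small simplex with all colours.\<close>

lemma not_cov_le_unit_cube: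
  assumes "j < n"
  shows "\<not> cov_le j (top_of_set (unit_cube n))"
proof
  assume cov: "cov_le j (top_of_set (unit_cube n))"
  let ?Q = "unit_cube n"
  \<comment> \<open>The cover consists of the open sets that meet no two opposite faces; every point
    has a small neighbourhood of this kind.\<close>
  define \<U> where "\<U> = {U. openin (top_of_set ?Q) U \<and> (\<forall>i<n. \<not> ((\<exists>x\<in>U. x i = 0) \<and> (\<exists>y\<in>U. y i = 1)))}"
  have "x \<in> \<Union>\<U>" if "x \<in> ?Q" for x
  proof -
    let ?U = "?Q \<inter> (\<Inter>i\<in>{..<n}. {y. \<bar>y i - x i\<bar> < 1/2})"
    have "open (\<Inter>i\<in>{..<n}. {y :: nat \<Rightarrow> real. \<bar>y i - x i\<bar> < 1/2})"
      by (intro open_INT ballI open_Collect_less continuous_intros continuous_on_product_coordinates) auto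
    then have "openin (top_of_set ?Q) ?U" by (rule openin_open_Int)
    moreover have "\<not> ((\<exists>z\<in>?U. z i = 0) \<and> (\<exists>y\<in>?U. y i = 1))" if "i < n" for i
    proof
      assume "(\<exists>z\<in>?U. z i = 0) \<and> (\<exists>y\<in>?U. y i = 1)"
      then obtain z y where "z \<in> ?U" "z i = 0" "y \<in> ?U" "y i = 1" by blast
      moreover then have "\<bar>z i - x i\<bar> < 1/2" "\<bar>y i - x i\<bar> < 1/2" using that by blast+
      ultimately have "\<bar>z i - x i\<bar> < 1/2" "z i = 0" "\<bar>y i - x i\<bar> < 1/2" "y i = 1" by auto
      then show False by linarith
    qed
    ultimately have "?U \<in> \<U>" unfolding \<U>_def by blast
    moreover have "x \<in> ?U" using that by auto
    ultimately show ?thesis by blast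
  qed
  then have "\<Union>\<U> = topspace (top_of_set ?Q)" unfolding \<U>_def using openin_imp_subset by fastforce
  then have 2: "\<Union>\<U> = topspace (top_of_set ?Q)" .
  have 1: "\<forall>U\<in>\<U>. openin (top_of_set ?Q) U" unfolding \<U>_def by blast
  obtain \<V> where \<V>: "\<And>V. V \<in> \<V> \<Longrightarrow> openin (top_of_set ?Q) V" "\<Union>\<V> = ?Q" "\<And>V. V \<in> \<V> \<Longrightarrow> \<exists>U\<in>\<U>. V \<subseteq> U"
     "\<And>x. x \<in> ?Q \<Longrightarrow> finite {V\<in>\<V>. x \<in> V} \<and> card {V\<in>\<V>. x \<in> V} \<le> j + 1"
    by (fact cov_leE[OF cov 1 2, unfolded topspace_euclidean_subtopology])
  have faces: "\<not> (\<exists>x\<in>V. x i = 0)" if "V \<in> \<V>" "i < n" "\<exists>y\<in>V. y i = 1" for V i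
    using \<V>(3)[OF that(1)] that(2,3) unfolding \<U>_def by blast
  define \<C> where "\<C> = {W. open W \<and> ?Q \<inter> W \<in> \<V>}"
  have Qne: "(\<lambda>_. 0) \<in> ?Q" unfolding unit_cube_def by simp
  have cC: "?Q \<subseteq> \<Union>\<C>"
  proof
    fix x assume "x \<in> ?Q"
    then obtain V where V: "V \<in> \<V>" "x \<in> V" using \<V>(2) by blast
    then obtain W where "open W" "V = ?Q \<inter> W" using \<V>(1) openin_open by metis
    then show "x \<in> \<Union>\<C>" unfolding \<C>_def using V by blast
  qed
  then have "\<C> \<noteq> {}" using Qne by blast
  moreover have "open B" if "B \<in> \<C>" for B using that unfolding \<C>_def by blast
  ultimately obtain \<delta> where \<delta>: "0 < \<delta>" "\<And>T. \<lbrakk>T \<subseteq> ?Q; diameter T < \<delta>\<rbrakk> \<Longrightarrow> \<exists>B \<in> \<C>. T \<subseteq> B"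
    using Lebesgue_number_lemma[OF compact_unit_cube[of n] _ cC] by metis
  \<comment> \<open>The 4 is a product of two factors 2: two points of \<open>T a\<close> differ by
    at most 2/p in each coordinate, and \<open>dist_fun_le\<close> doubles this.\<close>
  obtain p :: nat where p: "p > 0" "4 / real p < \<delta>"
  proof -
    obtain p where "4 / \<delta> < real p" using reals_Archimedean2 by blast
    moreover have "0 < 4 / \<delta>" using \<delta>(1) by simp
    ultimately have "0 < real p" by linarith
    moreover have "4 / real p < \<delta>" using \<open>4 / \<delta> < real p\<close> \<open>0 < real p\<close> \<delta>(1) by (simp add: field_simps)
    ultimately show thesis using that by simp
  qed
  define g where "g a = (\<lambda>i. if i < n then real (a i) / real p else 0)" for a :: "nat \<Rightarrow> nat"
  define T where "T a = {y \<in> ?Q. \<forall>i. \<bar>y i - g a i\<bar> \<le> 1 / real p}" for a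
  have "\<exists>V\<in>\<V>. T a \<subseteq> V" for a
  proof -
    have d: "dist x y \<le> 4 / real p" if xy: "x \<in> T a" "y \<in> T a" for x y
    proof -
      have "\<bar>x i - y i\<bar> \<le> 2 / real p" for i
      proof -
        have "\<bar>x i - g a i\<bar> \<le> 1 / real p" "\<bar>y i - g a i\<bar> \<le> 1 / real p"
          using xy unfolding T_def by auto
        moreover have "1 / real p + 1 / real p = 2 / real p" by simp
        ultimately show ?thesis by linarith
      qed
      then have "dist x y \<le> 2 * (2 / real p)" by (rule dist_fun_le)
      then show ?thesis by simp
    qed
    have "diameter (T a) \<le> 4 / real p"
      unfolding diameter_def using d by (auto intro!: cSUP_least)
    then have "diameter (T a) < \<delta>" using p by linarith
    then obtain B where "B \<in> \<C>" "T a \<subseteq> B" using \<delta>(2)[of "T a"] unfolding T_def by blast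
    then show ?thesis unfolding \<C>_def T_def by (intro bexI[of _ "?Q \<inter> B"]) auto
  qed
  then obtain V where V: "\<And>a. V a \<in> \<V>" "\<And>a. T a \<subseteq> V a" by metis
  \<comment> \<open>The label of a grid point depends only on the chosen member \<open>V a\<close>,
    so different labels prove different members. It is 0 on a lower face, because \<open>V a\<close>
    contains that grid point and cannot reach the opposite upper face.\<close>
  define lab where "lab a i = (if \<exists>y\<in>V a. y i = 1 then 1 else 0 :: nat)" for a i
  have gQ: "g a \<in> ?Q" if "\<forall>i. a i \<le> p" for a
    unfolding unit_cube_def g_def using that p(1) by auto
  have gV: "g a \<in> V a" if "\<forall>i. a i \<le> p" for a
    using V(2)[of a] gQ[OF that] unfolding T_def by auto
  have "odd (card {s. ksimplex p n s \<and> (reduced n \<circ> lab) ` s = {..n}})"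
  proof (rule kuhn_combinatorial[OF p(1)])
    show "\<forall>x j. (\<forall>j. x j \<le> p) \<and> j < n \<and> x j = 0 \<longrightarrow> lab x j = 0"
    proof (intro allI impI)
      fix x j assume xj: "(\<forall>j. x j \<le> p) \<and> j < n \<and> x j = 0"
      then have "g x \<in> V x" "g x j = 0" using gV unfolding g_def by auto
      then show "lab x j = 0" using faces[OF V(1)] xj unfolding lab_def by auto
    qed
    show "\<forall>x j. (\<forall>j. x j \<le> p) \<and> j < n \<and> x j = p \<longrightarrow> lab x j = 1"
    proof (intro allI impI)
      fix x j assume xj: "(\<forall>j. x j \<le> p) \<and> j < n \<and> x j = p"
      then have "g x \<in> V x" "g x j = 1" using gV p(1) unfolding g_def by auto
      then show "lab x j = 1" unfolding lab_def by auto
    qed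
  qed
  then have "{s. ksimplex p n s \<and> (reduced n \<circ> lab) ` s = {..n}} \<noteq> {}" by (rule odd_card_imp_not_empty)
  then obtain s b u where "kuhn_simplex p n b u s" and rl: "(reduced n \<circ> lab) ` s = {..n}"
    by (auto elim: ksimplex.cases)
  interpret kuhn_simplex p n b u s by fact
  have "\<forall>i\<in>{..n}. \<exists>a\<in>s. reduced n (lab a) = i" using rl by (metis comp_apply imageE)
  then obtain a where a: "\<And>i. i \<le> n \<Longrightarrow> a i \<in> s" "\<And>i. i \<le> n \<Longrightarrow> reduced n (lab (a i)) = i"
    by (metis atMost_iff)
  have close: "\<bar>g c i - g d i\<bar> \<le> 1 / real p" if "c \<in> s" "d \<in> s" for c d i
  proof -
    have "\<bar>real (c i) - real (d i)\<bar> \<le> 1"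
      using base_le[OF that(1), of i] base_le[OF that(2), of i] le_Suc_base[OF that(1), of i] le_Suc_base[OF that(2), of i]
      by linarith
    then show ?thesis unfolding g_def using p(1) by (auto simp: diff_divide_distrib[symmetric] divide_right_mono)
  qed
  \<comment> \<open>The vertices of a Kuhn simplex lie within one grid step of each other, so any
    one of them belongs to every \<open>V (a i)\<close>. With n + 1 different members through it,
    the order exceeds \<open>j + 1\<close>.\<close>
  let ?z = "g (a 0)"
  have zQ: "?z \<in> ?Q" using gQ s_le_p a(1)[of 0] by blast
  have "?z \<in> V (a i)" if "i \<le> n" for i
    using V(2)[of "a i"] zQ close[OF a(1)[of 0] a(1)[OF that]] unfolding T_def by auto
  then have sub: "(\<lambda>i. V (a i)) ` {..n} \<subseteq> {V \<in> \<V>. ?z \<in> V}" using V(1) by blast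
  have "inj_on (\<lambda>i. V (a i)) {..n}"
  proof (rule inj_onI)
    fix i i' assume i: "i \<in> {..n}" "i' \<in> {..n}" "V (a i) = V (a i')"
    then have "lab (a i) = lab (a i')" unfolding lab_def by simp
    then show "i = i'" using a(2) i by (metis atMost_iff)
  qed
  then have "card ((\<lambda>i. V (a i)) ` {..n}) = n + 1" by (simp add: card_image)
  moreover have "card ((\<lambda>i. V (a i)) ` {..n}) \<le> card {V \<in> \<V>. ?z \<in> V}"
    using \<V>(4)[OF zQ] by (intro card_mono[OF _ sub]) blast
  ultimately show False using \<V>(4)[OF zQ] assms by linarith
qed

text \<open>\<open>cov_le\<close> passes to closed subspaces, and the image of the cube is closed
  because it is compact in a Hausdorff space; for the same reason \<open>f\<close> is a
  homeomorphism onto it.\<close>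

lemma not_cov_le_embedded_cube:
  assumes "Hausdorff_space X" "continuous_map (top_of_set (unit_cube n)) X f" "inj_on f (unit_cube n)" "j < n"
  shows "\<not> cov_le j X"
proof
  assume "cov_le j X"
  let ?Q = "unit_cube n"
  have "compact_space (top_of_set ?Q)" using compact_unit_cube by (simp add: compact_space_subtopology)
  have fQ: "f ` ?Q \<subseteq> topspace X" using assms(2) by (auto simp: continuous_map_def)
  have "compactin X (f ` ?Q)"
    using image_compactin[OF _ assms(2)] \<open>compact_space (top_of_set ?Q)\<close> unfolding compact_space_def by auto
  then have "closedin X (f ` ?Q)" by (rule compactin_imp_closedin[OF assms(1)])
  then have "cov_le j (subtopology X (f ` ?Q))" using \<open>cov_le j X\<close> by (rule cov_le_closed_subspace)
  moreover have "homeomorphic_map (top_of_set ?Q) (subtopology X (f ` ?Q)) f"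
  proof (rule continuous_imp_homeomorphic_map)
    show "Hausdorff_space (subtopology X (f ` ?Q))" using assms(1) by (rule Hausdorff_space_subtopology)
    show "continuous_map (top_of_set ?Q) (subtopology X (f ` ?Q)) f"
      using assms(2) by (simp add: continuous_map_in_subtopology)
  qed (use assms fQ \<open>compact_space _\<close> in auto)
  then have "subtopology X (f ` ?Q) homeomorphic_space top_of_set ?Q"
    using homeomorphic_map_imp_homeomorphic_space homeomorphic_space_sym by blast
  ultimately have "cov_le j (top_of_set ?Q)" using cov_le_homeomorphic by blast
  then show False using not_cov_le_unit_cube[OF assms(4)] by simp
qed

section \<open>The Chabauty topology\<close>

lemma topspace_chabauty: "topspace (chabauty X) = {C. closedin X C}"
proof -
  have "{C. closedin X C} \<subseteq> \<Union>({{C. closedin X C \<and> C \<inter> K = {}} | K. compactin X K} \<union>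
         {{C. closedin X C \<and> C \<inter> U \<noteq> {}} | U. openin X U})"
    by (rule order_trans[OF _ Union_upper[of "{C. closedin X C \<and> C \<inter> {} = {}}"]]) (auto intro: compactin_empty)
  then show ?thesis unfolding chabauty_def by auto
qed

lemma openin_chabauty_miss:
  assumes "compactin X K"
  shows "openin (chabauty X) {C. closedin X C \<and> C \<inter> K = {}}"
  unfolding chabauty_def openin_subtopology
  using assms by (intro exI[of _ "{C. closedin X C \<and> C \<inter> K = {}}"] conjI topology_generated_by_Basis) auto

lemma openin_chabauty_hit:
  assumes "openin X U"
  shows "openin (chabauty X) {C. closedin X C \<and> C \<inter> U \<noteq> {}}"
  unfolding chabauty_def openin_subtopology
  using assms by (intro exI[of _ "{C. closedin X C \<and> C \<inter> U \<noteq> {}}"] conjI topology_generated_by_Basis) auto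

lemma continuous_map_into_chabauty:
  assumes "\<And>t. t \<in> topspace Y \<Longrightarrow> closedin X (f t)"
    and "\<And>K. compactin X K \<Longrightarrow> openin Y {t \<in> topspace Y. f t \<inter> K = {}}"
    and "\<And>U. openin X U \<Longrightarrow> openin Y {t \<in> topspace Y. f t \<inter> U \<noteq> {}}"
  shows "continuous_map Y (chabauty X) f"
  unfolding chabauty_def
proof (rule continuous_map_into_subtopology)
  show "f \<in> topspace Y \<rightarrow> {C. closedin X C}" using assms(1) by auto
  show "continuous_map Y (topology_generated_by
        ({{C. closedin X C \<and> C \<inter> K = {}} | K. compactin X K} \<union>
         {{C. closedin X C \<and> C \<inter> U \<noteq> {}} | U. openin X U})) f"
  proof (rule continuous_on_generated_topo)
    fix W assume "W \<in> {{C. closedin X C \<and> C \<inter> K = {}} | K. compactin X K} \<union>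
         {{C. closedin X C \<and> C \<inter> U \<noteq> {}} | U. openin X U}"
    then consider K where "compactin X K" "W = {C. closedin X C \<and> C \<inter> K = {}}"
      | U where "openin X U" "W = {C. closedin X C \<and> C \<inter> U \<noteq> {}}" by blast
    then show "openin Y (f -` W \<inter> topspace Y)"
    proof cases
      case 1
      have "f -` W \<inter> topspace Y = {t \<in> topspace Y. f t \<inter> K = {}}" unfolding 1 using assms(1) by auto
      then show ?thesis using assms(2)[OF 1(1)] by simp
    next
      case 2
      have "f -` W \<inter> topspace Y = {t \<in> topspace Y. f t \<inter> U \<noteq> {}}" unfolding 2 using assms(1) by auto
      then show ?thesis using assms(3)[OF 2(1)] by simp
    qed
  next
    show "f ` topspace Y \<subseteq> \<Union>({{C. closedin X C \<and> C \<inter> K = {}} | K. compactin X K} \<union>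
         {{C. closedin X C \<and> C \<inter> U \<noteq> {}} | U. openin X U})"
      by (rule order_trans[OF _ Union_upper[of "{C. closedin X C \<and> C \<inter> {} = {}}"]])
         (use assms(1) in \<open>auto intro: compactin_empty\<close>)
  qed
qed

text \<open>A closed set is encoded by the suprema of countably many functions \<open>g i\<close> on
  it. Such a supremum is lower semicontinuous in the set because the sets g i > a are open, and
  upper semicontinuous because the sets g i \<ge> c are compact for c > 0; this matches the two
  kinds of subbasic sets. The separation hypothesis makes the encoding injective and its inverse
  continuous.\<close>

lemma chabauty_embeds_in_sequence_space:
  fixes g :: "nat \<Rightarrow> 'a \<Rightarrow> real"
  assumes cont: "\<And>i. continuous_map X euclideanreal (g i)"
    and comp: "\<And>i c. c > 0 \<Longrightarrow> compactin X {x \<in> topspace X. c \<le> g i x}"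
    and range: "\<And>i x. x \<in> topspace X \<Longrightarrow> 0 \<le> g i x \<and> g i x \<le> 1"
    and sep: "\<And>x U. openin X U \<Longrightarrow> x \<in> U \<Longrightarrow> \<exists>i. g i x > 1/2 \<and> (\<forall>y\<in>topspace X - U. g i y = 0)"
  shows "\<exists>S :: (nat \<Rightarrow> real) set. chabauty X homeomorphic_space top_of_set S"
proof -
  \<comment> \<open>The inserted 0 gives the empty closed set a meaningful value and does not alter
    other suprema, since the \<open>g i\<close> are nonnegative.\<close>
  define \<Phi> where "\<Phi> C i = Sup (insert 0 (g i ` C))" for C i
  let ?T = "{C. closedin X C}"
  have gr: "\<Phi> C i > c \<longleftrightarrow> (\<exists>x\<in>C. g i x > c)" if "closedin X C" "c \<ge> 0" for C i c
  proof -
    have "bdd_above (insert 0 (g i ` C))"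
      unfolding bdd_above_def using range closedin_subset[OF that(1)] by (intro exI[of _ 1]) auto
    then show ?thesis unfolding \<Phi>_def using that(2) by (subst less_cSup_iff) auto
  qed
  have nn: "\<Phi> C i \<ge> 0" if "closedin X C" for C i
  proof -
    have "bdd_above (insert 0 (g i ` C))"
      unfolding bdd_above_def using range closedin_subset[OF that(1)] by (intro exI[of _ 1]) auto
    then show ?thesis unfolding \<Phi>_def by (intro cSup_upper) auto
  qed
  have contPhi: "continuous_map (chabauty X) euclidean \<Phi>"
  proof -
    have "continuous_map (chabauty X) euclideanreal (\<lambda>C. \<Phi> C i)" for i
      unfolding continuous_map_upper_lower_semicontinuous_lt topspace_chabauty
    proof (intro conjI allI)
      fix a :: real
      show "openin (chabauty X) {C \<in> ?T. \<Phi> C i < a}"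
      proof (subst openin_subopen, intro ballI)
        fix C assume C: "C \<in> {C \<in> ?T. \<Phi> C i < a}"
        then obtain c where c: "\<Phi> C i < c" "c < a" using dense by blast
        then have c0: "c > 0" using nn C by (metis (mono_tags, lifting) mem_Collect_eq order.strict_trans1)
        let ?K = "{x \<in> topspace X. c \<le> g i x}"
        have sub: "{C. closedin X C \<and> C \<inter> ?K = {}} \<subseteq> {C \<in> ?T. \<Phi> C i < a}"
        proof
          fix D assume D: "D \<in> {C. closedin X C \<and> C \<inter> ?K = {}}"
          then have "\<not> \<Phi> D i > c" using gr[of D c i] c0 closedin_subset[of X D] by fastforce
          then show "D \<in> {C \<in> ?T. \<Phi> C i < a}" using D c by auto
        qed
        moreover have "C \<in> {C. closedin X C \<and> C \<inter> ?K = {}}"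
        proof -
          have "\<not> (\<exists>x\<in>C. g i x > \<Phi> C i)" using gr[of C "\<Phi> C i" i] nn C by simp
          then show ?thesis using C c by force
        qed
        ultimately show "\<exists>T. openin (chabauty X) T \<and> C \<in> T \<and> T \<subseteq> {C \<in> ?T. \<Phi> C i < a}"
          using openin_chabauty_miss[OF comp[OF c0]] by blast
      qed
      show "openin (chabauty X) {C \<in> ?T. a < \<Phi> C i}"
      proof (cases "a < 0")
        case True
        then have "{C \<in> ?T. a < \<Phi> C i} = topspace (chabauty X)" unfolding topspace_chabauty by (auto intro: less_le_trans[OF _ nn])
        then show ?thesis by simp
      next
        case False
        let ?U = "{x \<in> topspace X. a < g i x}"
        have o: "openin X ?U" using cont[of i] unfolding continuous_map_upper_lower_semicontinuous_lt by blast
        have e: "{C \<in> ?T. a < \<Phi> C i} = {C. closedin X C \<and> C \<inter> ?U \<noteq> {}}"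
        proof (intro Collect_cong)
          fix C show "C \<in> ?T \<and> a < \<Phi> C i \<longleftrightarrow> closedin X C \<and> C \<inter> ?U \<noteq> {}"
            using gr[of C a i] False closedin_subset[of X C] by auto
        qed
        show ?thesis unfolding e by (rule openin_chabauty_hit[OF o])
      qed
    qed
    then show ?thesis unfolding euclidean_product_topology[symmetric] continuous_map_componentwise_UNIV by blast
  qed
  have sepc: "\<exists>i. \<Phi> C i > 1/2 \<and> \<Phi> D i = 0" if "closedin X C" "closedin X D" "x \<in> C" "x \<notin> D" for C D x
  proof -
    have "openin X (topspace X - D)" "x \<in> topspace X - D" using that closedin_subset by blast+
    then obtain i where i: "g i x > 1/2" "\<forall>y\<in>topspace X - (topspace X - D). g i y = 0" using sep by blast
    then have "\<Phi> C i > 1/2" using gr[of C "1/2" i] that by auto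
    moreover have "\<not> \<Phi> D i > 0" using gr[of D 0 i] that(2) i(2) closedin_subset[OF that(2)] by auto
    ultimately show ?thesis using nn[OF that(2), of i] by (intro exI[of _ i]) auto
  qed
  have inj: "inj_on \<Phi> ?T"
  proof (rule inj_onI)
    fix C D assume CD: "C \<in> ?T" "D \<in> ?T" "\<Phi> C = \<Phi> D"
    have "x \<in> D" if "x \<in> C" for x using sepc[of C D x] CD that by (metis (full_types) less_irrefl mem_Collect_eq half_gt_zero_iff zero_less_one order.asym)
    moreover have "x \<in> C" if "x \<in> D" for x using sepc[of D C x] CD that by (metis (full_types) less_irrefl mem_Collect_eq half_gt_zero_iff zero_less_one order.asym)
    ultimately show "C = D" by blast
  qed
  define \<Psi> where "\<Psi> = inv_into ?T \<Phi>"
  have Psi: "\<Psi> (\<Phi> C) = C" if "closedin X C" for C unfolding \<Psi>_def using inj that by (auto intro: inv_into_f_f)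
  let ?S = "\<Phi> ` ?T"
  have contPsi: "continuous_map (top_of_set ?S) (chabauty X) \<Psi>"
  proof (rule continuous_map_into_chabauty)
    show "closedin X (\<Psi> t)" if "t \<in> topspace (top_of_set ?S)" for t using that Psi by auto
    show "openin (top_of_set ?S) {t \<in> topspace (top_of_set ?S). \<Psi> t \<inter> U \<noteq> {}}" if U: "openin X U" for U
    proof (subst openin_subopen, intro ballI)
      fix t assume "t \<in> {t \<in> topspace (top_of_set ?S). \<Psi> t \<inter> U \<noteq> {}}"
      then obtain C x where C: "closedin X C" "t = \<Phi> C" "x \<in> C" "x \<in> U" using Psi by auto
      obtain i where i: "g i x > 1/2" "\<forall>y\<in>topspace X - U. g i y = 0" using sep[OF U C(4)] by blast
      let ?W = "?S \<inter> {t. 1/2 < t i}"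
      have "open {t :: nat \<Rightarrow> real. 1/2 < t i}"
        by (intro open_Collect_less continuous_intros continuous_on_product_coordinates)
      then have "openin (top_of_set ?S) ?W" by (rule openin_open_Int)
      moreover have "t \<in> ?W" using C gr[of C "1/2" i] i(1) by auto
      moreover have "?W \<subseteq> {t \<in> topspace (top_of_set ?S). \<Psi> t \<inter> U \<noteq> {}}"
      proof
        fix s assume "s \<in> ?W"
        then obtain D where D: "closedin X D" "s = \<Phi> D" "\<Phi> D i > 1/2" by auto
        then obtain y where y: "y \<in> D" "g i y > 1/2" using gr[of D "1/2" i] by auto
        then have "y \<in> U" using i(2) closedin_subset[OF D(1)] by force
        then show "s \<in> {t \<in> topspace (top_of_set ?S). \<Psi> t \<inter> U \<noteq> {}}" using D y Psi by auto
      qed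
      ultimately show "\<exists>T. openin (top_of_set ?S) T \<and> t \<in> T \<and> T \<subseteq> {t \<in> topspace (top_of_set ?S). \<Psi> t \<inter> U \<noteq> {}}"
        by blast
    qed
    show "openin (top_of_set ?S) {t \<in> topspace (top_of_set ?S). \<Psi> t \<inter> K = {}}" if K: "compactin X K" for K
    proof (subst openin_subopen, intro ballI)
      fix t assume "t \<in> {t \<in> topspace (top_of_set ?S). \<Psi> t \<inter> K = {}}"
      then obtain C where C: "closedin X C" "t = \<Phi> C" "C \<inter> K = {}" using Psi by auto
      \<comment> \<open>Compactness selects finitely many functions that vanish on \<open>C\<close>
        such that at each point of \<open>K\<close> one of them exceeds 1/2. Any closed set whose
        suprema for these functions stay below 1/2 misses \<open>K\<close>.\<close>
      define I where "I = {i. \<forall>y\<in>C. g i y = 0}"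
      define \<U> where "\<U> = (\<lambda>i. {x \<in> topspace X. 1/2 < g i x}) ` I"
      have o: "openin X {x \<in> topspace X. 1/2 < g i x}" for i
        using cont[of i] unfolding continuous_map_upper_lower_semicontinuous_lt by blast
      have "K \<subseteq> \<Union>\<U>"
      proof
        fix x assume "x \<in> K"
        then have "openin X (topspace X - C)" "x \<in> topspace X - C"
          using C(1,3) compactin_subset_topspace[OF K] by blast+
        from sep[OF this] obtain i where i: "g i x > 1/2" "\<forall>y\<in>topspace X - (topspace X - C). g i y = 0" by blast
        then have "i \<in> I" unfolding I_def using closedin_subset[OF C(1)] by auto
        then show "x \<in> \<Union>\<U>" unfolding \<U>_def using i(1) \<open>x \<in> topspace X - C\<close> by auto
      qed
      moreover have "\<And>U. U \<in> \<U> \<Longrightarrow> openin X U" unfolding \<U>_def using o by auto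
      ultimately obtain \<F> where \<F>: "finite \<F>" "\<F> \<subseteq> \<U>" "K \<subseteq> \<Union>\<F>" using compactinD[OF K] by metis
      then obtain J where J: "finite J" "J \<subseteq> I" "\<F> = (\<lambda>i. {x \<in> topspace X. 1/2 < g i x}) ` J"
        using finite_subset_image[OF \<F>(1) \<F>(2)[unfolded \<U>_def]] by (elim exE conjE)
      let ?W = "?S \<inter> (\<Inter>i\<in>J. {t. t i < 1/2})"
      have "open (\<Inter>i\<in>J. {t :: nat \<Rightarrow> real. t i < 1/2})"
        using J(1) by (intro open_INT open_Collect_less continuous_intros continuous_on_product_coordinates ballI)
      then have "openin (top_of_set ?S) ?W" by (rule openin_open_Int)
      moreover have "t \<in> ?W"
      proof -
        have "\<Phi> C i < 1/2" if "i \<in> J" for i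
        proof -
          have "\<not> \<Phi> C i > 0" using gr[of C 0 i] C(1) that J(2) unfolding I_def by auto
          then show ?thesis by simp
        qed
        then show ?thesis using C by auto
      qed
      moreover have "?W \<subseteq> {t \<in> topspace (top_of_set ?S). \<Psi> t \<inter> K = {}}"
      proof
        fix s assume s: "s \<in> ?W"
        then obtain D where D: "closedin X D" "s = \<Phi> D" by auto
        have "D \<inter> K = {}"
        proof (rule ccontr)
          assume "D \<inter> K \<noteq> {}"
          then obtain x where x: "x \<in> D" "x \<in> K" by blast
          then obtain i where i: "i \<in> J" "1/2 < g i x" using \<F>(3) J(3) by auto
          then have "\<Phi> D i > 1/2" using gr[of D "1/2" i] D x by auto
          moreover have "s i < 1/2" using s i(1) by blast
          ultimately show False using D(2) by simp
        qed
        then show "s \<in> {t \<in> topspace (top_of_set ?S). \<Psi> t \<inter> K = {}}" using D Psi by auto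
      qed
      ultimately show "\<exists>T. openin (top_of_set ?S) T \<and> t \<in> T \<and> T \<subseteq> {t \<in> topspace (top_of_set ?S). \<Psi> t \<inter> K = {}}"
        by blast
    qed
  qed
  have "homeomorphic_maps (chabauty X) (top_of_set ?S) \<Phi> \<Psi>"
    unfolding homeomorphic_maps_def
    using contPhi contPsi Psi by (auto simp: topspace_chabauty continuous_map_in_subtopology)
  then show ?thesis unfolding homeomorphic_space_def by blast
qed

text \<open>On integral values the floor merely changes the type from \<open>real\<close> to
  \<open>int\<close>; a set of integers pulls back to the union of the intervals of radius 1/2 about
  its elements.\<close>

lemma continuous_map_floor_of_Ints:
  fixes h :: "'a \<Rightarrow> real"
  assumes "continuous_map Y euclideanreal h" "\<And>t. t \<in> topspace Y \<Longrightarrow> h t \<in> \<int>"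
  shows "continuous_map Y (euclidean :: int topology) (\<lambda>t. \<lfloor>h t\<rfloor>)"
  unfolding continuous_map_def
proof (intro conjI allI impI)
  fix U :: "int set"
  have "openin Y {t \<in> topspace Y. h t \<in> (\<Union>s\<in>U. ball (of_int s) (1/2))}"
    using assms(1) by (rule openin_continuous_map_preimage) auto
  moreover have "h t \<in> (\<Union>s\<in>U. ball (of_int s) (1/2)) \<longleftrightarrow> \<lfloor>h t\<rfloor> \<in> U" if t: "t \<in> topspace Y" for t
  proof -
    obtain z where z: "h t = of_int z" using assms(2)[OF t] by (auto elim: Ints_cases)
    have "dist (real_of_int s) (of_int z) < 1/2 \<longleftrightarrow> s = z" for s
    proof
      assume "dist (real_of_int s) (of_int z) < 1/2"
      then have "\<bar>real_of_int (s - z)\<bar> < 1" by (simp add: dist_real_def)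
      then have "\<bar>s - z\<bar> < 1" by linarith
      then show "s = z" by simp
    qed simp
    then show ?thesis unfolding z by auto
  qed
  ultimately show "openin Y {t \<in> topspace Y. \<lfloor>h t\<rfloor> \<in> U}" by (smt (verit) Collect_cong)
qed simp

section \<open>Embedding the Chabauty space of the group\<close>

lemma topspace_G_top [simp]: "topspace (G_top k l m) = G_carrier k l m"
  unfolding G_top_def by (auto simp: topspace_prod_topology)

lemma continuous_map_into_G_top:
  assumes "\<And>i. continuous_map Y euclideanreal (\<lambda>t. a t i)"
    "\<And>i. continuous_map Y euclidean (\<lambda>t. b t i)"
    "\<And>i. continuous_map Y euclidean (\<lambda>t. c t i)"
    "continuous_map Y (discrete_topology UNIV) f"
    "\<And>t. t \<in> topspace Y \<Longrightarrow> (a t, b t, c t, f t) \<in> G_carrier k l m"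
  shows "continuous_map Y (G_top k l m) (\<lambda>t. (a t, b t, c t, f t))"
  unfolding G_top_def
  by (rule continuous_map_into_subtopology)
     (use assms in \<open>auto simp: continuous_map_pairedI continuous_map_componentwise_UNIV\<close>)

lemma continuous_map_G_coords:
  shows "continuous_map (G_top k l m :: 'f Gelem topology) euclideanreal (\<lambda>x. fst x i)"
    "continuous_map (G_top k l m :: 'f Gelem topology) euclidean (\<lambda>x. fst (snd x) i)"
    "continuous_map (G_top k l m :: 'f Gelem topology) euclidean (\<lambda>x. fst (snd (snd x)) i)"
    "continuous_map (G_top k l m :: 'f Gelem topology) (discrete_topology UNIV) (\<lambda>x. snd (snd (snd x)))"
proof -
  let ?P = "prod_topology (powertop_real (UNIV::nat set))
       (prod_topology (product_topology (\<lambda>_. (euclidean :: int topology)) (UNIV::nat set))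
         (prod_topology (product_topology (\<lambda>_. (euclidean :: complex topology)) (UNIV::nat set))
           (discrete_topology (UNIV :: 'f set))))"
  have 1: "continuous_map ?P (powertop_real UNIV) fst" by (rule continuous_map_fst)
  have s1: "continuous_map ?P (prod_topology (product_topology (\<lambda>_. (euclidean :: int topology)) (UNIV::nat set))
         (prod_topology (product_topology (\<lambda>_. (euclidean :: complex topology)) (UNIV::nat set))
           (discrete_topology (UNIV :: 'f set)))) snd" by (rule continuous_map_snd)
  have 2: "continuous_map ?P (product_topology (\<lambda>_. (euclidean :: int topology)) (UNIV::nat set)) (\<lambda>x. fst (snd x))"
    using continuous_map_compose[OF s1 continuous_map_fst] by (simp add: o_def)
  have s2: "continuous_map ?P (prod_topology (product_topology (\<lambda>_. (euclidean :: complex topology)) (UNIV::nat set))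
           (discrete_topology (UNIV :: 'f set))) (\<lambda>x. snd (snd x))"
    using continuous_map_compose[OF s1 continuous_map_snd] by (simp add: o_def)
  have 3: "continuous_map ?P (product_topology (\<lambda>_. (euclidean :: complex topology)) (UNIV::nat set)) (\<lambda>x. fst (snd (snd x)))"
    using continuous_map_compose[OF s2 continuous_map_fst] by (simp add: o_def)
  have 4: "continuous_map ?P (discrete_topology UNIV) (\<lambda>x. snd (snd (snd x)))"
    using continuous_map_compose[OF s2 continuous_map_snd] by (simp add: o_def)
  show "continuous_map (G_top k l m :: 'f Gelem topology) euclideanreal (\<lambda>x. fst x i)"
    unfolding G_top_def using continuous_map_compose[OF 1 continuous_map_product_projection[of i]]
    by (intro continuous_map_from_subtopology) (simp add: o_def)
  show "continuous_map (G_top k l m :: 'f Gelem topology) euclidean (\<lambda>x. fst (snd x) i)"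
    unfolding G_top_def using continuous_map_compose[OF 2 continuous_map_product_projection[of i]]
    by (intro continuous_map_from_subtopology) (simp add: o_def)
  show "continuous_map (G_top k l m :: 'f Gelem topology) euclidean (\<lambda>x. fst (snd (snd x)) i)"
    unfolding G_top_def using continuous_map_compose[OF 3 continuous_map_product_projection[of i]]
    by (intro continuous_map_from_subtopology) (simp add: o_def)
  show "continuous_map (G_top k l m :: 'f Gelem topology) (discrete_topology UNIV) (\<lambda>x. snd (snd (snd x)))"
    unfolding G_top_def using 4 by (rule continuous_map_from_subtopology)
qed

lemma Hausdorff_euclidean_int: "Hausdorff_space (euclidean :: int topology)"
  unfolding Hausdorff_space_def
proof (intro allI impI)
  fix x y :: int assume "x \<in> topspace euclidean \<and> y \<in> topspace euclidean \<and> x \<noteq> y"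
  then show "\<exists>U V. openin euclidean U \<and> openin euclidean V \<and> x \<in> U \<and> y \<in> V \<and> disjnt U V"
    by (intro exI[of _ "{x}"] exI[of _ "{y}"]) (auto simp: open_discrete)
qed

lemma Hausdorff_G_top: "Hausdorff_space (G_top k l m)"
  unfolding G_top_def
  by (intro Hausdorff_space_subtopology) (auto simp: Hausdorff_space_prod_topology Hausdorff_space_product_topology Hausdorff_euclidean_int)

text \<open>The distance to a centre; the integer coordinates of a centre are allowed to be real,
  so that a countable dense set of centres comes for free.\<close>

definition cdist :: "nat \<Rightarrow> nat \<Rightarrow> nat \<Rightarrow> (nat \<Rightarrow> real) \<times> (nat \<Rightarrow> real) \<times> (nat \<Rightarrow> complex) \<Rightarrow> 'f \<Rightarrow> 'f Gelem \<Rightarrow> real" where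
  "cdist k l m q e x = (\<Sum>i<k. \<bar>fst x i - fst q i\<bar>) + (\<Sum>i<l. \<bar>real_of_int (fst (snd x) i) - fst (snd q) i\<bar>)
     + (\<Sum>i<m. cmod (fst (snd (snd x)) i - snd (snd q) i)) + (if snd (snd (snd x)) = e then 0 else 1)"

lemma cdist_nonneg: "0 \<le> cdist k l m q e x"
  unfolding cdist_def by (intro add_nonneg_nonneg sum_nonneg) auto

lemma continuous_map_cdist: "continuous_map (G_top k l m) euclideanreal (cdist k l m q e)"
proof -
  have i: "continuous_map (G_top k l m) euclideanreal (\<lambda>x. real_of_int (fst (snd x) i))" for i
  proof -
    have "continuous_map (euclidean :: int topology) euclideanreal real_of_int"
      by (simp add: continuous_on_discrete)
    from continuous_map_compose[OF continuous_map_G_coords(2) this] show ?thesis by (simp add: o_def)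
  qed
  have d: "continuous_map (G_top k l m) euclideanreal (\<lambda>x. if snd (snd (snd x)) = e then 0 else 1)"
  proof -
    have "continuous_map (discrete_topology UNIV) euclideanreal (\<lambda>f. if f = e then 0 else 1)" by simp
    from continuous_map_compose[OF continuous_map_G_coords(4) this] show ?thesis by (simp add: o_def)
  qed
  show ?thesis unfolding cdist_def
    by (intro continuous_map_add continuous_map_sum continuous_map_real_abs continuous_map_diff
      continuous_map_norm continuous_map_const[THEN iffD2] continuous_map_G_coords i d) auto
qed

text \<open>The ball is a closed subset of a product of bounded intervals, finite sets of integers,
  circles and the finite group.\<close>

lemma compactin_cdist_ball: "compactin (G_top k l m) {x \<in> G_carrier k l m. cdist k l m q (e::'f::finite) x \<le> r}"
proof -
  let ?P = "prod_topology (powertop_real (UNIV::nat set))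
       (prod_topology (product_topology (\<lambda>_. (euclidean :: int topology)) (UNIV::nat set))
         (prod_topology (product_topology (\<lambda>_. (euclidean :: complex topology)) (UNIV::nat set))
           (discrete_topology (UNIV :: 'f set))))"
  define A where "A = (\<Pi>\<^sub>E i\<in>UNIV. if i < k then {fst q i - r..fst q i + r} else {0::real})"
  define B where "B = (\<Pi>\<^sub>E i\<in>UNIV. if i < l then {\<lfloor>fst (snd q) i - r\<rfloor>..\<lceil>fst (snd q) i + r\<rceil>} else {0::int})"
  define C where "C = (\<Pi>\<^sub>E i\<in>(UNIV::nat set). if i < m then sphere (0::complex) 1 else {1})"
  have ABC: "compactin ?P (A \<times> B \<times> C \<times> (UNIV :: 'f set))"
  proof -
    have "compactin (powertop_real UNIV) A" unfolding A_def compactin_PiE by auto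
    moreover have "compactin (product_topology (\<lambda>_. (euclidean :: int topology)) (UNIV::nat set)) B"
      unfolding B_def compactin_PiE by (auto simp: finite_imp_compact)
    moreover have "compactin (product_topology (\<lambda>_. (euclidean :: complex topology)) (UNIV::nat set)) C"
      unfolding C_def compactin_PiE by auto
    ultimately show ?thesis unfolding compactin_Times by (auto simp: finite_imp_compactin)
  qed
  have sub: "A \<times> B \<times> C \<times> (UNIV :: 'f set) \<subseteq> G_carrier k l m"
    unfolding A_def B_def C_def G_carrier_def by (auto simp: PiE_iff split: if_splits)
  have cpt: "compactin (G_top k l m) (A \<times> B \<times> C \<times> (UNIV :: 'f set))"
    unfolding G_top_def compactin_subtopology by (intro conjI ABC sub)
  have "{x \<in> G_carrier k l m. cdist k l m q e x \<le> r} \<subseteq> A \<times> B \<times> C \<times> (UNIV :: 'f set)"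
  proof
    fix x assume x: "x \<in> {x \<in> G_carrier k l m. cdist k l m q e x \<le> r}"
    obtain a b c f where abc: "x = (a, b, c, f)" by (cases x)
    have s: "\<bar>a i - fst q i\<bar> \<le> r" if "i < k" for i
    proof -
      have "\<bar>a i - fst q i\<bar> \<le> (\<Sum>i<k. \<bar>a i - fst q i\<bar>)" using that by (intro member_le_sum) auto
      also have "\<dots> \<le> cdist k l m q e x" unfolding cdist_def abc by (auto intro!: add_nonneg_nonneg sum_nonneg)
      finally show ?thesis using x by simp
    qed
    have t: "\<bar>real_of_int (b i) - fst (snd q) i\<bar> \<le> r" if "i < l" for i
    proof -
      have "\<bar>real_of_int (b i) - fst (snd q) i\<bar> \<le> (\<Sum>i<l. \<bar>real_of_int (b i) - fst (snd q) i\<bar>)"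
        using that by (intro member_le_sum) auto
      also have "\<dots> \<le> cdist k l m q e x" unfolding cdist_def abc by (auto intro!: add_nonneg_nonneg sum_nonneg)
      finally show ?thesis using x by simp
    qed
    have "fst q i - r \<le> a i \<and> a i \<le> fst q i + r" if "i < k" for i using s[OF that] by linarith
    then have "a \<in> A" unfolding A_def using x by (auto simp: abc G_carrier_def PiE_iff)
    moreover have "b \<in> B" unfolding B_def
    proof (rule PiE_I)
      fix i :: nat
      show "b i \<in> (if i < l then {\<lfloor>fst (snd q) i - r\<rfloor>..\<lceil>fst (snd q) i + r\<rceil>} else {0::int})"
      proof (cases "i < l")
        case True
        then have "fst (snd q) i - r \<le> real_of_int (b i)" "real_of_int (b i) \<le> fst (snd q) i + r" using t[OF True] by linarith+
        then show ?thesis using True by (auto simp: floor_le_iff le_ceiling_iff)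
      next
        case False then show ?thesis using x by (auto simp: abc G_carrier_def)
      qed
    qed simp
    moreover have "c \<in> C" unfolding C_def using x by (auto simp: abc G_carrier_def PiE_iff)
    ultimately show "x \<in> A \<times> B \<times> C \<times> (UNIV :: 'f set)" unfolding abc by auto
  qed
  moreover have "closedin (G_top k l m) {x \<in> topspace (G_top k l m). cdist k l m q e x \<in> {..r}}"
    by (rule closedin_continuous_map_preimage[OF continuous_map_cdist]) auto
  ultimately show ?thesis using closed_compactin[OF cpt] by (simp add: atMost_def)
qed

definition centre :: "'f Gelem \<Rightarrow> (nat \<Rightarrow> real) \<times> (nat \<Rightarrow> real) \<times> (nat \<Rightarrow> complex)" where
  "centre x = (fst x, \<lambda>i. real_of_int (fst (snd x) i), fst (snd (snd x)))"

text \<open>Otherwise points outside \<open>U\<close> would exist at \<open>cdist\<close> below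
  1/(n+1) for every n. They converge to \<open>x\<close> in every coordinate, the integral and
  finite ones being eventually constant, so they must enter \<open>U\<close>.\<close>

lemma openin_G_top_cdist:
  assumes "openin (G_top k l m) U" "x \<in> U"
  shows "\<exists>e>0. \<forall>y\<in>G_carrier k l m. cdist k l m (centre x) (snd (snd (snd x))) y < e \<longrightarrow> y \<in> U"
proof (rule ccontr)
  let ?d = "cdist k l m (centre x) (snd (snd (snd x)))"
  assume "\<not> ?thesis"
  then have "\<forall>n. \<exists>y. y \<in> G_carrier k l m \<and> ?d y < 1 / real (Suc n) \<and> y \<notin> U"
    by (metis of_nat_0_less_iff zero_less_Suc zero_less_divide_1_iff)
  then obtain y where y: "\<And>n. y n \<in> G_carrier k l m" "\<And>n. ?d (y n) < 1 / real (Suc n)" "\<And>n. y n \<notin> U" by metis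
  have xG: "x \<in> G_carrier k l m" using assms openin_subset by fastforce
  have lim0: "(\<lambda>n. ?d (y n)) \<longlonglongrightarrow> 0"
  proof (rule tendsto_sandwich[of "\<lambda>_. 0" _ _ "\<lambda>n. 1 / real (Suc n)"])
    show "(\<lambda>n. 1 / real (Suc n)) \<longlonglongrightarrow> 0" using LIMSEQ_inverse_real_of_nat by (simp add: inverse_eq_divide)
  qed (use y(2) in \<open>auto simp: cdist_nonneg simp del: of_nat_Suc intro!: always_eventually less_imp_le\<close>)
  have a: "(\<lambda>n. fst (y n) i) \<longlonglongrightarrow> fst x i" for i
  proof (cases "i < k")
    case True
    have "norm (fst (y n) i - fst x i) \<le> ?d (y n)" for n
    proof -
      have "norm (fst (y n) i - fst x i) \<le> (\<Sum>i<k. \<bar>fst (y n) i - fst x i\<bar>)"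
        using True by (simp, intro member_le_sum) auto
      also have "\<dots> \<le> ?d (y n)" unfolding cdist_def centre_def by (auto intro!: add_nonneg_nonneg sum_nonneg)
      finally show ?thesis .
    qed
    then have "(\<lambda>n. fst (y n) i - fst x i) \<longlonglongrightarrow> 0" by (rule Lim_null_comparison[OF always_eventually[OF allI] lim0])
    then show ?thesis using LIM_zero_iff by blast
  next
    case False
    then have "fst (y n) i = fst x i" for n using y(1)[of n] xG by (auto simp: G_carrier_def)
    then show ?thesis by simp
  qed
  have c: "(\<lambda>n. fst (snd (snd (y n))) i) \<longlonglongrightarrow> fst (snd (snd x)) i" for i
  proof (cases "i < m")
    case True
    have "norm (fst (snd (snd (y n))) i - fst (snd (snd x)) i) \<le> ?d (y n)" for n
    proof -
      have "norm (fst (snd (snd (y n))) i - fst (snd (snd x)) i) \<le> (\<Sum>i<m. cmod (fst (snd (snd (y n))) i - fst (snd (snd x)) i))"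
        using True by (intro member_le_sum) auto
      also have "\<dots> \<le> ?d (y n)" unfolding cdist_def centre_def by (auto intro!: add_nonneg_nonneg sum_nonneg)
      finally show ?thesis .
    qed
    then have "(\<lambda>n. fst (snd (snd (y n))) i - fst (snd (snd x)) i) \<longlonglongrightarrow> 0" by (rule Lim_null_comparison[OF always_eventually[OF allI] lim0])
    then show ?thesis using LIM_zero_iff by blast
  next
    case False
    then have "fst (snd (snd (y n))) i = fst (snd (snd x)) i" for n using y(1)[of n] xG by (auto simp: G_carrier_def)
    then show ?thesis by simp
  qed
  have ev: "eventually (\<lambda>n. ?d (y n) < 1) sequentially" using lim0 by (rule order_tendstoD) simp
  have b: "eventually (\<lambda>n. fst (snd (y n)) i = fst (snd x) i) sequentially" for i
    using ev
  proof eventually_elim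
    case (elim n)
    show ?case
    proof (cases "i < l")
      case True
      have "\<bar>real_of_int (fst (snd (y n)) i) - real_of_int (fst (snd x) i)\<bar>
         \<le> (\<Sum>i<l. \<bar>real_of_int (fst (snd (y n)) i) - real_of_int (fst (snd x) i)\<bar>)"
        using True by (intro member_le_sum) auto
      also have "\<dots> \<le> ?d (y n)" unfolding cdist_def centre_def by (auto intro!: add_nonneg_nonneg sum_nonneg)
      finally show ?thesis using elim by linarith
    next
      case False
      then show ?thesis using y(1)[of n] xG by (auto simp: G_carrier_def)
    qed
  qed
  have f: "eventually (\<lambda>n. snd (snd (snd (y n))) = snd (snd (snd x))) sequentially"
    using ev
  proof eventually_elim
    case (elim n)
    have "0 \<le> (\<Sum>i<k. \<bar>fst (y n) i - fst (centre x) i\<bar>) + (\<Sum>i<l. \<bar>real_of_int (fst (snd (y n)) i) - fst (snd (centre x)) i\<bar>)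
     + (\<Sum>i<m. cmod (fst (snd (snd (y n))) i - snd (snd (centre x)) i))"
      by (intro add_nonneg_nonneg sum_nonneg) auto
    then show ?case using elim unfolding cdist_def by (auto split: if_splits)
  qed
  have "limitin (G_top k l m) y x sequentially"
    unfolding G_top_def limitin_subtopology limitin_pairwise
  proof (intro conjI)
    show "x \<in> G_carrier k l m" "\<forall>\<^sub>F a in sequentially. y a \<in> G_carrier k l m" using xG y(1) by auto
    show "limitin (powertop_real UNIV) (fst \<circ> y) (fst x) sequentially"
      unfolding limitin_componentwise using a by auto
    show "limitin (product_topology (\<lambda>_. euclidean) UNIV) (fst \<circ> (snd \<circ> y)) (fst (snd x)) sequentially"
      unfolding limitin_componentwise using b by (auto intro: tendsto_eventually)
    show "limitin (product_topology (\<lambda>_. euclidean) UNIV) (fst \<circ> (snd \<circ> (snd \<circ> y))) (fst (snd (snd x))) sequentially"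
      unfolding limitin_componentwise using c by auto
    show "limitin (discrete_topology UNIV) (snd \<circ> (snd \<circ> (snd \<circ> y))) (snd (snd (snd x))) sequentially"
      unfolding limitin_def using f by (auto elim: eventually_mono)
  qed
  then have "eventually (\<lambda>n. y n \<in> U) sequentially" using assms unfolding limitin_def by blast
  then show False using y(3) by simp
qed

text \<open>All terms use the component of \<open>x\<close> in the finite group, so only
  \<open>y\<close> contributes there and an arbitrary \<open>q\<close> can serve as intermediate
  point.\<close>

lemma cdist_triangle:
  "cdist k l m (centre x) (snd (snd (snd x))) y \<le> cdist k l m q (snd (snd (snd x))) x + cdist k l m q (snd (snd (snd x))) y"
proof -
  have "(\<Sum>i<k. \<bar>fst y i - fst x i\<bar>) \<le> (\<Sum>i<k. \<bar>fst x i - fst q i\<bar>) + (\<Sum>i<k. \<bar>fst y i - fst q i\<bar>)"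
    unfolding sum.distrib[symmetric] by (intro sum_mono) linarith
  moreover have "(\<Sum>i<l. \<bar>real_of_int (fst (snd y) i) - real_of_int (fst (snd x) i)\<bar>)
    \<le> (\<Sum>i<l. \<bar>real_of_int (fst (snd x) i) - fst (snd q) i\<bar>) + (\<Sum>i<l. \<bar>real_of_int (fst (snd y) i) - fst (snd q) i\<bar>)"
    unfolding sum.distrib[symmetric] by (intro sum_mono) linarith
  moreover have "(\<Sum>i<m. cmod (fst (snd (snd y)) i - fst (snd (snd x)) i))
    \<le> (\<Sum>i<m. cmod (fst (snd (snd x)) i - snd (snd q) i)) + (\<Sum>i<m. cmod (fst (snd (snd y)) i - snd (snd q) i))"
    unfolding sum.distrib[symmetric] 
  proof (intro sum_mono)
    fix i
    show "cmod (fst (snd (snd y)) i - fst (snd (snd x)) i)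
      \<le> cmod (fst (snd (snd x)) i - snd (snd q) i) + cmod (fst (snd (snd y)) i - snd (snd q) i)"
      using norm_triangle_ineq4[of "fst (snd (snd y)) i - snd (snd q) i" "fst (snd (snd x)) i - snd (snd q) i"] by simp
  qed
  ultimately show ?thesis unfolding cdist_def centre_def by simp
qed

lemma chabauty_G_embeds:
  "\<exists>S :: (nat \<Rightarrow> real) set. chabauty (G_top k l m :: 'f::finite Gelem topology) homeomorphic_space top_of_set S"
proof -
  obtain D :: "((nat \<Rightarrow> real) \<times> (nat \<Rightarrow> real) \<times> (nat \<Rightarrow> complex)) set"
    where D: "countable D" "\<And>X. open X \<Longrightarrow> X \<noteq> {} \<Longrightarrow> \<exists>d\<in>D. d \<in> X" using countable_dense_exists by blast
  define I where "I = D \<times> (UNIV :: 'f set) \<times> (UNIV :: nat set)"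
  have cI: "countable I" unfolding I_def using D(1) by (intro countable_SIGMA) (auto simp: countable_finite)
  have neI: "I \<noteq> {}" using D(2)[of UNIV] unfolding I_def by auto
  \<comment> \<open>Tent functions of height 1 and radius 1/(N + 1) about the centres from the
    countable dense set \<open>D\<close>.\<close>
  define G where "G = (\<lambda>(q, e, N) (x :: 'f Gelem). max 0 (1 - real (Suc N) * cdist k l m q e x))"
  have fni: "range (from_nat_into I) = I" using cI neI by simp
  show ?thesis
  proof (rule chabauty_embeds_in_sequence_space[where g = "\<lambda>i. G (from_nat_into I i)"])
    fix i
    obtain q e N where i: "from_nat_into I i = (q, e, N)" by (metis prod_cases3)
    show "continuous_map (G_top k l m) euclideanreal (G (from_nat_into I i))"
      unfolding i G_def prod.case
      by (intro continuous_map_real_max continuous_map_diff continuous_map_real_mult continuous_map_cdist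
         continuous_map_const[THEN iffD2]) auto
    show "0 \<le> G (from_nat_into I i) x \<and> G (from_nat_into I i) x \<le> 1" for x
      unfolding i G_def using cdist_nonneg[of k l m q e x] by auto
    show "compactin (G_top k l m) {x \<in> topspace (G_top k l m). c \<le> G (from_nat_into I i) x}" if "c > 0" for c
    proof -
      have "closedin (G_top k l m) {x \<in> topspace (G_top k l m). G (from_nat_into I i) x \<in> {c..}}"
        by (rule closedin_continuous_map_preimage[OF \<open>continuous_map (G_top k l m) euclideanreal (G (from_nat_into I i))\<close>]) auto
      moreover have "{x \<in> topspace (G_top k l m). G (from_nat_into I i) x \<in> {c..}} \<subseteq> {x \<in> G_carrier k l m. cdist k l m q e x \<le> 1}"
      proof
        fix x assume x: "x \<in> {x \<in> topspace (G_top k l m). G (from_nat_into I i) x \<in> {c..}}"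
        then have "real (Suc N) * cdist k l m q e x \<le> 1" using that unfolding i G_def by auto
        moreover have "1 * cdist k l m q e x \<le> real (Suc N) * cdist k l m q e x"
          by (rule mult_right_mono[OF _ cdist_nonneg]) simp
        ultimately show "x \<in> {x \<in> G_carrier k l m. cdist k l m q e x \<le> 1}" using x by auto
      qed
      ultimately show ?thesis using closed_compactin[OF compactin_cdist_ball] by (simp add: atLeast_def)
    qed
  next
    fix x and U :: "'f Gelem set" assume U: "openin (G_top k l m) U" "x \<in> U"
    let ?f = "snd (snd (snd x))"
    obtain e where e: "e > 0" "\<And>y. y \<in> G_carrier k l m \<Longrightarrow> cdist k l m (centre x) ?f y < e \<Longrightarrow> y \<in> U"
      using openin_G_top_cdist[OF U] by blast
    \<comment> \<open>Put s = 1/(N + 1). A centre within s/2 of \<open>x\<close> gives a value above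
      1/2 at \<open>x\<close>. The support then reaches at most 3s/2 from \<open>x\<close>, which is
      less than \<open>e\<close> because s < e/4.\<close>
    obtain N where N: "1 / real (Suc N) < e / 4" using nat_approx_posE[of "e/4"] e(1) by auto
    define W where "W = {q. cdist k l m q ?f x < 1 / (2 * real (Suc N))}"
    have "open W" unfolding W_def cdist_def
      by (intro open_Collect_less continuous_intros continuous_on_product_then_coordinatewise[where f = fst]
         continuous_on_product_then_coordinatewise[where f = "\<lambda>x. fst (snd x)"]
         continuous_on_product_then_coordinatewise[where f = "\<lambda>x. snd (snd x)"])
    moreover have "centre x \<in> W" unfolding W_def cdist_def centre_def by simp
    ultimately obtain q where q: "q \<in> D" "q \<in> W" using D(2) by blast
    obtain i where i: "from_nat_into I i = (q, ?f, N)" using fni q(1) unfolding I_def by (metis (no_types, lifting) SigmaI UNIV_I imageE)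
    show "\<exists>i. 1/2 < G (from_nat_into I i) x \<and> (\<forall>y\<in>topspace (G_top k l m) - U. G (from_nat_into I i) y = 0)"
    proof (intro exI[of _ i] conjI ballI)
      have "real (Suc N) * cdist k l m q ?f x < real (Suc N) * (1 / (2 * real (Suc N)))"
        using q(2) unfolding W_def by (intro mult_strict_left_mono) auto
      then have "real (Suc N) * cdist k l m q ?f x < 1/2" by (simp del: of_nat_Suc)
      then show "1/2 < G (from_nat_into I i) x" unfolding i G_def by auto
      fix y assume "y \<in> topspace (G_top k l m) - U"
      then have "e \<le> cdist k l m (centre x) ?f y" using e(2)[of y] by force
      also have "\<dots> \<le> cdist k l m q ?f x + cdist k l m q ?f y" by (rule cdist_triangle)
      finally have "e \<le> 1 / (2 * real (Suc N)) + cdist k l m q ?f y" using q(2) unfolding W_def by auto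
      moreover define s where "s = 1 / real (Suc N)"
      moreover have "s \<ge> 0" "1 / (2 * real (Suc N)) = s / 2" unfolding s_def by simp_all
      ultimately have "s \<le> cdist k l m q ?f y" using N unfolding s_def[symmetric] by linarith
      then have "1 / real (Suc N) \<le> cdist k l m q ?f y" unfolding s_def .
      then have "1 \<le> real (Suc N) * cdist k l m q ?f y" by (simp add: field_simps del: of_nat_Suc)
      then show "G (from_nat_into I i) y = 0" unfolding i G_def by auto
    qed
  qed
qed

lemma SG_embeds:
  "\<exists>S :: (nat \<Rightarrow> real) set. (SG k l m :: 'f::{finite,ab_group_add} Gelem set topology) homeomorphic_space top_of_set S"
proof -
  obtain S :: "(nat \<Rightarrow> real) set" and f where f: "homeomorphic_map (chabauty (G_top k l m :: 'f Gelem topology)) (top_of_set S) f"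
    using chabauty_G_embeds homeomorphic_space by blast
  let ?C = "closed_subgroups k l m :: 'f Gelem set set"
  have "homeomorphic_map (subtopology (chabauty (G_top k l m)) ?C) (subtopology (top_of_set S) (f ` (topspace (chabauty (G_top k l m)) \<inter> ?C))) f"
    by (rule homeomorphic_map_subtopologies[OF f]) (use homeomorphic_imp_surjective_map[OF f] in auto)
  then have "homeomorphic_map (SG k l m) (top_of_set (S \<inter> f ` (topspace (chabauty (G_top k l m)) \<inter> ?C))) f"
    unfolding SG_def subtopology_subtopology .
  then show ?thesis using homeomorphic_map_imp_homeomorphic_space by blast
qed

section \<open>The covering of the group\<close>

lemma G_add_simp: "G_add (a, b, c, f) (a', b', c', f') = (\<lambda>i. a i + a' i, \<lambda>i. b i + b' i, \<lambda>i. c i * c' i, f + f')"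
  by (simp add: G_add_def)

lemma cis_2pi_eq_iff: "cis (2 * pi * s) = cis (2 * pi * t) \<longleftrightarrow> s - t \<in> \<int>"
proof -
  have "cis (2 * pi * s) = cis (2 * pi * t) \<longleftrightarrow> (\<exists>n::int. 2 * pi * s = 2 * pi * t + 2 * pi * n)"
    using sin_cos_eq_iff[of "2 * pi * s" "2 * pi * t"] by (auto simp: complex_eq_iff)
  also have "\<dots> \<longleftrightarrow> (\<exists>n::int. 2 * pi * (s - t) = 2 * pi * n)" by (simp add: algebra_simps)
  also have "\<dots> \<longleftrightarrow> (\<exists>n::int. s - t = n)" by simp
  also have "\<dots> \<longleftrightarrow> s - t \<in> \<int>" by (auto simp: Ints_def)
  finally show ?thesis .
qed

locale params =
  fixes k l m :: nat
begin

abbreviation n where "n \<equiv> k + m + l"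

text \<open>The coordinates of the covering group \<open>E \<times> F\<close> are ordered as follows: the real ones are \<open>i < k\<close>, those covering
  the torus are \<open>k \<le> i < k + m\<close>, the integer ones are \<open>k + m \<le> i < n\<close>.\<close>

definition E :: "(nat \<Rightarrow> real) set" where
  "E = {x. (\<forall>i\<ge>n. x i = 0) \<and> (\<forall>i\<ge>k + m. x i \<in> \<int>)}"

text \<open>On \<open>E\<close> the last coordinates are integral, so the floor only converts them
  to \<open>int\<close>; torus coordinates are wound around the circle with period 1. Additivity and
  continuity are claimed on \<open>E\<close> only.\<close>

definition pr :: "(nat \<Rightarrow> real) \<Rightarrow> 'f \<Rightarrow> 'f Gelem" where
  "pr x f = (\<lambda>i. if i < k then x i else 0, \<lambda>i. if i < l then \<lfloor>x (k + m + i)\<rfloor> else 0,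
     \<lambda>i. if i < m then cis (2 * pi * x (k + i)) else 1, f)"

lemma pr_sel:
  "fst (pr x f) = (\<lambda>i. if i < k then x i else 0)"
  "fst (snd (pr x f)) = (\<lambda>i. if i < l then \<lfloor>x (k + m + i)\<rfloor> else 0)"
  "fst (snd (snd (pr x f))) = (\<lambda>i. if i < m then cis (2 * pi * x (k + i)) else 1)"
  "snd (snd (snd (pr x f))) = f"
  by (simp_all add: pr_def)

lemma pr_in_carrier: "pr x f \<in> G_carrier k l m"
  unfolding pr_def G_carrier_def by auto

lemma E_add: "x \<in> E \<Longrightarrow> y \<in> E \<Longrightarrow> (\<lambda>i. x i + y i) \<in> E"
  unfolding E_def by auto

lemma E_neg: "x \<in> E \<Longrightarrow> (\<lambda>i. - x i) \<in> E"
  unfolding E_def by auto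

lemma closed_E: "closed E"
proof -
  have "closed {x :: nat \<Rightarrow> real. x i \<in> \<int>}" for i
    using closed_vimage[of \<int> "\<lambda>x :: nat \<Rightarrow> real. x i"] by (simp add: vimage_def)
  then show ?thesis unfolding E_def
    by (intro closed_Collect_conj closed_Collect_all closed_Collect_imp closed_Collect_eq
       continuous_intros continuous_on_product_coordinates) auto
qed

lemma pr_continuous: "continuous_map (top_of_set E) (G_top k l m) (\<lambda>x. pr x f)"
proof -
  have c: "continuous_map (top_of_set E) euclideanreal (\<lambda>x. x i)" for i
    using continuous_on_subset[OF continuous_on_product_coordinates subset_UNIV] by auto
  have fl: "continuous_map (top_of_set E) euclidean (\<lambda>x. \<lfloor>x (k + m + i)\<rfloor>)" for i
    by (rule continuous_map_floor_of_Ints[OF c]) (auto simp: E_def)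
  show ?thesis unfolding pr_def
  proof (rule continuous_map_into_G_top)
    show "continuous_map (top_of_set E) euclideanreal (\<lambda>x. if i < k then x i else 0)" for i
      using c by (cases "i < k") auto
    show "continuous_map (top_of_set E) euclidean (\<lambda>x. if i < l then \<lfloor>x (k + m + i)\<rfloor> else 0)" for i
      using fl[of i] by (cases "i < l") auto
    show "continuous_map (top_of_set E) euclidean (\<lambda>x. if i < m then cis (2 * pi * x (k + i)) else 1)" for i
      by (cases "i < m") (auto intro!: continuous_intros continuous_on_subset[OF continuous_on_product_coordinates subset_UNIV])
    show "continuous_map (top_of_set E) (discrete_topology UNIV) (\<lambda>x. f)" by simp
    show "\<And>t. t \<in> topspace (top_of_set E) \<Longrightarrow>
         (\<lambda>i. if i < k then t i else 0, \<lambda>i. if i < l then \<lfloor>t (k + m + i)\<rfloor> else 0,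
          \<lambda>i. if i < m then cis (2 * pi * t (k + i)) else 1, f) \<in> G_carrier k l m"
      using pr_in_carrier unfolding pr_def by simp
  qed
qed

lemma pr_add:
  assumes "x \<in> E" "y \<in> E"
  shows "G_add (pr x f) (pr y g) = pr (\<lambda>i. x i + y i) (f + g)"
proof -
  have "\<lfloor>x i\<rfloor> + \<lfloor>y i\<rfloor> = \<lfloor>x i + y i\<rfloor>" if "i \<ge> k + m" for i
  proof -
    have "x i \<in> \<int>" using assms that unfolding E_def by auto
    then show ?thesis by (metis Ints_cases floor_add_int floor_of_int add.commute)
  qed
  then show ?thesis unfolding pr_def G_add_simp by (auto simp: cis_mult algebra_simps fun_eq_iff)
qed

lemma pr_zero: "pr (\<lambda>_. 0) 0 = G_zero"
  unfolding pr_def G_zero_def by auto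

lemma pr_neg:
  assumes "x \<in> E"
  shows "G_neg (pr x f) = pr (\<lambda>i. - x i) (- f)"
proof -
  have "- \<lfloor>x i\<rfloor> = \<lfloor>- x i\<rfloor>" if "i \<ge> k + m" for i
  proof -
    have "x i \<in> \<int>" using assms that unfolding E_def by auto
    then show ?thesis by (metis Ints_cases floor_of_int of_int_minus)
  qed
  then show ?thesis unfolding pr_def G_neg_def by (auto simp: fun_eq_iff)
qed

text \<open>The kernel consists of the integral vectors supported on the torus coordinates; all
  other coordinates can be read off from the image.\<close>

lemma pr_eq_iff:
  assumes "x \<in> E" "y \<in> E"
  shows "pr x f = pr y g \<longleftrightarrow> f = g \<and> (\<forall>i. if k \<le> i \<and> i < k + m then x i - y i \<in> \<int> else x i = y i)"
    (is "?L \<longleftrightarrow> ?R")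
proof
  assume L: ?L
  have "if k \<le> i \<and> i < k + m then x i - y i \<in> \<int> else x i = y i" for i
  proof -
    consider "i < k" | "k \<le> i" "i < k + m" | "k + m \<le> i" "i < n" | "n \<le> i" by linarith
    then show ?thesis
    proof cases
      case 1
      have "fst (pr x f) i = fst (pr y g) i" using L by simp
      then show ?thesis using 1 by (simp add: pr_sel)
    next
      case 2
      have "fst (snd (snd (pr x f))) (i - k) = fst (snd (snd (pr y g))) (i - k)" using L by simp
      then have "cis (2 * pi * x i) = cis (2 * pi * y i)" using 2 by (simp add: pr_sel split: if_splits)
      then show ?thesis using 2 by (simp add: cis_2pi_eq_iff)
    next
      case 3
      have "fst (snd (pr x f)) (i - (k + m)) = fst (snd (pr y g)) (i - (k + m))" using L by simp
      then have "\<lfloor>x i\<rfloor> = \<lfloor>y i\<rfloor>" using 3 by (simp add: pr_sel split: if_splits)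
      moreover have "x i \<in> \<int>" "y i \<in> \<int>" using assms 3 unfolding E_def by auto
      ultimately have "x i = y i" by (metis Ints_cases floor_of_int)
      then show ?thesis using 3 by simp
    next
      case 4
      then show ?thesis using assms unfolding E_def by auto
    qed
  qed
  moreover have "f = g" using L unfolding pr_def by simp
  ultimately show ?R by blast
next
  assume R: ?R
  have "x i = y i" if "i < k \<or> k + m \<le> i" for i using R[THEN conjunct2, rule_format, of i] that by (auto split: if_splits)
  moreover have "cis (2 * pi * x (k + i)) = cis (2 * pi * y (k + i))" if "i < m" for i
    using R[THEN conjunct2, rule_format, of "k + i"] that by (simp add: cis_2pi_eq_iff)
  ultimately show ?L using R unfolding pr_def by auto
qed

lemma pr_lift:
  assumes "g \<in> G_carrier k l m"
  obtains x where "x \<in> E" "pr x (snd (snd (snd g))) = g" "\<And>i. k \<le> i \<Longrightarrow> i < k + m \<Longrightarrow> 0 \<le> x i \<and> x i \<le> 1"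
proof -
  obtain a b c f where g: "g = (a, b, c, f)" by (cases g)
  have "\<exists>t. 0 \<le> t \<and> t \<le> 1 \<and> cis (2 * pi * t) = c i" if "i < m" for i
  proof -
    have "cmod (c i) = 1" using assms that unfolding g G_carrier_def by auto
    then obtain s where s: "0 \<le> s" "s < 2 * pi" "c i = Complex (cos s) (sin s)"
      using complex_unimodular_polar by metis
    then show ?thesis by (intro exI[of _ "s / (2 * pi)"]) (auto simp: cis.ctr divide_le_eq)
  qed
  then obtain t where t: "\<And>i. i < m \<Longrightarrow> 0 \<le> t i \<and> t i \<le> 1 \<and> cis (2 * pi * t i) = c i" by metis
  define x where "x i = (if i < k then a i else if i < k + m then t (i - k) else real_of_int (b (i - (k + m))))" for i
  show thesis
  proof
    show "x \<in> E" unfolding E_def x_def using assms unfolding g G_carrier_def by auto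
    show "pr x (snd (snd (snd g))) = g"
      unfolding pr_def x_def g using assms t unfolding g G_carrier_def by (auto simp: fun_eq_iff)
    show "0 \<le> x i \<and> x i \<le> 1" if "k \<le> i" "i < k + m" for i using that t[of "i - k"] unfolding x_def by auto
  qed
qed

text \<open>Real and integral coordinates of a compact set are bounded, and torus coordinates can be
  lifted into [0, 1]. The summand 1 in \<open>R\<close> accounts for the latter.\<close>

lemma compact_lift:
  assumes "compactin (G_top k l m) K"
  obtains R where "R \<ge> 0" "\<And>g. g \<in> K \<Longrightarrow> \<exists>x\<in>E. pr x (snd (snd (snd g))) = g \<and> (\<forall>i. \<bar>x i\<bar> \<le> R)"
proof -
  have a: "\<exists>B. \<forall>g\<in>K. \<bar>fst g i\<bar> \<le> B" for i
  proof -
    have "compactin euclideanreal ((\<lambda>g. fst g i) ` K)" by (rule image_compactin[OF assms continuous_map_G_coords(1)])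
    then have "bounded ((\<lambda>g. fst g i) ` K)" by (simp add: compact_imp_bounded)
    then show ?thesis unfolding bounded_iff by auto
  qed
  have b: "\<exists>B. \<forall>g\<in>K. \<bar>real_of_int (fst (snd g) i)\<bar> \<le> B" for i
  proof -
    have "compactin euclidean ((\<lambda>g. fst (snd g) i) ` K)" by (rule image_compactin[OF assms continuous_map_G_coords(2)])
    then have "compact ((\<lambda>g. fst (snd g) i) ` K)" by simp
    then have "compact (real_of_int ` ((\<lambda>g. fst (snd g) i) ` K))"
      by (rule compact_continuous_image[OF continuous_on_of_int[OF continuous_on_id]])
    then have "bounded (real_of_int ` ((\<lambda>g. fst (snd g) i) ` K))" by (rule compact_imp_bounded)
    then show ?thesis unfolding bounded_iff by auto
  qed
  obtain A B where A: "\<And>i g. g \<in> K \<Longrightarrow> \<bar>fst g i\<bar> \<le> A i" and B: "\<And>i g. g \<in> K \<Longrightarrow> \<bar>real_of_int (fst (snd g) i)\<bar> \<le> B i"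
    using a b by metis
  define R where "R = 1 + (\<Sum>i<k. \<bar>A i\<bar>) + (\<Sum>i<l. \<bar>B i\<bar>)"
  have nn: "0 \<le> (\<Sum>i<k. \<bar>A i\<bar>)" "0 \<le> (\<Sum>i<l. \<bar>B i\<bar>)" by (auto intro: sum_nonneg)
  have "\<exists>x\<in>E. pr x (snd (snd (snd g))) = g \<and> (\<forall>i. \<bar>x i\<bar> \<le> R)" if g: "g \<in> K" for g
  proof -
    have "g \<in> G_carrier k l m" using g compactin_subset_topspace[OF assms] by auto
    then obtain x where x: "x \<in> E" "pr x (snd (snd (snd g))) = g" "\<And>i. k \<le> i \<Longrightarrow> i < k + m \<Longrightarrow> 0 \<le> x i \<and> x i \<le> 1"
      using pr_lift by metis
    have "\<bar>x i\<bar> \<le> R" for i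
    proof -
      consider "i < k" | "k \<le> i" "i < k + m" | "k + m \<le> i" "i < n" | "n \<le> i" by linarith
      then show ?thesis
      proof cases
        case 1
        have "fst g = (\<lambda>i. if i < k then x i else 0)" using pr_sel(1)[of x "snd (snd (snd g))"] unfolding x(2) .
        then have "\<bar>x i\<bar> \<le> A i" using A[OF g, of i] 1 by simp
        also have "\<dots> \<le> \<bar>A i\<bar>" by simp
        also have "\<dots> \<le> (\<Sum>i<k. \<bar>A i\<bar>)" using 1 by (intro member_le_sum) auto
        finally show ?thesis unfolding R_def using nn by linarith
      next
        case 2 then show ?thesis using x(3)[of i] nn unfolding R_def by linarith
      next
        case 3
        have "fst (snd g) = (\<lambda>i. if i < l then \<lfloor>x (k + m + i)\<rfloor> else 0)" using pr_sel(2)[of x "snd (snd (snd g))"] unfolding x(2) .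
        then have "fst (snd g) (i - (k + m)) = \<lfloor>x i\<rfloor>" using 3 by auto
        moreover have "x i \<in> \<int>" using x(1) 3 unfolding E_def by auto
        ultimately have "\<bar>x i\<bar> \<le> B (i - (k + m))" using B[OF g, of "i - (k + m)"] by (metis Ints_cases floor_of_int)
        also have "\<dots> \<le> \<bar>B (i - (k + m))\<bar>" by simp
        also have "\<dots> \<le> (\<Sum>i<l. \<bar>B i\<bar>)" using 3 by (intro member_le_sum[of _ _ "\<lambda>i. \<bar>B i\<bar>"]) auto
        finally show ?thesis unfolding R_def using nn by linarith
      next
        case 4 then show ?thesis using x(1) nn unfolding E_def R_def by auto
      qed
    qed
    then show ?thesis using x by blast
  qed
  then show thesis using that[of R] nn unfolding R_def by auto
qed

end

section \<open>Subgroups of vectors and linear forms\<close>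

definition add_subgroup :: "((nat \<Rightarrow> real) \<times> 'f::ab_group_add) set \<Rightarrow> bool" where
  "add_subgroup S \<longleftrightarrow> ((\<lambda>_. 0), 0) \<in> S \<and>
     (\<forall>z f w g. (z, f) \<in> S \<longrightarrow> (w, g) \<in> S \<longrightarrow> ((\<lambda>i. z i + w i), f + g) \<in> S) \<and>
     (\<forall>z f. (z, f) \<in> S \<longrightarrow> ((\<lambda>i. - z i), - f) \<in> S)"

lemma add_subgroupD:
  assumes "add_subgroup S"
  shows "((\<lambda>_. 0), 0) \<in> S"
    "(z, f) \<in> S \<Longrightarrow> (w, g) \<in> S \<Longrightarrow> ((\<lambda>i. z i + w i), f + g) \<in> S"
    "(z, f) \<in> S \<Longrightarrow> ((\<lambda>i. - z i), - f) \<in> S"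
  using assms unfolding add_subgroup_def by blast+

lemma add_subgroup_diff:
  assumes "add_subgroup S" "(z, f) \<in> S" "(w, g) \<in> S"
  shows "((\<lambda>i. z i - w i), f - g) \<in> S"
  using add_subgroupD(2)[OF assms(1,2) add_subgroupD(3)[OF assms(1,3)]] by simp

text \<open>\<open>((+) f ^^ r) 0\<close> denotes the r-fold sum of \<open>f\<close>.\<close>

lemma add_subgroup_nat:
  assumes "add_subgroup S" "(x, f) \<in> S"
  shows "((\<lambda>i. real r * x i), ((+) f ^^ r) 0) \<in> S"
proof (induction r)
  case 0 then show ?case using add_subgroupD(1)[OF assms(1)] by simp
next
  case (Suc r)
  from add_subgroupD(2)[OF assms(1,2) Suc] show ?case by (simp add: algebra_simps)
qed

lemma add_subgroup_int:
  assumes "add_subgroup S" "(x, 0) \<in> S"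
  shows "((\<lambda>i. of_int s * x i), 0) \<in> S"
proof -
  have z: "((+) 0 ^^ r) 0 = (0::'a)" for r by (induction r) auto
  have nat: "((\<lambda>i. real r * x i), 0) \<in> S" for r using add_subgroup_nat[OF assms, of r] unfolding z .
  show ?thesis
  proof (cases "s \<ge> 0")
    case True then show ?thesis using nat[of "nat s"] by simp
  next
    case False
    then show ?thesis using add_subgroupD(3)[OF assms(1) nat[of "nat (-s)"]] by simp
  qed
qed

lemma add_subgroup_sum:
  assumes "add_subgroup S" "\<And>t. t \<in> T \<Longrightarrow> (v t, 0) \<in> S" "finite T"
  shows "((\<lambda>i. \<Sum>t\<in>T. v t i), 0) \<in> S"
  using assms(3,2)
proof (induction T)
  case empty then show ?case using add_subgroupD(1)[OF assms(1)] by simp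
next
  case (insert t T)
  from add_subgroupD(2)[OF assms(1), of "v t" 0 "\<lambda>i. \<Sum>t\<in>T. v t i" 0] insert show ?case by simp
qed

text \<open>By the pigeonhole principle two multiples of \<open>f\<close> agree, and the difference
  of the corresponding multiples of \<open>(x, f)\<close> has trivial component in the finite group.
  Up to an integer factor this reduces a subgroup to its elements with component 0.\<close>

lemma add_subgroup_torsion:
  fixes S :: "((nat \<Rightarrow> real) \<times> 'f::{finite,ab_group_add}) set"
  assumes "add_subgroup S" "(x, f) \<in> S"
  shows "\<exists>d>0. ((\<lambda>i. real d * x i), 0) \<in> S"
proof -
  have "\<not> inj (\<lambda>r::nat. ((+) f ^^ r) 0)"
  proof
    assume "inj (\<lambda>r::nat. ((+) f ^^ r) 0)"
    then have "finite (UNIV :: nat set)" using finite_imageD[of "\<lambda>r::nat. ((+) f ^^ r) 0" UNIV] by simp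
    then show False by simp
  qed
  then obtain r s :: nat where rs: "r < s" "((+) f ^^ r) 0 = ((+) f ^^ s) 0"
    unfolding inj_def by (metis linorder_neqE_nat)
  from add_subgroup_diff[OF assms(1) add_subgroup_nat[OF assms, of s] add_subgroup_nat[OF assms, of r]] rs
  have "((\<lambda>i. real (s - r) * x i), 0) \<in> S" by (simp add: of_nat_diff left_diff_distrib)
  then show ?thesis using rs(1) by (intro exI[of _ "s - r"]) auto
qed

definition unit_vec :: "nat \<Rightarrow> nat \<Rightarrow> real" where
  "unit_vec j = (\<lambda>i. if i = j then 1 else 0)"

lemma sum_unit_vec: "finite A \<Longrightarrow> (\<Sum>i\<in>A. a i * unit_vec j i) = (if j \<in> A then a j else 0)"
  unfolding unit_vec_def by (simp add: if_distrib cong: if_cong)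

lemma sum_unit_vec': "finite A \<Longrightarrow> (\<Sum>j\<in>A. a j * unit_vec j i) = (if i \<in> A then a i else 0)"
  unfolding unit_vec_def by (simp add: if_distrib cong: if_cong)

lemma add_subgroup_unit_vecs:
  assumes "add_subgroup S" "finite T" "\<And>t. t \<in> T \<Longrightarrow> (unit_vec t, 0) \<in> S" "\<And>i. s i \<in> \<int>" "\<And>i. i \<notin> T \<Longrightarrow> s i = 0"
  shows "(s, 0) \<in> S"
proof -
  have "((\<lambda>i. \<Sum>t\<in>T. s t * unit_vec t i), 0) \<in> S"
  proof (rule add_subgroup_sum[OF assms(1) _ assms(2)])
    fix t assume "t \<in> T"
    moreover obtain z where "s t = of_int z" using assms(4) Ints_cases by blast
    ultimately show "((\<lambda>i. s t * unit_vec t i), 0) \<in> S" using add_subgroup_int[OF assms(1) assms(3)] by simp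
  qed
  moreover have "(\<lambda>i. \<Sum>t\<in>T. s t * unit_vec t i) = s" using assms(5) by (auto simp: sum_unit_vec'[OF assms(2)])
  ultimately show ?thesis by simp
qed

text \<open>A discrete subgroup of \<real>^b times the finite group that contains \<int>^b. It
  stores the discrete data of a closed subgroup: the coordinates, relative to independent vectors of
  its lattice part, of all lattice elements, together with their components in the finite group.
  Such coordinates need not be integral.\<close>

definition disc_group :: "nat \<Rightarrow> ((nat \<Rightarrow> real) \<times> 'f::{finite,ab_group_add}) set \<Rightarrow> bool" where
  "disc_group b \<Gamma> \<longleftrightarrow> add_subgroup \<Gamma> \<and> (\<forall>z f. (z, f) \<in> \<Gamma> \<longrightarrow> (\<forall>j\<ge>b. z j = 0)) \<and>
     (\<forall>j<b. (unit_vec j, 0) \<in> \<Gamma>) \<and> (\<forall>R. finite {(z, f) \<in> \<Gamma>. \<forall>j. \<bar>z j\<bar> \<le> R})"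

lemma disc_groupD:
  assumes "disc_group b \<Gamma>"
  shows "add_subgroup \<Gamma>"
    "(z, f) \<in> \<Gamma> \<Longrightarrow> j \<ge> b \<Longrightarrow> z j = 0"
    "j < b \<Longrightarrow> (unit_vec j, 0) \<in> \<Gamma>"
    "finite {(z, f) \<in> \<Gamma>. \<forall>j. \<bar>z j\<bar> \<le> R}"
  using assms unfolding disc_group_def by blast+

lemma disc_group_gap:
  assumes "disc_group b \<Gamma>"
  obtains \<gamma> where "\<gamma> > 0" "\<And>z. (z, 0) \<in> \<Gamma> \<Longrightarrow> (\<Sum>j<b. \<bar>z j\<bar>) < \<gamma> \<Longrightarrow> \<forall>j<b. z j = 0"
proof -
  define S where "S = (\<lambda>(z, f). \<Sum>j<b. \<bar>z j\<bar>) ` {(z, f) \<in> \<Gamma>. \<forall>j. \<bar>z j\<bar> \<le> 1} - {0}"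
  have fin: "finite S" unfolding S_def using disc_groupD(4)[OF assms, of 1] by simp
  \<comment> \<open>The 1 restricts attention to vectors with all entries at most 1, of which there
    are finitely many, and provides a value if \<open>S\<close> is empty.\<close>
  define \<gamma> where "\<gamma> = Min (insert 1 S)"
  have pos: "s > 0" if "s \<in> S" for s using that unfolding S_def by (force intro: sum_nonneg order.not_eq_order_implies_strict)
  show thesis
  proof
    show "\<gamma> > 0" unfolding \<gamma>_def using fin pos by (subst Min_gr_iff) auto
    fix z assume z: "(z, 0) \<in> \<Gamma>" "(\<Sum>j<b. \<bar>z j\<bar>) < \<gamma>"
    have "\<gamma> \<le> 1" unfolding \<gamma>_def using fin by (intro Min_le) auto
    have "\<bar>z j\<bar> \<le> 1" for j
    proof (cases "j < b")
      case True
      then have "\<bar>z j\<bar> \<le> (\<Sum>j<b. \<bar>z j\<bar>)" by (intro member_le_sum[of _ _ "\<lambda>j. \<bar>z j\<bar>"]) auto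
      then show ?thesis using z(2) \<open>\<gamma> \<le> 1\<close> by linarith
    next
      case False then show ?thesis using disc_groupD(2)[OF assms z(1)] by simp
    qed
    then have "(z, 0) \<in> {(z, f) \<in> \<Gamma>. \<forall>j. \<bar>z j\<bar> \<le> 1}" using z(1) by simp
    moreover have "(\<Sum>j<b. \<bar>z j\<bar>) \<notin> S" using z(2) fin unfolding \<gamma>_def by (subst (asm) Min_gr_iff) auto
    ultimately have "(\<Sum>j<b. \<bar>z j\<bar>) = 0" unfolding S_def by force
    then show "\<forall>j<b. z j = 0" by (simp add: sum_nonneg_eq_0_iff)
  qed
qed

text \<open>Reducing the multiples of an element modulo \<int>^b keeps them in a bounded part of
  \<Gamma>, which is finite. Two of the reduced multiples agree, so a positive multiple of
  \<open>z\<close> is integral.\<close>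

lemma disc_group_rational:
  assumes \<Gamma>: "disc_group b \<Gamma>" and z: "(z, f) \<in> \<Gamma>"
  shows "z j \<in> \<rat>"
proof -
  define w where "w r = (\<lambda>i. frac (real r * z i))" for r
  define g where "g r = ((+) f ^^ r) 0" for r :: nat
  have w: "(w r, g r) \<in> \<Gamma>" for r
  proof -
    have "((\<lambda>i. of_int \<lfloor>real r * z i\<rfloor>), 0) \<in> \<Gamma>"
      by (rule add_subgroup_unit_vecs[OF disc_groupD(1)[OF \<Gamma>], of "{..<b}"])
         (use disc_groupD(3)[OF \<Gamma>] disc_groupD(2)[OF \<Gamma> z] in auto)
    from add_subgroup_diff[OF disc_groupD(1)[OF \<Gamma>] add_subgroup_nat[OF disc_groupD(1)[OF \<Gamma>] z, of r] this]
    show ?thesis unfolding w_def g_def frac_def by simp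
  qed
  have "(\<lambda>r. (w r, g r)) ` UNIV \<subseteq> {(z, f) \<in> \<Gamma>. \<forall>j. \<bar>z j\<bar> \<le> 1}"
    using w unfolding w_def by (auto simp: less_imp_le frac_lt_1)
  then have "finite ((\<lambda>r. (w r, g r)) ` UNIV)" using disc_groupD(4)[OF \<Gamma>] finite_subset by blast
  then have "\<not> inj (\<lambda>r. (w r, g r))" using finite_imageD by fastforce
  then obtain r s where rs: "r < s" "w r = w s" unfolding inj_def by (metis linorder_neqE_nat prod.inject)
  have "frac (real r * z j) = frac (real s * z j)" using rs(2) unfolding w_def by (rule fun_cong)
  then have "real s * z j - real r * z j = of_int (\<lfloor>real s * z j\<rfloor> - \<lfloor>real r * z j\<rfloor>)" unfolding frac_def by simp
  then have "(real s - real r) * z j = of_int (\<lfloor>real s * z j\<rfloor> - \<lfloor>real r * z j\<rfloor>)" by (simp only: left_diff_distrib)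
  moreover have "real s - real r \<noteq> 0" using rs(1) by simp
  ultimately have "z j = of_int (\<lfloor>real s * z j\<rfloor> - \<lfloor>real r * z j\<rfloor>) / (real s - real r)" by (simp add: field_simps)
  also have "\<dots> \<in> \<rat>" by (intro Rats_divide Rats_diff Rats_of_int Rats_of_nat)
  finally show ?thesis .
qed

lemma countable_finite_support:
  fixes C :: "real set"
  assumes "countable C"
  shows "countable {z :: nat \<Rightarrow> real. (\<forall>j<b. z j \<in> C) \<and> (\<forall>j\<ge>b. z j = 0)}" (is "countable ?Z")
proof -
  have "countable ({..<b} \<rightarrow>\<^sub>E C)" using assms by (intro countable_PiE) auto
  moreover have "(\<lambda>z. restrict z {..<b}) ` ?Z \<subseteq> ({..<b} \<rightarrow>\<^sub>E C)" by (auto split: if_splits)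
  ultimately have "countable ((\<lambda>z. restrict z {..<b}) ` ?Z)" using countable_subset by blast
  moreover have "inj_on (\<lambda>z. restrict z {..<b}) ?Z"
  proof (rule inj_onI, rule ext)
    fix x y j assume xy: "x \<in> ?Z" "y \<in> ?Z" "restrict x {..<b} = restrict y {..<b}"
    show "x j = y j"
    proof (cases "j < b")
      case True then show ?thesis using fun_cong[OF xy(3), of j] by simp
    next
      case False then show ?thesis using xy by auto
    qed
  qed
  ultimately show ?thesis using countable_image_inj_on by blast
qed

text \<open>Modulo \<int>^b the group is determined by its elements with entries in [0, 1]. These
  are finitely many and rational, so there are countably many possibilities for their set
  \<open>D\<close>; the function \<open>S\<close> rebuilds the group from \<open>D\<close>.\<close>

lemma countable_disc_groups:
  "countable {\<Gamma> :: ((nat \<Rightarrow> real) \<times> 'f::{finite,ab_group_add}) set. disc_group b \<Gamma>}"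
proof -
  define Q :: "((nat \<Rightarrow> real) \<times> 'f) set" where "Q = {z. (\<forall>j<b. z j \<in> \<rat>) \<and> (\<forall>j\<ge>b. z j = 0)} \<times> UNIV"
  have "countable Q" unfolding Q_def
    by (intro countable_SIGMA countable_finite_support countable_rat) (auto simp: countable_finite)
  then have "countable {D. finite D \<and> D \<subseteq> Q}" by (rule countable_Collect_finite_subset)
  define S :: "((nat \<Rightarrow> real) \<times> 'f) set \<Rightarrow> ((nat \<Rightarrow> real) \<times> 'f) set"
    where "S D = {(z, f). \<exists>w. (w, f) \<in> D \<and> (\<forall>j. z j - w j \<in> \<int>) \<and> (\<forall>j\<ge>b. z j = 0)}" for D
  have "{\<Gamma>. disc_group b \<Gamma>} \<subseteq> S ` {D. finite D \<and> D \<subseteq> Q}"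
  proof
    fix \<Gamma> :: "((nat \<Rightarrow> real) \<times> 'f) set" assume "\<Gamma> \<in> {\<Gamma>. disc_group b \<Gamma>}"
    then have \<Gamma>: "disc_group b \<Gamma>" by simp
    note G = disc_groupD(1)[OF \<Gamma>]
    have int: "(s, 0) \<in> \<Gamma>" if "\<And>i. s i \<in> \<int>" "\<And>i. i \<ge> b \<Longrightarrow> s i = 0" for s
      by (rule add_subgroup_unit_vecs[OF G, of "{..<b}"]) (use that disc_groupD(3)[OF \<Gamma>] in auto)
    define D where "D = {(z, f) \<in> \<Gamma>. \<forall>j. 0 \<le> z j \<and> z j \<le> 1}"
    have "D \<subseteq> Q" unfolding D_def Q_def using disc_group_rational[OF \<Gamma>] disc_groupD(2)[OF \<Gamma>] by auto
    moreover have "finite D" by (rule finite_subset[OF _ disc_groupD(4)[OF \<Gamma>, of 1]]) (auto simp: D_def)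
    moreover have "\<Gamma> = S D"
    proof (intro set_eqI iffI)
      fix q assume q: "q \<in> \<Gamma>"
      obtain z f where zf: "q = (z, f)" by (cases q)
      have "z i = 0" if "i \<ge> b" for i using disc_groupD(2)[OF \<Gamma> q[unfolded zf]] that by blast
      then have "((\<lambda>i. of_int \<lfloor>z i\<rfloor>), 0) \<in> \<Gamma>" by (intro int) auto
      from add_subgroup_diff[OF G q[unfolded zf] this]
      have "((\<lambda>i. z i - of_int \<lfloor>z i\<rfloor>), f) \<in> D" unfolding D_def by (auto simp: frac_def[symmetric] less_imp_le frac_lt_1)
      then show "q \<in> S D" unfolding S_def zf using disc_groupD(2)[OF \<Gamma> q[unfolded zf]] by force
    next
      fix q assume "q \<in> S D"
      then obtain z f w where q: "q = (z, f)" "(w, f) \<in> \<Gamma>" "\<forall>j. z j - w j \<in> \<int>" "\<forall>j\<ge>b. z j = 0" unfolding S_def D_def by auto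
      have "((\<lambda>i. z i - w i), 0) \<in> \<Gamma>" by (rule int) (use q disc_groupD(2)[OF \<Gamma> q(2)] in auto)
      from add_subgroupD(2)[OF G this q(2)] show "q \<in> \<Gamma>" unfolding q by simp
    qed
    ultimately show "\<Gamma> \<in> S ` {D. finite D \<and> D \<subseteq> Q}" by blast
  qed
  then show ?thesis using \<open>countable {D. finite D \<and> D \<subseteq> Q}\<close> by (meson countable_image countable_subset)
qed

lemma disc_group_countable:
  assumes "disc_group b \<Gamma>"
  shows "countable \<Gamma>"
proof -
  have "\<Gamma> \<subseteq> {z. (\<forall>j<b. z j \<in> \<rat>) \<and> (\<forall>j\<ge>b. z j = 0)} \<times> UNIV"
    using disc_group_rational[OF assms] disc_groupD(2)[OF assms] by auto
  moreover have "countable ({z::nat\<Rightarrow>real. (\<forall>j<b. z j \<in> \<rat>) \<and> (\<forall>j\<ge>b. z j = 0)} \<times> (UNIV :: 'a set))"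
    by (intro countable_SIGMA countable_finite_support countable_rat) (auto simp: countable_finite)
  ultimately show ?thesis using countable_subset by blast
qed

text \<open>By Gaussian elimination; \<open>T\<close> is the set of pivots.\<close>

lemma independent_forms_pivots:
  fixes w :: "nat \<Rightarrow> 'i \<Rightarrow> real"
  assumes "finite S" "\<And>c. \<forall>s\<in>S. (\<Sum>j<t. c j * w j s) = 0 \<Longrightarrow> \<forall>j<t. c j = 0"
  shows "\<exists>T\<subseteq>S. card T = t \<and> (\<forall>u. (\<forall>j<t. (\<Sum>s\<in>T. u s * w j s) = 0) \<longrightarrow> (\<forall>s\<in>T. u s = 0))"
  using assms
proof (induction t arbitrary: S w)
  case 0 then show ?case by (intro exI[of _ "{}"]) auto
next
  case (Suc t)
  have "\<exists>s\<in>S. w t s \<noteq> 0"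
  proof (rule ccontr)
    assume "\<not> (\<exists>s\<in>S. w t s \<noteq> 0)"
    then have "\<forall>s\<in>S. (\<Sum>j<Suc t. (if j = t then 1 else 0) * w j s) = 0" by simp
    from Suc.prems(2)[OF this] show False by auto
  qed
  then obtain p where p: "p \<in> S" "w t p \<noteq> 0" by blast
  define w' where "w' j s = w j s - w j p / w t p * w t s" for j s
  have w'p: "w' j p = 0" for j unfolding w'_def using p by simp
  have "\<forall>j<t. c j = 0" if c: "\<forall>s\<in>S - {p}. (\<Sum>j<t. c j * w' j s) = 0" for c
  proof -
    \<comment> \<open>The coefficient of the eliminated vector \<open>w t\<close> is chosen such
      that the combination of the \<open>w j\<close> with coefficients \<open>c'\<close> equals that
      of the \<open>w' j\<close> with coefficients \<open>c\<close>.\<close>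
    define c' where "c' j = (if j = t then - (\<Sum>j<t. c j * w j p / w t p) else c j)" for j
    have "(\<Sum>j<Suc t. c' j * w j s) = 0" if "s \<in> S" for s
    proof -
      have "(\<Sum>j<Suc t. c' j * w j s) = (\<Sum>j<t. c j * w j s) - (\<Sum>j<t. c j * w j p / w t p) * w t s"
        unfolding c'_def by simp
      also have "\<dots> = (\<Sum>j<t. c j * w' j s)"
        unfolding w'_def by (simp add: sum_distrib_right sum_distrib_left sum_subtractf algebra_simps)
      also have "\<dots> = 0" using c that w'p by (cases "s = p") auto
      finally show ?thesis .
    qed
    then have "\<forall>j<Suc t. c' j = 0" using Suc.prems(2)[of c'] by blast
    then show ?thesis unfolding c'_def by (metis less_SucI nat_less_le)
  qed
  then obtain T where T: "T \<subseteq> S - {p}" "card T = t" "\<And>u. (\<forall>j<t. (\<Sum>s\<in>T. u s * w' j s) = 0) \<Longrightarrow> (\<forall>s\<in>T. u s = 0)"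
    using Suc.IH[of "S - {p}" w'] Suc.prems(1) by auto
  have fT: "finite T" "p \<notin> T" using T(1) Suc.prems(1) finite_subset by blast+
  show ?case
  proof (intro exI[of _ "insert p T"] conjI allI impI)
    show "insert p T \<subseteq> S" using T(1) p by blast
    show "card (insert p T) = Suc t" using fT T(2) by simp
    fix u assume u: "\<forall>j<Suc t. (\<Sum>s\<in>insert p T. u s * w j s) = 0"
    have "(\<Sum>s\<in>T. u s * w' j s) = 0" if "j < t" for j
    proof -
      have "(\<Sum>s\<in>T. u s * w' j s) = (\<Sum>s\<in>insert p T. u s * w' j s)" using fT w'p by simp
      also have "\<dots> = (\<Sum>s\<in>insert p T. u s * w j s) - w j p / w t p * (\<Sum>s\<in>insert p T. u s * w t s)"
        unfolding w'_def sum_distrib_left sum_subtractf[symmetric] by (intro sum.cong) (auto simp: algebra_simps)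
      also have "\<dots> = 0" using u that by simp
      finally show ?thesis .
    qed
    then have uT: "\<forall>s\<in>T. u s = 0" using T(3) by blast
    moreover have "u p * w t p + (\<Sum>s\<in>T. u s * w t s) = 0" using u fT by simp
    moreover have "(\<Sum>s\<in>T. u s * w t s) = 0" using uT by (intro sum.neutral) auto
    ultimately show "\<forall>s\<in>insert p T. u s = 0" using p by simp
  qed
qed

lemma independent_forms_card:
  fixes w :: "nat \<Rightarrow> 'i \<Rightarrow> real"
  assumes "finite S" "\<And>c. \<forall>s\<in>S. (\<Sum>j<t. c j * w j s) = 0 \<Longrightarrow> \<forall>j<t. c j = 0"
  shows "t \<le> card S"
  using independent_forms_pivots[OF assms] assms(1) card_mono by metis

text \<open>The sum on the right is a continuous function that vanishes nowhere on the unit sphere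
  of the sum norm, so by compactness it has a positive minimum \<mu> there; homogeneity extends the
  estimate to all \<open>z\<close> with constant \<open>1 / \<mu>\<close>.\<close>

lemma independent_forms_lower_bound:
  fixes w :: "nat \<Rightarrow> 'i \<Rightarrow> real"
  assumes fin: "finite S" and ind: "\<And>c. \<forall>s\<in>S. (\<Sum>j<b. c j * w j s) = 0 \<Longrightarrow> \<forall>j<b. c j = 0"
  obtains C where "C \<ge> 0" "\<And>z. (\<Sum>j<b. \<bar>z j\<bar>) \<le> C * (\<Sum>s\<in>S. \<bar>\<Sum>j<b. z j * w j s\<bar>)"
proof -
  define K where "K = {z :: nat \<Rightarrow> real. \<forall>j. (if j < b then -1 else 0) \<le> z j \<and> z j \<le> (if j < b then 1 else 0)} \<inter> {z. (\<Sum>j<b. \<bar>z j\<bar>) = 1}"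
  define g where "g z = (\<Sum>s\<in>S. \<bar>\<Sum>j<b. z j * w j s\<bar>)" for z :: "nat \<Rightarrow> real"
  have "closed {z :: nat \<Rightarrow> real. (\<Sum>j<b. \<bar>z j\<bar>) = 1}"
    by (intro closed_Collect_eq continuous_intros continuous_on_product_coordinates)
  then have "compact K" unfolding K_def by (intro compact_Int_closed compact_box_fun)
  have cg: "continuous_on UNIV g" unfolding g_def by (intro continuous_intros continuous_on_product_coordinates)
  have g0: "g z \<ge> 0" for z unfolding g_def by (intro sum_nonneg) auto
  have gpos: "g z > 0" if "z \<in> K" for z
  proof (rule ccontr)
    assume "\<not> g z > 0"
    then have "g z = 0" using g0[of z] by linarith
    then have "\<forall>s\<in>S. (\<Sum>j<b. z j * w j s) = 0" unfolding g_def using fin by (simp add: sum_nonneg_eq_0_iff)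
    then have "\<forall>j<b. z j = 0" by (rule ind)
    then show False using that unfolding K_def by simp
  qed
  obtain \<mu> where \<mu>: "\<mu> > 0" "\<And>z. z \<in> K \<Longrightarrow> \<mu> \<le> g z"
  \<comment> \<open>The sphere is empty exactly for b = 0, and then any constant will do.\<close>
  proof (cases "K = {}")
    case True then show ?thesis using that[of 1] by simp
  next
    case False
    then obtain z0 where "z0 \<in> K" "\<forall>z\<in>K. g z0 \<le> g z"
      using continuous_attains_inf[OF \<open>compact K\<close> _ continuous_on_subset[OF cg subset_UNIV]] by blast
    then show ?thesis using that[of "g z0"] gpos by blast
  qed
  show thesis
  proof
    show "1 / \<mu> \<ge> 0" using \<mu>(1) by simp
    fix z :: "nat \<Rightarrow> real"
    define N where "N = (\<Sum>j<b. \<bar>z j\<bar>)"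
    show "(\<Sum>j<b. \<bar>z j\<bar>) \<le> 1 / \<mu> * (\<Sum>s\<in>S. \<bar>\<Sum>j<b. z j * w j s\<bar>)"
    proof (cases "N = 0")
      case True
      then show ?thesis unfolding N_def using \<mu>(1) by (simp add: sum_nonneg)
    next
      case False
      moreover have "N \<ge> 0" unfolding N_def by (rule sum_nonneg) simp
      ultimately have N: "N > 0" by simp
      define y where "y j = (if j < b then z j / N else 0)" for j
      have zj: "\<bar>z j\<bar> \<le> N" if "j < b" for j
        unfolding N_def using that by (intro member_le_sum[of _ _ "\<lambda>j. \<bar>z j\<bar>"]) auto
      have "(\<Sum>j<b. \<bar>y j\<bar>) = (\<Sum>j<b. \<bar>z j\<bar> / N)" unfolding y_def using N by (intro sum.cong) auto
      also have "\<dots> = 1" unfolding sum_divide_distrib[symmetric] N_def[symmetric] using N by simp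
      finally have "y \<in> K" unfolding K_def y_def using zj N by (auto simp: divide_le_eq le_divide_eq abs_le_iff minus_le_iff)
      then have "\<mu> \<le> g y" by (rule \<mu>(2))
      also have "g y = (\<Sum>s\<in>S. \<bar>\<Sum>j<b. z j * w j s\<bar> / N)"
      proof -
        have "(\<Sum>j<b. y j * w j s) = (\<Sum>j<b. z j * w j s) / N" for s unfolding y_def sum_divide_distrib by (intro sum.cong) auto
        then show ?thesis unfolding g_def using N by (simp add: abs_divide)
      qed
      also have "\<dots> = (\<Sum>s\<in>S. \<bar>\<Sum>j<b. z j * w j s\<bar>) / N" by (simp add: sum_divide_distrib)
      finally show ?thesis using N \<mu>(1) unfolding N_def[symmetric] by (simp add: field_simps)
    qed
  qed
qed

section \<open>Parametrised closed subgroups\<close>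

lemma continuous_on_coord2: "continuous_on UNIV (\<lambda>\<theta> :: nat \<Rightarrow> nat \<Rightarrow> real. \<theta> i j)"
  using continuous_on_product_then_coordinatewise[OF continuous_on_product_coordinates] .

lemma compact_box2:
  fixes a b :: "nat \<Rightarrow> nat \<Rightarrow> real"
  shows "compact {\<theta>. \<forall>i j. a i j \<le> \<theta> i j \<and> \<theta> i j \<le> b i j}"
proof -
  have "compactin (product_topology (\<lambda>i::nat. euclidean) UNIV) (\<Pi>\<^sub>E i\<in>UNIV. {x. \<forall>j. a i j \<le> x j \<and> x j \<le> b i j})"
    unfolding compactin_PiE using compact_box_fun by auto
  moreover have "(\<Pi>\<^sub>E i\<in>UNIV. {x. \<forall>j. a i j \<le> x j \<and> x j \<le> b i j}) = {\<theta>. \<forall>i j. a i j \<le> \<theta> i j \<and> \<theta> i j \<le> b i j}"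
    by (auto simp: PiE_iff)
  ultimately show ?thesis by (simp add: euclidean_product_topology)
qed

context params
begin

text \<open>The coordinates in \<open>P\<close> are chosen freely, those outside follow from them
  and from a lattice point \<open>z\<close>: a vector space in reduced echelon form plus a lattice
  that vanishes on \<open>P\<close>. Shifting the lattice columns by \<open>n\<close> lets one
  matrix hold both blocks.\<close>

definition lat :: "nat set \<Rightarrow> nat \<Rightarrow> ((nat \<Rightarrow> real) \<times> 'f) set \<Rightarrow> (nat \<Rightarrow> nat \<Rightarrow> real) \<Rightarrow> ((nat \<Rightarrow> real) \<times> 'f) set" where
  "lat P b \<Gamma> \<theta> = {(x, f). (\<forall>i\<ge>n. x i = 0) \<and> (\<exists>z. (z, f) \<in> \<Gamma> \<and>
     (\<forall>i\<in>{..<n} - P. x i = (\<Sum>j\<in>P. \<theta> i j * x j) + (\<Sum>j<b. \<theta> i (n + j) * z j)))}"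

text \<open>The admissible matrices \<open>\<theta>\<close>: the columns \<open>j \<in> P\<close> describe the identity component of the subgroup, the
  columns \<open>n + j\<close> with \<open>j < b\<close> a lattice transversal to it, and \<open>zt t\<close> are the coordinates of the \<open>t\<close>-th unit vector.\<close>

definition adm :: "nat set \<Rightarrow> nat \<Rightarrow> ((nat \<Rightarrow> real) \<times> 'f) set \<Rightarrow> (nat \<Rightarrow> nat \<Rightarrow> real) \<Rightarrow> real \<Rightarrow> (nat \<Rightarrow> nat \<Rightarrow> real) set" where
  "adm P b \<Gamma> zt c = {\<theta>.
     (\<forall>i j. \<not> (i < n \<and> i \<notin> P \<and> (j \<in> P \<or> (n \<le> j \<and> j < n + b))) \<longrightarrow> \<theta> i j = 0) \<and>
     (\<forall>z. (\<Sum>j<b. \<bar>z j\<bar>) \<le> c * (\<Sum>i\<in>{..<n} - P. \<bar>\<Sum>j<b. \<theta> i (n + j) * z j\<bar>)) \<and>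
     (\<forall>i j. k + m \<le> i \<longrightarrow> j \<in> P \<longrightarrow> \<theta> i j = 0) \<and>
     (\<forall>i z f. k + m \<le> i \<longrightarrow> (z, f) \<in> \<Gamma> \<longrightarrow> (\<Sum>j<b. \<theta> i (n + j) * z j) \<in> \<int>) \<and>
     (\<forall>t i. k \<le> t \<longrightarrow> t < k + m \<longrightarrow> i \<in> {..<n} - P \<longrightarrow>
        unit_vec t i = (\<Sum>j\<in>P. \<theta> i j * unit_vec t j) + (\<Sum>j<b. \<theta> i (n + j) * zt t j))}"

definition sub_of :: "nat set \<Rightarrow> nat \<Rightarrow> ((nat \<Rightarrow> real) \<times> 'f) set \<Rightarrow> (nat \<Rightarrow> nat \<Rightarrow> real) \<Rightarrow> 'f Gelem set" where
  "sub_of P b \<Gamma> \<theta> = (\<lambda>(x, f). pr x f) ` lat P b \<Gamma> \<theta>"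

text \<open>All conditions are equations, weak inequalities or integrality conditions under
  universal quantifiers. Linear independence of the lattice columns would be an open condition; the
  inequality with the fixed constant \<open>c\<close> is a closed substitute for it.\<close>

lemma closed_adm: "closed (adm P b \<Gamma> zt c)"
proof -
  have int: "closed {\<theta> :: nat \<Rightarrow> nat \<Rightarrow> real. (\<Sum>j<b. \<theta> i (n + j) * z j) \<in> \<int>}" for i z
  proof -
    have "continuous_on UNIV (\<lambda>\<theta> :: nat \<Rightarrow> nat \<Rightarrow> real. (\<Sum>j<b. \<theta> i (n + j) * z j))"
      by (intro continuous_intros continuous_on_coord2)
    from closed_vimage[OF closed_Ints this] show ?thesis by (simp add: vimage_def)
  qed
  show ?thesis unfolding adm_def
    by (intro closed_Collect_conj closed_Collect_all closed_Collect_imp closed_Collect_eq closed_Collect_le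
       open_Collect_const int continuous_intros continuous_on_coord2)
qed

end

text \<open>Everything discrete is fixed here, and only the matrix \<theta> varies. The free
  coordinates lie below \<open>k + m\<close> because no line moves an integral coordinate. The
  \<open>zt t\<close> are fixed lattice coordinates of the kernel generators, which turns
  containment of the kernel into linear equations for \<theta>.\<close>

locale lat_data = params k l m for k l m :: nat +
  fixes P :: "nat set" and b :: nat and \<Gamma> :: "((nat \<Rightarrow> real) \<times> 'f::{finite,ab_group_add}) set"
    and zt :: "nat \<Rightarrow> nat \<Rightarrow> real" and c :: real
  assumes P: "P \<subseteq> {..<k + m}" and \<Gamma>: "disc_group b \<Gamma>"
    and zt: "\<And>t. k \<le> t \<Longrightarrow> t < k + m \<Longrightarrow> (zt t, 0) \<in> \<Gamma>" and c: "c \<ge> 0"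
begin

abbreviation "L \<equiv> lat P b \<Gamma>"
abbreviation "A \<equiv> adm P b \<Gamma> zt c"
abbreviation "Th \<equiv> sub_of P b \<Gamma>"

lemma \<Gamma>': "add_subgroup \<Gamma>" using disc_groupD(1)[OF \<Gamma>] .

lemma finP: "finite P" using P finite_subset by blast

lemma admD:
  assumes "\<theta> \<in> A"
  shows "\<not> (i < n \<and> i \<notin> P \<and> (j \<in> P \<or> (n \<le> j \<and> j < n + b))) \<Longrightarrow> \<theta> i j = 0"
    "(\<Sum>j<b. \<bar>z j\<bar>) \<le> c * (\<Sum>i\<in>{..<n} - P. \<bar>\<Sum>j<b. \<theta> i (n + j) * z j\<bar>)"
    "k + m \<le> i \<Longrightarrow> j \<in> P \<Longrightarrow> \<theta> i j = 0"
    "k + m \<le> i \<Longrightarrow> (z, f) \<in> \<Gamma> \<Longrightarrow> (\<Sum>j<b. \<theta> i (n + j) * z j) \<in> \<int>"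
    "k \<le> t \<Longrightarrow> t < k + m \<Longrightarrow> i \<in> {..<n} - P \<Longrightarrow>
        unit_vec t i = (\<Sum>j\<in>P. \<theta> i j * unit_vec t j) + (\<Sum>j<b. \<theta> i (n + j) * zt t j)"
  using assms unfolding adm_def by blast+

lemma latI:
  assumes "\<And>i. i \<ge> n \<Longrightarrow> x i = 0" "(z, f) \<in> \<Gamma>"
    "\<And>i. i < n \<Longrightarrow> i \<notin> P \<Longrightarrow> x i = (\<Sum>j\<in>P. \<theta> i j * x j) + (\<Sum>j<b. \<theta> i (n + j) * z j)"
  shows "(x, f) \<in> L \<theta>"
  using assms unfolding lat_def by blast

lemma latE:
  assumes "(x, f) \<in> L \<theta>"
  obtains z where "(z, f) \<in> \<Gamma>"
    "\<And>i. i < n \<Longrightarrow> i \<notin> P \<Longrightarrow> x i = (\<Sum>j\<in>P. \<theta> i j * x j) + (\<Sum>j<b. \<theta> i (n + j) * z j)"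
  using assms unfolding lat_def by blast

lemma lat_outside: "(x, f) \<in> L \<theta> \<Longrightarrow> i \<ge> n \<Longrightarrow> x i = 0"
  unfolding lat_def by blast

lemma lat_zero: "((\<lambda>_. 0), 0) \<in> L \<theta>"
  by (rule latI[OF _ add_subgroupD(1)[OF \<Gamma>']]) auto

lemma lat_add:
  assumes "(x, f) \<in> L \<theta>" "(y, g) \<in> L \<theta>"
  shows "((\<lambda>i. x i + y i), f + g) \<in> L \<theta>"
proof -
  obtain z where z: "(z, f) \<in> \<Gamma>" "\<And>i. i < n \<Longrightarrow> i \<notin> P \<Longrightarrow> x i = (\<Sum>j\<in>P. \<theta> i j * x j) + (\<Sum>j<b. \<theta> i (n + j) * z j)"
    using latE[OF assms(1)] by blast
  obtain w where w: "(w, g) \<in> \<Gamma>" "\<And>i. i < n \<Longrightarrow> i \<notin> P \<Longrightarrow> y i = (\<Sum>j\<in>P. \<theta> i j * y j) + (\<Sum>j<b. \<theta> i (n + j) * w j)"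
    using latE[OF assms(2)] by blast
  show ?thesis
    by (rule latI[OF _ add_subgroupD(2)[OF \<Gamma>' z(1) w(1)]])
       (use lat_outside[OF assms(1)] lat_outside[OF assms(2)] z(2) w(2) in \<open>auto simp: sum.distrib algebra_simps\<close>)
qed

lemma lat_neg:
  assumes "(x, f) \<in> L \<theta>"
  shows "((\<lambda>i. - x i), - f) \<in> L \<theta>"
proof -
  obtain z where z: "(z, f) \<in> \<Gamma>" "\<And>i. i < n \<Longrightarrow> i \<notin> P \<Longrightarrow> x i = (\<Sum>j\<in>P. \<theta> i j * x j) + (\<Sum>j<b. \<theta> i (n + j) * z j)"
    using latE[OF assms] by blast
  show ?thesis
    by (rule latI[OF _ add_subgroupD(3)[OF \<Gamma>' z(1)]])
       (use lat_outside[OF assms] z(2) in \<open>auto simp: sum_negf algebra_simps\<close>)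
qed

text \<open>Rows of integral coordinates vanish in the columns of \<open>P\<close> and take integral
  values on \<Gamma>.\<close>

lemma lat_in_E:
  assumes "\<theta> \<in> A" "(x, f) \<in> L \<theta>"
  shows "x \<in> E"
proof -
  obtain z where z: "(z, f) \<in> \<Gamma>" "\<And>i. i < n \<Longrightarrow> i \<notin> P \<Longrightarrow> x i = (\<Sum>j\<in>P. \<theta> i j * x j) + (\<Sum>j<b. \<theta> i (n + j) * z j)"
    using latE[OF assms(2)] by blast
  have "x i \<in> \<int>" if "i \<ge> k + m" for i
  proof (cases "i < n")
    case True
    have "i \<notin> P" using P that by auto
    then have "x i = (\<Sum>j<b. \<theta> i (n + j) * z j)" using z(2)[OF True] admD(3)[OF assms(1) that] by simp
    then show ?thesis using admD(4)[OF assms(1) that z(1)] by simp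
  next
    case False then show ?thesis using lat_outside[OF assms(2)] by simp
  qed
  then show ?thesis using lat_outside[OF assms(2)] unfolding E_def by auto
qed

lemma lat_torus:
  assumes "\<theta> \<in> A" "k \<le> t" "t < k + m"
  shows "(unit_vec t, 0) \<in> L \<theta>"
  by (rule latI[OF _ zt[OF assms(2,3)]])
     (use admD(5)[OF assms] assms in \<open>auto simp: unit_vec_def\<close>)

lemma lat_add_subgroup: "add_subgroup (L \<theta>)"
  unfolding add_subgroup_def using lat_zero lat_add lat_neg by blast

text \<open>Two lifts of one point differ by an integral combination of the unit vectors in the
  torus directions, and these lie in \<open>L \<theta>\<close>.\<close>

lemma lat_saturated:
  assumes "\<theta> \<in> A" "(x, f) \<in> L \<theta>" "y \<in> E" "pr y g = pr x f"
  shows "(y, g) \<in> L \<theta>"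
proof -
  have xE: "x \<in> E" using lat_in_E assms by blast
  have eq: "g = f" "\<And>i. if k \<le> i \<and> i < k + m then y i - x i \<in> \<int> else y i = x i"
    using assms(4) unfolding pr_eq_iff[OF assms(3) xE] by blast+
  define s where "s t = (if k \<le> t \<and> t < k + m then y t - x t else 0)" for t
  have "s t \<in> \<int>" for t
  proof (cases "k \<le> t \<and> t < k + m")
    case True then show ?thesis using eq(2)[of t] unfolding s_def by simp
  next
    case False then have "s t = 0" unfolding s_def by (simp only: if_False)
    then show ?thesis by simp
  qed
  note sint = this
  have "(s, 0) \<in> L \<theta>"
  proof (rule add_subgroup_unit_vecs[OF lat_add_subgroup])
    show "finite {k..<k + m}" by simp
    show "(unit_vec t, 0) \<in> L \<theta>" if "t \<in> {k..<k + m}" for t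
      using lat_torus[OF assms(1), of t] that by simp
    show "s t \<in> \<int>" for t by (rule sint)
    show "s t = 0" if "t \<notin> {k..<k + m}" for t using that unfolding s_def by auto
  qed
  from lat_add[OF assms(2) this] have "((\<lambda>i. x i + s i), f) \<in> L \<theta>" by simp
  moreover have "x i + s i = y i" for i using eq(2)[of i] unfolding s_def by (auto split: if_splits)
  ultimately show ?thesis using eq(1) by simp
qed

text \<open>By saturation nothing else lies above the image. This lets the injectivity of
  \<open>Th\<close> be examined upstairs, on \<open>L\<close>.\<close>

lemma lat_eq_preimage:
  assumes "\<theta> \<in> A"
  shows "L \<theta> = {(x, f). x \<in> E \<and> pr x f \<in> Th \<theta>}"
proof (intro set_eqI iffI)
  fix q assume q: "q \<in> L \<theta>"
  then show "q \<in> {(x, f). x \<in> E \<and> pr x f \<in> Th \<theta>}"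
    unfolding sub_of_def using lat_in_E[OF assms, of "fst q" "snd q"] by (cases q) auto
next
  fix q assume "q \<in> {(x, f). x \<in> E \<and> pr x f \<in> Th \<theta>}"
  then obtain y g x f where "q = (y, g)" "y \<in> E" "pr y g = pr x f" "(x, f) \<in> L \<theta>"
    unfolding sub_of_def by auto
  then show "q \<in> L \<theta>" using lat_saturated[OF assms] by blast
qed

text \<open>Bounded \<open>x\<close> and a compact set of matrices bound the lattice part of
  \<open>x\<close>, hence \<open>z\<close> itself by means of \<open>c\<close>. Local finiteness of
  \<Gamma> leaves finitely many \<open>z\<close>, and for each of them the relation is closed in a
  compact product. Closedness of \<open>Th \<theta>\<close> and openness of the condition to miss a
  compact set both come from here.\<close>

lemma lat_relation_compact:
  fixes f :: 'f
  assumes "compact \<K>" "\<K> \<subseteq> A" "compactin (G_top k l m) K"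
  shows "compact {(\<theta>, x). \<theta> \<in> \<K> \<and> (\<forall>i. \<bar>x i\<bar> \<le> R) \<and> (x, f) \<in> L \<theta> \<and> pr x f \<in> K}"
proof -
  have "\<exists>B. \<forall>\<theta>\<in>\<K>. \<bar>\<theta> i j\<bar> \<le> B" for i j
  proof -
    have "compact ((\<lambda>\<theta>. \<theta> i j) ` \<K>)"
      by (rule compact_continuous_image[OF continuous_on_subset[OF continuous_on_coord2 subset_UNIV] assms(1)])
    then have "bounded ((\<lambda>\<theta>. \<theta> i j) ` \<K>)" by (rule compact_imp_bounded)
    then show ?thesis unfolding bounded_iff by auto
  qed
  then obtain B where B: "\<And>i j \<theta>. \<theta> \<in> \<K> \<Longrightarrow> \<bar>\<theta> i j\<bar> \<le> B i j" by metis
  define R' where "R' = c * (\<Sum>i\<in>{..<n} - P. R + (\<Sum>j\<in>P. B i j * R))"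
  define Z where "Z = {z. (z, f) \<in> \<Gamma> \<and> (\<forall>j. \<bar>z j\<bar> \<le> R')}"
  have "finite ((\<lambda>z. (z, f)) ` Z)"
    by (rule finite_subset[OF _ disc_groupD(4)[OF \<Gamma>, of R']]) (auto simp: Z_def)
  then have finZ: "finite Z" by (rule finite_imageD) (auto simp: inj_on_def)
  define X where "X = {x. \<forall>i. - R \<le> x i \<and> x i \<le> R} \<inter> {x \<in> E. pr x f \<in> K}"
  have "closedin (top_of_set E) {x \<in> topspace (top_of_set E). pr x f \<in> K}"
    by (rule closedin_continuous_map_preimage[OF pr_continuous compactin_imp_closedin[OF Hausdorff_G_top assms(3)]])
  then have "closed {x \<in> E. pr x f \<in> K}" using closed_E by (simp add: closedin_closed_eq)
  then have cX: "compact X" unfolding X_def by (rule compact_Int_closed[OF compact_box_fun])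
  define M where "M z = (\<K> \<times> X) \<inter> (\<Inter>i\<in>{..<n} - P. {q. snd q i = (\<Sum>j\<in>P. fst q i j * snd q j) + (\<Sum>j<b. fst q i (n + j) * z j)})" for z
  have c1: "continuous_on UNIV (\<lambda>q :: (nat \<Rightarrow> nat \<Rightarrow> real) \<times> (nat \<Rightarrow> real). snd q i)" for i
    by (rule continuous_on_product_then_coordinatewise[OF continuous_on_snd[OF continuous_on_id]])
  have c2: "continuous_on UNIV (\<lambda>q :: (nat \<Rightarrow> nat \<Rightarrow> real) \<times> (nat \<Rightarrow> real). fst q i j)" for i j
    by (rule continuous_on_product_then_coordinatewise[OF continuous_on_product_then_coordinatewise[OF continuous_on_fst[OF continuous_on_id]]])
  have "compact (M z)" for z
    unfolding M_def
    by (intro compact_Int_closed compact_Times assms(1) cX closed_INT ballI closed_Collect_eq continuous_intros c1 c2)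
  then have "compact (\<Union>z\<in>Z. M z)" using finZ by blast
  moreover have "{(\<theta>, x). \<theta> \<in> \<K> \<and> (\<forall>i. \<bar>x i\<bar> \<le> R) \<and> (x, f) \<in> L \<theta> \<and> pr x f \<in> K} = (\<Union>z\<in>Z. M z)"
  proof (intro set_eqI iffI)
    fix q assume "q \<in> {(\<theta>, x). \<theta> \<in> \<K> \<and> (\<forall>i. \<bar>x i\<bar> \<le> R) \<and> (x, f) \<in> L \<theta> \<and> pr x f \<in> K}"
    then obtain \<theta> x where q: "q = (\<theta>, x)" "\<theta> \<in> \<K>" "\<And>i. \<bar>x i\<bar> \<le> R" "(x, f) \<in> L \<theta>" "pr x f \<in> K" by blast
    have \<theta>A: "\<theta> \<in> A" using q assms(2) by blast
    obtain z where z: "(z, f) \<in> \<Gamma>"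
      "\<And>i. i < n \<Longrightarrow> i \<notin> P \<Longrightarrow> x i = (\<Sum>j\<in>P. \<theta> i j * x j) + (\<Sum>j<b. \<theta> i (n + j) * z j)"
      using latE[OF q(4)] by blast
    have "\<bar>z j\<bar> \<le> R'" for j
    proof (cases "j < b")
      case True
      have "\<bar>z j\<bar> \<le> (\<Sum>j<b. \<bar>z j\<bar>)" using True by (intro member_le_sum[of _ _ "\<lambda>j. \<bar>z j\<bar>"]) auto
      also have "\<dots> \<le> c * (\<Sum>i\<in>{..<n} - P. \<bar>\<Sum>j<b. \<theta> i (n + j) * z j\<bar>)" by (rule admD(2)[OF \<theta>A])
      also have "\<dots> \<le> R'" unfolding R'_def
      proof (intro mult_left_mono[OF _ c] sum_mono)
        fix i assume i: "i \<in> {..<n} - P"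
        have "\<bar>\<Sum>j<b. \<theta> i (n + j) * z j\<bar> = \<bar>x i - (\<Sum>j\<in>P. \<theta> i j * x j)\<bar>" using z(2)[of i] i by simp
        also have "\<dots> \<le> \<bar>x i\<bar> + \<bar>\<Sum>j\<in>P. \<theta> i j * x j\<bar>" by (rule abs_triangle_ineq4)
        also have "\<dots> \<le> R + (\<Sum>j\<in>P. B i j * R)"
        proof (intro add_mono q(3) order_trans[OF sum_abs] sum_mono)
          fix j show "\<bar>\<theta> i j * x j\<bar> \<le> B i j * R" unfolding abs_mult
            by (intro mult_mono B q) (use B[OF q(2), of i j] in auto)
        qed
        finally show "\<bar>\<Sum>j<b. \<theta> i (n + j) * z j\<bar> \<le> R + (\<Sum>j\<in>P. B i j * R)" .
      qed
      finally show ?thesis .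
    next
      case False
      \<comment> \<open>Coordinates of \<open>z\<close> from \<open>b\<close> on vanish, so
        \<open>R' \<ge> 0\<close> suffices here; the existence of \<open>x\<close> shows that
        \<open>R\<close> is not negative.\<close>
      have "\<bar>x 0\<bar> \<le> R" by (rule q(3))
      then have R: "R \<ge> 0" by linarith
      have "0 \<le> R'" unfolding R'_def
        using R B[OF q(2)] by (intro mult_nonneg_nonneg c sum_nonneg add_nonneg_nonneg) (meson abs_ge_zero order_trans)+
      then show ?thesis using disc_groupD(2)[OF \<Gamma> z(1)] False by simp
    qed
    then have "z \<in> Z" unfolding Z_def using z(1) by blast
    moreover have "x \<in> X" unfolding X_def using q lat_in_E[OF \<theta>A q(4)] abs_le_D1 abs_le_D2 by (auto simp: abs_le_iff minus_le_iff)
    ultimately show "q \<in> (\<Union>z\<in>Z. M z)" unfolding M_def q(1) using q(2) z(2) by auto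
  next
    fix q assume "q \<in> (\<Union>z\<in>Z. M z)"
    then obtain z \<theta> x where q: "q = (\<theta>, x)" "z \<in> Z" "\<theta> \<in> \<K>" "x \<in> X"
      "\<forall>i\<in>{..<n} - P. x i = (\<Sum>j\<in>P. \<theta> i j * x j) + (\<Sum>j<b. \<theta> i (n + j) * z j)"
      unfolding M_def by auto
    have "(x, f) \<in> L \<theta>" by (rule latI[of x z]) (use q in \<open>auto simp: X_def E_def Z_def\<close>)
    then show "q \<in> {(\<theta>, x). \<theta> \<in> \<K> \<and> (\<forall>i. \<bar>x i\<bar> \<le> R) \<and> (x, f) \<in> L \<theta> \<and> pr x f \<in> K}"
      using q unfolding X_def by (auto simp: abs_le_iff minus_le_iff)
  qed
  ultimately show ?thesis by simp
qed

lemma Th_carrier: "Th \<theta> \<subseteq> G_carrier k l m"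
  unfolding sub_of_def using pr_in_carrier by auto

text \<open>Points of \<open>K\<close> have lifts of bounded size, and saturation puts such a lift
  into \<open>L \<theta>\<close> whenever the point lies in \<open>Th \<theta>\<close>.\<close>

lemma Th_meets_compact:
  assumes "\<theta> \<in> A" "\<forall>g\<in>K. \<exists>x\<in>E. pr x (snd (snd (snd g))) = g \<and> (\<forall>i. \<bar>x i\<bar> \<le> R)"
  shows "Th \<theta> \<inter> K = (\<Union>f. (\<lambda>x. pr x f) ` {x. (\<forall>i. \<bar>x i\<bar> \<le> R) \<and> (x, f) \<in> L \<theta> \<and> pr x f \<in> K})"
proof
  show "Th \<theta> \<inter> K \<subseteq> (\<Union>f. (\<lambda>x. pr x f) ` {x. (\<forall>i. \<bar>x i\<bar> \<le> R) \<and> (x, f) \<in> L \<theta> \<and> pr x f \<in> K})"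
  proof
    fix g assume g: "g \<in> Th \<theta> \<inter> K"
    then obtain y f where y: "(y, f) \<in> L \<theta>" "g = pr y f" unfolding sub_of_def by auto
    obtain x where x: "x \<in> E" "pr x (snd (snd (snd g))) = g" "\<forall>i. \<bar>x i\<bar> \<le> R" using assms(2) g by blast
    have "snd (snd (snd g)) = f" unfolding y pr_sel ..
    then have "(x, f) \<in> L \<theta>" using lat_saturated[OF assms(1) y(1) x(1)] x(2) y(2) by simp
    then show "g \<in> (\<Union>f. (\<lambda>x. pr x f) ` {x. (\<forall>i. \<bar>x i\<bar> \<le> R) \<and> (x, f) \<in> L \<theta> \<and> pr x f \<in> K})"
      using x g \<open>snd (snd (snd g)) = f\<close> by (intro UN_I[of f]) (auto intro!: image_eqI[of _ _ x])
  qed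
qed (auto simp: sub_of_def)

text \<open>The intersection with any compact set is compact, being a finite union, over the finite
  group, of images of compact sets of bounded lifts. In a locally compact Hausdorff space this
  implies closedness; the closed balls of radius 1 for \<open>cdist\<close> serve as compact
  neighbourhoods.\<close>

lemma Th_closed:
  assumes "\<theta> \<in> A"
  shows "closedin (G_top k l m) (Th \<theta>)"
proof -
  have cK: "compactin (G_top k l m) (Th \<theta> \<inter> K)" if K: "compactin (G_top k l m) K" for K
  proof -
    obtain R where R: "\<forall>g\<in>K. \<exists>x\<in>E. pr x (snd (snd (snd g))) = g \<and> (\<forall>i. \<bar>x i\<bar> \<le> R)"
      using compact_lift[OF K] by metis
    have "compactin (G_top k l m) ((\<lambda>x. pr x f) ` {x. (\<forall>i. \<bar>x i\<bar> \<le> R) \<and> (x, f) \<in> L \<theta> \<and> pr x f \<in> K})" (is "compactin _ (_ ` ?X)") for f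
    proof -
      have "compact (snd ` {(\<theta>', x). \<theta>' \<in> {\<theta>} \<and> (\<forall>i. \<bar>x i\<bar> \<le> R) \<and> (x, f) \<in> L \<theta>' \<and> pr x f \<in> K})"
        using assms by (intro compact_continuous_image lat_relation_compact K) (auto intro: continuous_intros)
      moreover have "snd ` {(\<theta>', x). \<theta>' \<in> {\<theta>} \<and> (\<forall>i. \<bar>x i\<bar> \<le> R) \<and> (x, f) \<in> L \<theta>' \<and> pr x f \<in> K} = ?X" by force
      ultimately have "compact ?X" by simp
      moreover have "?X \<subseteq> E" using lat_in_E[OF assms] by blast
      ultimately have "compactin (top_of_set E) ?X" by (simp add: compactin_subtopology)
      then show ?thesis by (rule image_compactin[OF _ pr_continuous])
    qed
    then show ?thesis unfolding Th_meets_compact[OF assms R] by (intro compactin_Union) auto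
  qed
  have "openin (G_top k l m) (G_carrier k l m - Th \<theta>)"
  proof (subst openin_subopen, intro ballI)
    fix g assume g: "g \<in> G_carrier k l m - Th \<theta>"
    let ?d = "cdist k l m (centre g) (snd (snd (snd g)))"
    let ?K = "{x \<in> G_carrier k l m. ?d x \<le> 1}"
    have "closedin (G_top k l m) (Th \<theta> \<inter> ?K)"
      by (rule compactin_imp_closedin[OF Hausdorff_G_top cK[OF compactin_cdist_ball]])
    moreover have "openin (G_top k l m) {x \<in> topspace (G_top k l m). ?d x \<in> {..<1}}"
      by (rule openin_continuous_map_preimage[OF continuous_map_cdist]) auto
    ultimately have "openin (G_top k l m) ({x \<in> topspace (G_top k l m). ?d x \<in> {..<1}} - Th \<theta> \<inter> ?K)" by (rule openin_diff[rotated])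
    moreover have "?d g = 0" unfolding cdist_def centre_def by simp
    ultimately show "\<exists>T. openin (G_top k l m) T \<and> g \<in> T \<and> T \<subseteq> G_carrier k l m - Th \<theta>"
      using g by (intro exI[of _ "{x \<in> topspace (G_top k l m). ?d x \<in> {..<1}} - Th \<theta> \<inter> ?K"]) auto
  qed
  then show ?thesis unfolding closedin_def using Th_carrier by simp
qed

lemma Th_closed_subgroup:
  assumes "\<theta> \<in> A"
  shows "Th \<theta> \<in> closed_subgroups k l m"
  unfolding closed_subgroups_def
proof (intro CollectI conjI ballI)
  show "Th \<theta> \<subseteq> G_carrier k l m" by (rule Th_carrier)
  show "closedin (G_top k l m) (Th \<theta>)" by (rule Th_closed[OF assms])
  show "G_zero \<in> Th \<theta>" unfolding sub_of_def 
    by (rule image_eqI[OF _ lat_zero]) (simp add: pr_zero)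
next
  fix g h assume "g \<in> Th \<theta>" "h \<in> Th \<theta>"
  then obtain x f y f' where xy: "(x, f) \<in> L \<theta>" "g = pr x f" "(y, f') \<in> L \<theta>" "h = pr y f'" unfolding sub_of_def by auto
  have "G_add g h = pr (\<lambda>i. x i + y i) (f + f')"
    unfolding xy by (rule pr_add[OF lat_in_E[OF assms xy(1)] lat_in_E[OF assms xy(3)]])
  then show "G_add g h \<in> Th \<theta>" unfolding sub_of_def
    using lat_add[OF xy(1,3)] by (intro image_eqI[of _ _ "((\<lambda>i. x i + y i), f + f')"]) auto
next
  fix g assume "g \<in> Th \<theta>"
  then obtain x f where x: "(x, f) \<in> L \<theta>" "g = pr x f" unfolding sub_of_def by auto
  have "G_neg g = pr (\<lambda>i. - x i) (- f)" unfolding x by (rule pr_neg[OF lat_in_E[OF assms x(1)]])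
  then show "G_neg g \<in> Th \<theta>" unfolding sub_of_def
    using lat_neg[OF x(1)] by (intro image_eqI[of _ _ "((\<lambda>i. - x i), - f)"]) auto
qed

text \<open>The matrices whose subgroup meets a compact set form a finite union of projections of
  compact relations, hence a closed set. For meeting an open set, a point of one subgroup is
  followed continuously into the neighbouring ones.\<close>

lemma Th_continuous:
  assumes "compact \<K>" "\<K> \<subseteq> A"
  shows "continuous_map (top_of_set \<K>) (SG k l m) Th"
  unfolding SG_def
proof (rule continuous_map_into_subtopology)
  show "Th \<in> topspace (top_of_set \<K>) \<rightarrow> closed_subgroups k l m" using Th_closed_subgroup assms(2) by auto
  show "continuous_map (top_of_set \<K>) (chabauty (G_top k l m)) Th"
  proof (rule continuous_map_into_chabauty)
    show "closedin (G_top k l m) (Th t)" if "t \<in> topspace (top_of_set \<K>)" for t using that assms(2) Th_closed by auto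
  next
    fix K :: "'f Gelem set" assume K: "compactin (G_top k l m) K"
    obtain R where R: "\<forall>g\<in>K. \<exists>x\<in>E. pr x (snd (snd (snd g))) = g \<and> (\<forall>i. \<bar>x i\<bar> \<le> R)"
      using compact_lift[OF K] by metis
    define M where "M f = fst ` {(\<theta>, x). \<theta> \<in> \<K> \<and> (\<forall>i. \<bar>x i\<bar> \<le> R) \<and> (x, f) \<in> L \<theta> \<and> pr x f \<in> K}" for f
    have "compact (M f)" for f unfolding M_def
      by (intro compact_continuous_image lat_relation_compact K assms) (auto intro: continuous_intros)
    then have "compact (\<Union>f. M f)" by (intro compact_UN) auto
    then have "closed (\<Union>f. M f)" by (rule compact_imp_closed)
    then have "openin (top_of_set \<K>) (\<K> \<inter> - (\<Union>f. M f))" by (intro openin_open_Int open_Compl)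
    moreover have "{t \<in> topspace (top_of_set \<K>). Th t \<inter> K = {}} = \<K> \<inter> - (\<Union>f. M f)"
    proof -
      have "Th t \<inter> K = {} \<longleftrightarrow> t \<notin> (\<Union>f. M f)" if "t \<in> \<K>" for t
      proof -
        have "t \<in> A" using that assms by blast
        have H: "t \<in> M f \<longleftrightarrow> {x. (\<forall>i. \<bar>x i\<bar> \<le> R) \<and> (x, f) \<in> L t \<and> pr x f \<in> K} \<noteq> {}" for f
          unfolding M_def using that by force
        show ?thesis unfolding Th_meets_compact[OF \<open>t \<in> A\<close> R] UN_iff H by blast
      qed
      then show ?thesis by auto
    qed
    ultimately show "openin (top_of_set \<K>) {t \<in> topspace (top_of_set \<K>). Th t \<inter> K = {}}" by simp
  next
    fix U :: "'f Gelem set" assume U: "openin (G_top k l m) U"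
    show "openin (top_of_set \<K>) {t \<in> topspace (top_of_set \<K>). Th t \<inter> U \<noteq> {}}"
    proof (subst openin_subopen, intro ballI)
      fix \<theta> assume "\<theta> \<in> {t \<in> topspace (top_of_set \<K>). Th t \<inter> U \<noteq> {}}"
      then obtain x f where x: "\<theta> \<in> \<K>" "(x, f) \<in> L \<theta>" "pr x f \<in> U" unfolding sub_of_def by auto
      obtain z where z: "(z, f) \<in> \<Gamma>"
        "\<And>i. i < n \<Longrightarrow> i \<notin> P \<Longrightarrow> x i = (\<Sum>j\<in>P. \<theta> i j * x j) + (\<Sum>j<b. \<theta> i (n + j) * z j)"
        using latE[OF x(2)] by blast
      \<comment> \<open>The free coordinates of \<open>x\<close> and the lattice vector
        \<open>z\<close> are kept, and the remaining coordinates are recomputed from the varying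
        matrix.\<close>
      define h where "h \<theta>' i = (if i \<in> P then x i else if i < n then (\<Sum>j\<in>P. \<theta>' i j * x j) + (\<Sum>j<b. \<theta>' i (n + j) * z j) else 0)" for \<theta>' i
      have hL: "(h \<theta>', f) \<in> L \<theta>'" for \<theta>'
        by (rule latI[OF _ z(1)]) (use P in \<open>auto simp: h_def intro!: arg_cong2[where f = "(+)"] sum.cong\<close>)
      have h\<theta>: "h \<theta> = x" unfolding h_def using z(2) lat_outside[OF x(2)] by (auto simp: fun_eq_iff)
      have hE: "h \<theta>' \<in> E" if "\<theta>' \<in> \<K>" for \<theta>' using lat_in_E[OF _ hL] that assms(2) by blast
      have "continuous_on \<K> (\<lambda>\<theta>'. h \<theta>' i)" for i
        unfolding h_def by (cases "i \<in> P"; cases "i < n")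
          (auto intro!: continuous_intros continuous_on_subset[OF continuous_on_coord2 subset_UNIV])
      then have "continuous_on \<K> h" by (rule continuous_on_coordinatewise_then_product)
      then have "continuous_map (top_of_set \<K>) (top_of_set E) h"
        using hE by (auto simp: continuous_map_in_subtopology)
      then have "continuous_map (top_of_set \<K>) (G_top k l m) ((\<lambda>x. pr x f) \<circ> h)"
        by (rule continuous_map_compose[OF _ pr_continuous])
      then have "openin (top_of_set \<K>) {t \<in> topspace (top_of_set \<K>). ((\<lambda>x. pr x f) \<circ> h) t \<in> U}"
        by (rule openin_continuous_map_preimage[OF _ U])
      moreover have "{t \<in> topspace (top_of_set \<K>). ((\<lambda>x. pr x f) \<circ> h) t \<in> U} \<subseteq> {t \<in> topspace (top_of_set \<K>). Th t \<inter> U \<noteq> {}}"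
        unfolding sub_of_def using hL by fastforce
      moreover have "\<theta> \<in> {t \<in> topspace (top_of_set \<K>). ((\<lambda>x. pr x f) \<circ> h) t \<in> U}" using x h\<theta> by simp
      ultimately show "\<exists>T. openin (top_of_set \<K>) T \<and> \<theta> \<in> T \<and> T \<subseteq> {t \<in> topspace (top_of_set \<K>). Th t \<inter> U \<noteq> {}}"
        by blast
    qed
  qed
qed

text \<open>Equal subgroups have equal preimages. A lattice column of \<theta> belongs to the
  preimage for \<theta>', where its lattice coordinates differ from a unit vector by an element of
  \<Gamma> so short that the gap \<gamma> forces it to vanish. For columns in \<open>P\<close>
  closeness is replaced by scaling: a vector of a line can be shrunk until the gap applies.\<close>

lemma Th_locally_injective:
  assumes \<theta>: "\<theta> \<in> A" and \<theta>': "\<theta>' \<in> A" and eq: "Th \<theta> = Th \<theta>'"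
    and gap: "\<gamma> > 0" "\<And>z. (z, 0) \<in> \<Gamma> \<Longrightarrow> (\<Sum>j<b. \<bar>z j\<bar>) < \<gamma> \<Longrightarrow> \<forall>j<b. z j = 0"
    and close: "\<And>j. j < b \<Longrightarrow> c * (\<Sum>i\<in>{..<n} - P. \<bar>\<theta> i (n + j) - \<theta>' i (n + j)\<bar>) < \<gamma>"
  shows "\<theta> = \<theta>'"
proof -
  have Leq: "L \<theta> = L \<theta>'" unfolding lat_eq_preimage[OF \<theta>] lat_eq_preimage[OF \<theta>'] eq ..
  have col: "\<theta> i (n + j) = \<theta>' i (n + j)" if j: "j < b" and i: "i < n" "i \<notin> P" for i j
  proof -
    define x where "x i = (if i < n \<and> i \<notin> P then \<theta> i (n + j) else 0)" for i
    have xP: "(\<Sum>j\<in>P. a j * x j) = 0" for a unfolding x_def by (intro sum.neutral) auto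
    have "(x, 0) \<in> L \<theta>"
      by (rule latI[OF _ disc_groupD(3)[OF \<Gamma> j]]) (simp_all only: xP, simp_all add: x_def sum_unit_vec j)
    then obtain z where z: "(z, 0) \<in> \<Gamma>"
      "\<And>i. i < n \<Longrightarrow> i \<notin> P \<Longrightarrow> x i = (\<Sum>j\<in>P. \<theta>' i j * x j) + (\<Sum>j<b. \<theta>' i (n + j) * z j)"
      unfolding Leq using latE by blast
    define w where "w i = z i - unit_vec j i" for i
    have w: "(w, 0) \<in> \<Gamma>" using add_subgroup_diff[OF \<Gamma>' z(1) disc_groupD(3)[OF \<Gamma> j]] unfolding w_def by simp
    have wi: "(\<Sum>j'<b. \<theta>' i (n + j') * w j') = \<theta> i (n + j) - \<theta>' i (n + j)" if "i < n" "i \<notin> P" for i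
    proof -
      have "(\<Sum>j'<b. \<theta>' i (n + j') * w j') = (\<Sum>j'<b. \<theta>' i (n + j') * z j') - (\<Sum>j'<b. \<theta>' i (n + j') * unit_vec j j')"
        unfolding w_def by (simp add: algebra_simps sum_subtractf)
      also have "\<dots> = x i - \<theta>' i (n + j)" using z(2)[OF that] xP j by (simp add: sum_unit_vec)
      finally show ?thesis using that unfolding x_def by simp
    qed
    have "(\<Sum>j<b. \<bar>w j\<bar>) \<le> c * (\<Sum>i\<in>{..<n} - P. \<bar>\<Sum>j<b. \<theta>' i (n + j) * w j\<bar>)" by (rule admD(2)[OF \<theta>'])
    also have "\<dots> = c * (\<Sum>i\<in>{..<n} - P. \<bar>\<theta> i (n + j) - \<theta>' i (n + j)\<bar>)"
      by (intro arg_cong[where f = "(*) c"] sum.cong) (auto simp: wi)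
    also have "\<dots> < \<gamma>" by (rule close[OF j])
    finally have "\<forall>j<b. w j = 0" by (rule gap(2)[OF w])
    then show ?thesis using wi[OF i] by simp
  qed
  have colP: "\<theta> i p = \<theta>' i p" if p: "p \<in> P" and i: "i < n" "i \<notin> P" for i p
  proof -
    define S where "S = c * (\<Sum>i\<in>{..<n} - P. \<bar>\<theta> i p - \<theta>' i p\<bar>)"
    have S: "S \<ge> 0" unfolding S_def by (intro mult_nonneg_nonneg c sum_nonneg) auto
    \<comment> \<open>Chosen so that \<open>t * S \<le> \<gamma> / 2\<close>; the added 1 keeps the
      denominator positive if \<open>S\<close> is 0.\<close>
    define t where "t = \<gamma> / (2 * (S + 1))"
    have t: "t > 0" unfolding t_def using S gap(1) by simp
    have "t * S \<le> \<gamma> / 2"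
    proof -
      have "t * S \<le> t * (S + 1)" using t by simp
      also have "\<dots> = \<gamma> / 2" unfolding t_def using S by (simp add: field_simps)
      finally show ?thesis .
    qed
    then have tS: "t * S < \<gamma>" using gap(1) by simp
    define x where "x i = (if i \<in> P then t * unit_vec p i else if i < n then \<theta> i p * t else 0)" for i
    have xP: "(\<Sum>j\<in>P. a j * x j) = a p * t" for a
    proof -
      have "(\<Sum>j\<in>P. a j * x j) = (\<Sum>j\<in>P. (a j * t) * unit_vec p j)" unfolding x_def by (intro sum.cong) auto
      then show ?thesis using p finP by (simp add: sum_unit_vec)
    qed
    have "(x, 0) \<in> L \<theta>"
      by (rule latI[OF _ add_subgroupD(1)[OF \<Gamma>']]) (simp_all only: xP, use P in \<open>auto simp: x_def\<close>)
    then obtain z where z: "(z, 0) \<in> \<Gamma>"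
      "\<And>i. i < n \<Longrightarrow> i \<notin> P \<Longrightarrow> x i = (\<Sum>j\<in>P. \<theta>' i j * x j) + (\<Sum>j<b. \<theta>' i (n + j) * z j)"
      unfolding Leq using latE by blast
    have zi: "(\<Sum>j<b. \<theta>' i (n + j) * z j) = t * (\<theta> i p - \<theta>' i p)" if "i < n" "i \<notin> P" for i
      using z(2)[OF that] unfolding xP using that by (simp add: x_def algebra_simps)
    have "(\<Sum>j<b. \<bar>z j\<bar>) \<le> c * (\<Sum>i\<in>{..<n} - P. \<bar>\<Sum>j<b. \<theta>' i (n + j) * z j\<bar>)" by (rule admD(2)[OF \<theta>'])
    also have "\<dots> = c * (\<Sum>i\<in>{..<n} - P. t * \<bar>\<theta> i p - \<theta>' i p\<bar>)"
      using t by (intro arg_cong[where f = "(*) c"] sum.cong) (auto simp: zi abs_mult)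
    also have "\<dots> = t * S" unfolding S_def by (simp add: sum_distrib_left mult.left_commute)
    also have "\<dots> < \<gamma>" by (rule tS)
    finally have "\<forall>j<b. z j = 0" by (rule gap(2)[OF z(1)])
    then have "t * (\<theta> i p - \<theta>' i p) = 0" using zi[OF i] by simp
    then show ?thesis using t by simp
  qed
  show ?thesis
  proof (intro ext)
    fix i j
    show "\<theta> i j = \<theta>' i j"
    proof (cases "i < n \<and> i \<notin> P \<and> (j \<in> P \<or> (n \<le> j \<and> j < n + b))")
      case True
      then show ?thesis using col[of "j - n" i] colP[of j i] by auto
    next
      case False then show ?thesis using admD(1)[OF \<theta> False] admD(1)[OF \<theta>' False] by simp
    qed
  qed
qed

end

section \<open>The structure of closed subgroups\<close>

lemma tendsto_fun_iff:
  fixes f :: "'a \<Rightarrow> nat \<Rightarrow> real"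
  shows "(f \<longlongrightarrow> x) F \<longleftrightarrow> (\<forall>i. ((\<lambda>a. f a i) \<longlongrightarrow> x i) F)"
  using limitin_componentwise[of "\<lambda>_. euclideanreal" UNIV f x F] by (simp add: euclidean_product_topology)

text \<open>Points in the same cell of a grid of mesh \<open>e\<close> coincide, and a bounded
  region meets finitely many cells.\<close>

lemma bounded_separated_finite:
  fixes S :: "(nat \<Rightarrow> real) set"
  assumes "e > 0" "\<And>x i. x \<in> S \<Longrightarrow> i \<ge> N \<Longrightarrow> x i = 0" "\<And>x i. x \<in> S \<Longrightarrow> \<bar>x i\<bar> \<le> R"
    "\<And>x y. x \<in> S \<Longrightarrow> y \<in> S \<Longrightarrow> (\<And>i. \<bar>x i - y i\<bar> < e) \<Longrightarrow> x = y"
  shows "finite S"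
proof -
  define g where "g x = restrict (\<lambda>i. \<lfloor>x i / e\<rfloor>) {..<N}" for x :: "nat \<Rightarrow> real"
  have "g ` S \<subseteq> ({..<N} \<rightarrow>\<^sub>E {\<lfloor>- R / e\<rfloor>..\<lfloor>R / e\<rfloor>})"
  proof
    fix h assume "h \<in> g ` S"
    then obtain x where x: "x \<in> S" "h = g x" by blast
    have "- R / e \<le> x i / e \<and> x i / e \<le> R / e" for i
    proof -
      have "- R \<le> x i" "x i \<le> R" using assms(3)[OF x(1), of i] by auto
      then show ?thesis using assms(1) by (intro conjI divide_right_mono) auto
    qed
    then show "h \<in> ({..<N} \<rightarrow>\<^sub>E {\<lfloor>- R / e\<rfloor>..\<lfloor>R / e\<rfloor>})"
      unfolding x g_def by (auto intro!: floor_mono)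
  qed
  moreover have "finite ({..<N} \<rightarrow>\<^sub>E {\<lfloor>- R / e\<rfloor>..\<lfloor>R / e\<rfloor>})" by (intro finite_PiE) auto
  ultimately have "finite (g ` S)" by (rule finite_subset)
  moreover have "inj_on g S"
  proof (rule inj_onI)
    fix x y assume xy: "x \<in> S" "y \<in> S" "g x = g y"
    show "x = y"
    proof (rule assms(4)[OF xy(1,2)])
      fix i show "\<bar>x i - y i\<bar> < e"
      proof (cases "i < N")
        case True
        then have "\<lfloor>x i / e\<rfloor> = \<lfloor>y i / e\<rfloor>" using fun_cong[OF xy(3), of i] unfolding g_def by simp
        then have "\<bar>x i / e - y i / e\<bar> < 1" by linarith
        then have "\<bar>(x i - y i) / e\<bar> < 1" by (simp add: diff_divide_distrib)
        then show ?thesis using assms(1) by (simp add: abs_divide)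
      next
        case False then show ?thesis using assms(1) assms(2)[OF xy(1)] assms(2)[OF xy(2)] by simp
      qed
    qed
  qed
  ultimately show ?thesis by (rule finite_imageD)
qed

section \<open>Closed subgroups of a real vector space\<close>

definition closed_vec_group :: "nat \<Rightarrow> (nat \<Rightarrow> real) set \<Rightarrow> bool" where
  "closed_vec_group N B \<longleftrightarrow> closed B \<and> (\<lambda>_. 0) \<in> B \<and> (\<forall>x\<in>B. \<forall>y\<in>B. (\<lambda>i. x i + y i) \<in> B) \<and>
     (\<forall>x\<in>B. (\<lambda>i. - x i) \<in> B) \<and> (\<forall>x\<in>B. \<forall>i\<ge>N. x i = 0)"

lemma closed_vec_groupD:
  assumes "closed_vec_group N B"
  shows "closed B" "(\<lambda>_. 0) \<in> B" "x \<in> B \<Longrightarrow> y \<in> B \<Longrightarrow> (\<lambda>i. x i + y i) \<in> B"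
    "x \<in> B \<Longrightarrow> (\<lambda>i. - x i) \<in> B" "x \<in> B \<Longrightarrow> i \<ge> N \<Longrightarrow> x i = 0"
  using assms unfolding closed_vec_group_def by blast+

lemma closed_vec_group_int:
  assumes "closed_vec_group N B" "x \<in> B"
  shows "(\<lambda>i. of_int s * x i) \<in> B"
proof -
  have nat: "(\<lambda>i. real r * x i) \<in> B" for r
  proof (induction r)
    case 0 then show ?case using closed_vec_groupD(2)[OF assms(1)] by simp
  next
    case (Suc r)
    from closed_vec_groupD(3)[OF assms Suc] show ?case by (simp add: algebra_simps)
  qed
  show ?thesis
  proof (cases "s \<ge> 0")
    case True then show ?thesis using nat[of "nat s"] by simp
  next
    case False
    then show ?thesis using closed_vec_groupD(4)[OF assms(1) nat[of "nat (-s)"]] by simp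
  qed
qed

text \<open>If arbitrarily short nonzero vectors existed, their directions would accumulate at the direction of a line in \<open>B\<close>.\<close>

lemma closed_vec_group_discrete:
  assumes B: "closed_vec_group N B" and no_line: "\<And>u. (\<And>t. (\<lambda>i. t * u i) \<in> B) \<Longrightarrow> u = (\<lambda>_. 0)"
  obtains e where "e > 0" "\<And>x. x \<in> B \<Longrightarrow> (\<And>i. \<bar>x i\<bar> < e) \<Longrightarrow> x = (\<lambda>_. 0)"
proof (rule ccontr)
  assume "\<not> thesis"
  then have "\<forall>r. \<exists>x. x \<in> B \<and> (\<forall>i. \<bar>x i\<bar> < 1 / real (Suc r)) \<and> x \<noteq> (\<lambda>_. 0)"
    using that by (metis of_nat_0_less_iff zero_less_Suc zero_less_divide_1_iff)
  then obtain X where X: "\<And>r. X r \<in> B" "\<And>r i. \<bar>X r i\<bar> < 1 / real (Suc r)" "\<And>r. X r \<noteq> (\<lambda>_. 0)" by metis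
  define s where "s r = (\<Sum>i<N. \<bar>X r i\<bar>)" for r
  have spos: "s r > 0" for r
  proof -
    obtain i where i: "X r i \<noteq> 0" using X(3)[of r] by auto
    then have "i < N" using closed_vec_groupD(5)[OF B X(1)] by (metis not_le)
    then have "\<bar>X r i\<bar> \<le> s r" unfolding s_def by (intro member_le_sum[of _ _ "\<lambda>i. \<bar>X r i\<bar>"]) auto
    then show ?thesis using i by linarith
  qed
  have s0: "s \<longlonglongrightarrow> 0"
  proof (rule tendsto_sandwich[of "\<lambda>_. 0" _ _ "\<lambda>r. real N * (1 / real (Suc r))"])
    show "\<forall>\<^sub>F r in sequentially. s r \<le> real N * (1 / real (Suc r))"
    proof (intro always_eventually allI)
      fix r
      have "s r \<le> (\<Sum>i<N. 1 / real (Suc r))" unfolding s_def using X(2) by (intro sum_mono less_imp_le)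
      then show "s r \<le> real N * (1 / real (Suc r))" by simp
    qed
    have "(\<lambda>r. 1 / real (Suc r)) \<longlonglongrightarrow> 0" using LIMSEQ_inverse_real_of_nat by (simp add: inverse_eq_divide)
    then show "(\<lambda>r. real N * (1 / real (Suc r))) \<longlonglongrightarrow> 0" by (rule tendsto_mult_right_zero)
  qed (auto simp: spos less_imp_le)
  define U where "U r i = X r i / s r" for r i
  define C where "C = {x :: nat \<Rightarrow> real. \<forall>i. (if i < N then -1 else 0) \<le> x i \<and> x i \<le> (if i < N then 1 else 0)}"
  have "seq_compact C" unfolding C_def by (intro compact_imp_seq_compact compact_box_fun)
  moreover have "U r \<in> C" for r
  proof -
    have "\<bar>X r i\<bar> \<le> s r" if "i < N" for i
      unfolding s_def using that by (intro member_le_sum[of _ _ "\<lambda>i. \<bar>X r i\<bar>"]) auto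
    then show ?thesis unfolding C_def U_def using spos[of r] closed_vec_groupD(5)[OF B X(1)]
      by (auto simp: divide_le_eq le_divide_eq abs_le_iff minus_le_iff)
  qed
  ultimately obtain u \<phi> where u: "u \<in> C" "strict_mono (\<phi> :: nat \<Rightarrow> nat)" "(U \<circ> \<phi>) \<longlonglongrightarrow> u"
    unfolding seq_compact_def by metis
  have ui: "(\<lambda>r. U (\<phi> r) i) \<longlonglongrightarrow> u i" for i using u(3) unfolding tendsto_fun_iff o_def by blast
  have "(\<lambda>r. \<Sum>i<N. \<bar>U (\<phi> r) i\<bar>) \<longlonglongrightarrow> (\<Sum>i<N. \<bar>u i\<bar>)" by (intro tendsto_sum tendsto_rabs ui)
  moreover have "(\<Sum>i<N. \<bar>U r i\<bar>) = 1" for r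
  proof -
    have "(\<Sum>i<N. \<bar>U r i\<bar>) = (\<Sum>i<N. \<bar>X r i\<bar>) / s r" unfolding U_def sum_divide_distrib using spos[of r] by (intro sum.cong) auto
    then show ?thesis using spos[of r] unfolding s_def[symmetric] by simp
  qed
  ultimately have "(\<Sum>i<N. \<bar>u i\<bar>) = 1" by (simp add: LIMSEQ_const_iff)
  moreover have "u = (\<lambda>_. 0)"
  proof (rule no_line)
    fix t
    \<comment> \<open>Multiplying a vector of length s by the integer part of t / s gives its
      direction times a number within s of t. As s tends to 0, every real multiple of the limit
      direction \<open>u\<close> is a limit of elements of \<open>B\<close>.\<close>
    define Y where "Y r i = of_int \<lfloor>t / s (\<phi> r)\<rfloor> * X (\<phi> r) i" for r i
    have "Y r \<in> B" for r unfolding Y_def by (rule closed_vec_group_int[OF B X(1)])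
    moreover have "Y \<longlonglongrightarrow> (\<lambda>i. t * u i)"
      unfolding tendsto_fun_iff
    proof
      fix i
      have s\<phi>: "(\<lambda>r. s (\<phi> r)) \<longlonglongrightarrow> 0" using LIMSEQ_subseq_LIMSEQ[OF s0 u(2)] by (simp add: o_def)
      have "(\<lambda>r. of_int \<lfloor>t / s (\<phi> r)\<rfloor> * s (\<phi> r) - t) \<longlonglongrightarrow> 0"
      proof (rule Lim_null_comparison[OF _ s\<phi>], intro always_eventually allI)
        fix r
        have fl: "of_int \<lfloor>t / s (\<phi> r)\<rfloor> \<le> t / s (\<phi> r)" "t / s (\<phi> r) \<le> of_int \<lfloor>t / s (\<phi> r)\<rfloor> + 1" by linarith+
        have "of_int \<lfloor>t / s (\<phi> r)\<rfloor> * s (\<phi> r) \<le> t" "t \<le> (of_int \<lfloor>t / s (\<phi> r)\<rfloor> + 1) * s (\<phi> r)"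
          using fl(1)[unfolded pos_le_divide_eq[OF spos]] fl(2)[unfolded pos_divide_le_eq[OF spos]] .
        then show "norm (of_int \<lfloor>t / s (\<phi> r)\<rfloor> * s (\<phi> r) - t) \<le> s (\<phi> r)" by (simp add: algebra_simps abs_le_iff)
      qed
      then have "(\<lambda>r. of_int \<lfloor>t / s (\<phi> r)\<rfloor> * s (\<phi> r)) \<longlonglongrightarrow> t" using LIM_zero_iff by blast
      then have "(\<lambda>r. of_int \<lfloor>t / s (\<phi> r)\<rfloor> * s (\<phi> r) * U (\<phi> r) i) \<longlonglongrightarrow> t * u i" by (intro tendsto_mult ui)
      moreover have "of_int \<lfloor>t / s (\<phi> r)\<rfloor> * s (\<phi> r) * U (\<phi> r) i = Y r i" for r
        unfolding Y_def U_def using spos[of "\<phi> r"] by simp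
      ultimately show "(\<lambda>r. Y r i) \<longlonglongrightarrow> t * u i" by simp
    qed
    ultimately show "(\<lambda>i. t * u i) \<in> B" using closed_sequentially[OF closed_vec_groupD(1)[OF B]] by blast
  qed
  ultimately show False by simp
qed

text \<open>Among the families of lines of \<open>B\<close> in reduced echelon form one with the
  largest number of pivots is taken. A further line vanishing on \<open>P\<close> would yield an
  additional pivot \<open>h\<close>, after normalising it at \<open>h\<close> and clearing that
  column in the others.\<close>

lemma maximal_lines:
  assumes B: "closed_vec_group N B"
  obtains P v where "P \<subseteq> {..<N}" "\<And>p t. p \<in> P \<Longrightarrow> (\<lambda>i. t * v p i) \<in> B"
    "\<And>p q. p \<in> P \<Longrightarrow> q \<in> P \<Longrightarrow> v p q = unit_vec p q"
    "\<And>u. (\<And>p. p \<in> P \<Longrightarrow> u p = 0) \<Longrightarrow> (\<And>t. (\<lambda>i. t * u i) \<in> B) \<Longrightarrow> u = (\<lambda>_. 0)"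
proof -
  define Q where "Q P v \<longleftrightarrow> P \<subseteq> {..<N} \<and> (\<forall>p\<in>P. \<forall>t. (\<lambda>i. t * v p i) \<in> B) \<and> (\<forall>p\<in>P. \<forall>q\<in>P. v p q = unit_vec p q)"
    for P and v :: "nat \<Rightarrow> nat \<Rightarrow> real"
  have "\<exists>P. (\<exists>v. Q P v) \<and> (\<forall>P'. (\<exists>v. Q P' v) \<longrightarrow> card P' \<le> card P)"
  proof (rule ex_has_greatest_nat[of "\<lambda>P. \<exists>v. Q P v" "{}" card "Suc N"])
    show "\<exists>v. Q {} v" unfolding Q_def by simp
    show "\<forall>P. (\<exists>v. Q P v) \<longrightarrow> card P < Suc N" unfolding Q_def using card_mono[of "{..<N}"] by fastforce
  qed
  then obtain P v where Pv: "Q P v" "\<And>P' v'. Q P' v' \<Longrightarrow> card P' \<le> card P" by blast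
  have finP: "finite P" using Pv(1) unfolding Q_def using finite_subset by blast
  show thesis
  proof
    show "P \<subseteq> {..<N}" "\<And>p t. p \<in> P \<Longrightarrow> (\<lambda>i. t * v p i) \<in> B"
      "\<And>p q. p \<in> P \<Longrightarrow> q \<in> P \<Longrightarrow> v p q = unit_vec p q" using Pv(1) unfolding Q_def by auto
    fix u assume u: "\<And>p. p \<in> P \<Longrightarrow> u p = 0" "\<And>t. (\<lambda>i. t * u i) \<in> B"
    show "u = (\<lambda>_. 0)"
    proof (rule ccontr)
      assume "u \<noteq> (\<lambda>_. 0)"
      then obtain h where h: "u h \<noteq> 0" by auto
      have "h < N" using h closed_vec_groupD(5)[OF B u(2)[of 1], of h] by (cases "h < N") auto
      have hP: "h \<notin> P" using h u(1) by blast
      define w where "w i = u i / u h" for i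
      have w: "(\<lambda>i. t * w i) \<in> B" for t using u(2)[of "t / u h"] unfolding w_def by simp
      define v' where "v' p i = (if p = h then w i else v p i - v p h * w i)" for p i
      have "Q (insert h P) v'"
        unfolding Q_def
      proof (intro conjI ballI allI)
        show "insert h P \<subseteq> {..<N}" using Pv(1) \<open>h < N\<close> unfolding Q_def by auto
        fix p t assume p: "p \<in> insert h P"
        show "(\<lambda>i. t * v' p i) \<in> B"
        proof (cases "p = h")
          case True then show ?thesis using w unfolding v'_def by simp
        next
          case False
          then have "(\<lambda>i. t * v p i) \<in> B" using Pv(1) p unfolding Q_def by blast
          from closed_vec_groupD(3)[OF B this w[of "- t * v p h"]] show ?thesis
            unfolding v'_def using False by (simp add: algebra_simps)
        qed
      next
        fix p q assume pq: "p \<in> insert h P" "q \<in> insert h P"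
        have "w h = 1" unfolding w_def using h by simp
        moreover have "w q = 0" if "q \<in> P" for q using u(1)[OF that] unfolding w_def by simp
        moreover have "v p q = unit_vec p q" if "p \<in> P" "q \<in> P" using Pv(1) that unfolding Q_def by blast
        ultimately show "v' p q = unit_vec p q" using pq hP unfolding v'_def unit_vec_def by auto
      qed
      from Pv(2)[OF this] show False using hP finP by simp
    qed
  qed
qed

text \<open>Independent families have at most \<open>N\<close> members, so a longest one in
  \<open>B\<close> exists; adding any \<open>x\<close> makes it dependent, which expresses
  \<open>x\<close> through it with real coefficients.\<close>

lemma maximal_independent:
  assumes "\<And>x i. x \<in> B \<Longrightarrow> i \<ge> N \<Longrightarrow> x i = 0"
  shows "\<exists>(b :: nat) (w :: nat \<Rightarrow> nat \<Rightarrow> real). (\<forall>j<b. w j \<in> B) \<and>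
    (\<forall>c. (\<forall>i<N. (\<Sum>j<b. c j * w j i) = 0) \<longrightarrow> (\<forall>j<b. c j = 0)) \<and>
    (\<forall>x\<in>B. \<exists>z. \<forall>i. x i = (\<Sum>j<b. z j * w j i))"
proof -
  define Q where "Q b w \<longleftrightarrow> (\<forall>j<b. w j \<in> B) \<and> (\<forall>c. (\<forall>i<N. (\<Sum>j<b. c j * w j i) = 0) \<longrightarrow> (\<forall>j<b. c j = 0))"
    for b and w :: "nat \<Rightarrow> nat \<Rightarrow> real"
  have "b \<le> N" if "Q b w" for b w
  proof -
    have "b \<le> card {..<N}" by (rule independent_forms_card[where w = w]) (use that in \<open>auto simp: Q_def\<close>)
    then show ?thesis by simp
  qed
  then have bd: "\<forall>b. (\<exists>w. Q b w) \<longrightarrow> b < Suc N" by (metis less_Suc_eq_le)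
  have "\<exists>b. (\<exists>w. Q b w) \<and> (\<forall>b'. (\<exists>w. Q b' w) \<longrightarrow> b' \<le> b)"
  proof (rule ex_has_greatest_nat[of "\<lambda>b. \<exists>w. Q b w" 0 "\<lambda>b. b" "Suc N"])
    show "\<exists>w. Q 0 w" unfolding Q_def by simp
  qed (rule bd)
  then obtain b w where bw: "Q b w" "\<And>b' w'. Q b' w' \<Longrightarrow> b' \<le> b" by blast
  show ?thesis
  proof (intro exI[of _ b] exI[of _ w] conjI ballI)
    show "\<forall>j<b. w j \<in> B" "\<forall>c. (\<forall>i<N. (\<Sum>j<b. c j * w j i) = 0) \<longrightarrow> (\<forall>j<b. c j = 0)"
      using bw(1) unfolding Q_def by blast+
    fix x assume x: "x \<in> B"
    define w' where "w' = w(b := x)"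
    have "\<not> Q (Suc b) w'" using bw(2)[of "Suc b" w'] by auto
    moreover have "\<forall>j<Suc b. w' j \<in> B" using bw(1) x unfolding Q_def w'_def by (auto simp: less_Suc_eq)
    ultimately obtain c where c: "\<forall>i<N. (\<Sum>j<Suc b. c j * w' j i) = 0" "\<exists>j<Suc b. c j \<noteq> 0" unfolding Q_def by blast
    have cs: "(\<Sum>j<b. c j * w j i) + c b * x i = 0" if "i < N" for i
      using c(1)[rule_format, OF that] unfolding w'_def by simp
    have cb: "c b \<noteq> 0"
    proof
      assume "c b = 0"
      then have "\<forall>i<N. (\<Sum>j<b. c j * w j i) = 0" using cs by simp
      then have "\<forall>j<b. c j = 0" using bw(1) unfolding Q_def by blast
      then show False using c(2) \<open>c b = 0\<close> by (auto simp: less_Suc_eq)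
    qed
    show "\<exists>z. \<forall>i. x i = (\<Sum>j<b. z j * w j i)"
    proof (intro exI[of _ "\<lambda>j. - c j / c b"] allI)
      fix i
      show "x i = (\<Sum>j<b. - c j / c b * w j i)"
      proof (cases "i < N")
        case True
        have "(\<Sum>j<b. - c j / c b * w j i) = - (\<Sum>j<b. c j * w j i) / c b"
          by (simp add: sum_divide_distrib sum_negf)
        also have "\<dots> = x i" using cs[OF True] cb by (simp add: field_simps add_eq_0_iff)
        finally show ?thesis by simp
      next
        case False
        then have "w j i = 0" if "j < b" for j using assms bw(1) that unfolding Q_def by (metis not_le)
        then show ?thesis using assms[OF x] False by simp
      qed
    qed
  qed
qed

context params
begin

text \<open>The preimage \<open>A\<close> of \<open>H\<close> splits into a vector space part,
  spanned by the lines \<open>v p\<close>, and the subgroup \<open>B\<close> of elements vanishing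
  on the pivots \<open>P\<close>. The elements of \<open>B\<close> with trivial component in the
  finite group contain no line, hence are discrete; independent vectors \<open>w j\<close> among
  them give coordinates, and \<Gamma> collects the coordinates of all of \<open>B\<close>. The
  columns of \<theta> are the \<open>v p\<close> and the \<open>w j\<close>.\<close>

lemma closed_subgroup_eq_sub_of:
  fixes H :: "'f::{finite,ab_group_add} Gelem set"
  assumes H: "H \<in> closed_subgroups k l m"
  obtains P b \<Gamma> zt c \<theta> where "P \<subseteq> {..<k + m}" "disc_group b \<Gamma>"
    "\<And>t. k \<le> t \<Longrightarrow> t < k + m \<Longrightarrow> (zt t, 0) \<in> \<Gamma>" "c \<ge> 0"
    "\<theta> \<in> adm P b \<Gamma> zt c" "H = sub_of P b \<Gamma> \<theta>"
proof -
  have HG: "H \<subseteq> G_carrier k l m" "closedin (G_top k l m) H" "G_zero \<in> H"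
    "\<And>x y. x \<in> H \<Longrightarrow> y \<in> H \<Longrightarrow> G_add x y \<in> H" "\<And>x. x \<in> H \<Longrightarrow> G_neg x \<in> H"
    using H unfolding closed_subgroups_def by auto
  define A where "A = {(x, f). x \<in> E \<and> pr x f \<in> H}"
  have AE: "x \<in> E" if "(x, f) \<in> A" for x f using that unfolding A_def by blast
  have E0: "(\<lambda>_. 0) \<in> E" unfolding E_def by simp
  have A: "add_subgroup A" unfolding add_subgroup_def
  proof (intro conjI allI impI)
    show "((\<lambda>_. 0), 0) \<in> A" unfolding A_def using E0 HG(3) by (simp add: pr_zero)
    fix z f assume z: "(z, f) \<in> A"
    have zE: "z \<in> E" and zH: "pr z f \<in> H" using z unfolding A_def by auto
    show "((\<lambda>i. - z i), - f) \<in> A" unfolding A_def using E_neg[OF zE] pr_neg[OF zE, of f] HG(5)[OF zH] by simp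
    fix w g assume w: "(w, g) \<in> A"
    have wE: "w \<in> E" and wH: "pr w g \<in> H" using w unfolding A_def by auto
    show "((\<lambda>i. z i + w i), f + g) \<in> A"
      unfolding A_def using E_add[OF zE wE] pr_add[OF zE wE, of f g] HG(4)[OF zH wH] by simp
  qed
  define A0 where "A0 = {x. (x, 0) \<in> A}"
  have clA0: "closed A0"
  proof -
    have "closedin (top_of_set E) {x \<in> topspace (top_of_set E). pr x 0 \<in> H}"
      by (rule closedin_continuous_map_preimage[OF pr_continuous HG(2)])
    then show ?thesis unfolding A0_def A_def using closed_E by (simp add: closedin_closed_eq)
  qed
  have A0E: "A0 \<subseteq> E" unfolding A0_def A_def by blast
  have A0: "closed_vec_group n A0"
    unfolding closed_vec_group_def
  proof (intro conjI ballI allI impI)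
    show "closed A0" by (rule clA0)
    show "(\<lambda>_. 0) \<in> A0" unfolding A0_def using add_subgroupD(1)[OF A] by simp
    fix x assume x: "x \<in> A0"
    show "(\<lambda>i. - x i) \<in> A0" using add_subgroupD(3)[OF A] x unfolding A0_def by fastforce
    show "x i = 0" if "i \<ge> n" for i using x A0E that unfolding E_def by blast
    fix y assume y: "y \<in> A0"
    show "(\<lambda>i. x i + y i) \<in> A0" using add_subgroupD(2)[OF A, of x 0 y 0] x y unfolding A0_def by simp
  qed
  obtain P v where Pv: "P \<subseteq> {..<n}" "\<And>p t. p \<in> P \<Longrightarrow> (\<lambda>i. t * v p i) \<in> A0"
    "\<And>p q. p \<in> P \<Longrightarrow> q \<in> P \<Longrightarrow> v p q = unit_vec p q"
    "\<And>u. (\<And>p. p \<in> P \<Longrightarrow> u p = 0) \<Longrightarrow> (\<And>t. (\<lambda>i. t * u i) \<in> A0) \<Longrightarrow> u = (\<lambda>_. 0)"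
    by (fact maximal_lines[OF A0])
  have finP: "finite P" using Pv(1) finite_subset by blast
  have vInt: "v p i = 0" if "p \<in> P" "i \<ge> k + m" for p i
  proof (rule ccontr)
    assume nz: "v p i \<noteq> 0"
    \<comment> \<open>The point of the line with i-th coordinate 1/2 contradicts
      integrality.\<close>
    have "(\<lambda>j. (1 / (2 * v p i)) * v p j) \<in> E" using Pv(2)[OF that(1)] A0E by blast
    then have "(1 / (2 * v p i)) * v p i \<in> \<int>" using that(2) unfolding E_def by blast
    then have "(1/2::real) \<in> \<int>" using nz by simp
    then obtain z where "(1/2::real) = of_int z" by (rule Ints_cases)
    then have "real_of_int (2 * z) = of_int 1" by simp
    then have "2 * z = 1" by (simp only: of_int_eq_iff)
    then show False by presburger
  qed
  have Pkm: "P \<subseteq> {..<k + m}"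
  proof
    fix p assume p: "p \<in> P"
    then have "v p p = 1" using Pv(3)[OF p p] unfolding unit_vec_def by simp
    then show "p \<in> {..<k + m}" using vInt[OF p, of p] by (cases "p < k + m") auto
  qed
  define B where "B = {(x, f) \<in> A. \<forall>p\<in>P. x p = 0}"
  have B: "add_subgroup B" using A unfolding add_subgroup_def B_def by auto
  define B0 where "B0 = {x. (x, 0) \<in> B}"
  have "closed (A0 \<inter> (\<Inter>p\<in>P. {x. x p = 0}))"
    by (intro closed_Int clA0 closed_INT ballI closed_Collect_eq continuous_intros continuous_on_product_coordinates)
  moreover have B0eq: "B0 = A0 \<inter> (\<Inter>p\<in>P. {x. x p = 0})" unfolding B0_def B_def A0_def by auto
  ultimately have B0: "closed_vec_group n B0" using A0 unfolding closed_vec_group_def by auto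
  have noline: "u = (\<lambda>_. 0)" if "\<And>t. (\<lambda>i. t * u i) \<in> B0" for u
  proof (rule Pv(4))
    show "u p = 0" if "p \<in> P" for p using \<open>\<And>t. (\<lambda>i. t * u i) \<in> B0\<close>[of 1] that unfolding B0eq by auto
    show "(\<lambda>i. t * u i) \<in> A0" for t using that[of t] unfolding B0eq by blast
  qed
  have "\<exists>e>0. \<forall>x\<in>B0. (\<forall>i. \<bar>x i\<bar> < e) \<longrightarrow> x = (\<lambda>_. 0)"
  proof (rule closed_vec_group_discrete[OF B0])
    show "u = (\<lambda>_. 0)" if "\<And>t. (\<lambda>i. t * u i) \<in> B0" for u by (rule noline[OF that])
    fix e :: real assume "e > 0" "\<And>x. x \<in> B0 \<Longrightarrow> (\<And>i. \<bar>x i\<bar> < e) \<Longrightarrow> x = (\<lambda>_. 0)"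
    then show ?thesis by blast
  qed
  then obtain e where e: "e > 0" "\<And>x. x \<in> B0 \<Longrightarrow> (\<And>i. \<bar>x i\<bar> < e) \<Longrightarrow> x = (\<lambda>_. 0)" by blast
  have B0n: "x i = 0" if "x \<in> B0" "i \<ge> n" for x i using closed_vec_groupD(5)[OF B0 that] .
  have "\<exists>(b :: nat) (w :: nat \<Rightarrow> nat \<Rightarrow> real). (\<forall>j<b. w j \<in> B0) \<and>
    (\<forall>c. (\<forall>i<n. (\<Sum>j<b. c j * w j i) = 0) \<longrightarrow> (\<forall>j<b. c j = 0)) \<and>
    (\<forall>x\<in>B0. \<exists>z. \<forall>i. x i = (\<Sum>j<b. z j * w j i))"
    by (rule maximal_independent) (rule B0n)
  then obtain b :: nat where "\<exists>w :: nat \<Rightarrow> nat \<Rightarrow> real. (\<forall>j<b. w j \<in> B0) \<and>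
    (\<forall>c. (\<forall>i<n. (\<Sum>j<b. c j * w j i) = 0) \<longrightarrow> (\<forall>j<b. c j = 0)) \<and>
    (\<forall>x\<in>B0. \<exists>z. \<forall>i. x i = (\<Sum>j<b. z j * w j i))" ..
  then obtain w :: "nat \<Rightarrow> nat \<Rightarrow> real" where bw': "(\<forall>j<b. w j \<in> B0) \<and>
    (\<forall>c. (\<forall>i<n. (\<Sum>j<b. c j * w j i) = 0) \<longrightarrow> (\<forall>j<b. c j = 0)) \<and>
    (\<forall>x\<in>B0. \<exists>z. \<forall>i. x i = (\<Sum>j<b. z j * w j i))" ..
  have bw: "\<And>j. j < b \<Longrightarrow> w j \<in> B0" "\<And>x. x \<in> B0 \<Longrightarrow> \<exists>z. \<forall>i. x i = (\<Sum>j<b. z j * w j i)"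
    using bw' by blast+
  have bw_ind: "\<forall>j<b. c j = 0" if "\<And>i. i < n \<Longrightarrow> (\<Sum>j<b. c j * w j i) = 0" for c
    using spec[OF conjunct1[OF conjunct2[OF bw']], of c] that by blast
  \<comment> \<open>Maximality covers elements with component 0 only; for the others a multiple has
    component 0, and its coordinates are divided by the factor.\<close>
  have spanB: "\<exists>z. (\<forall>j\<ge>b. z j = 0) \<and> (\<forall>i. x i = (\<Sum>j<b. z j * w j i))" if xf: "(x, f) \<in> B" for x f
  proof -
    obtain d :: nat where d: "d > 0" "((\<lambda>i. real d * x i), 0) \<in> B" using add_subgroup_torsion[OF B xf] by blast
    then obtain z where z: "\<And>i. real d * x i = (\<Sum>j<b. z j * w j i)" using bw(2)[of "\<lambda>i. real d * x i"] unfolding B0_def by auto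
    have "x i = (\<Sum>j<b. (if j < b then z j / real d else 0) * w j i)" for i
    proof -
      have "(\<Sum>j<b. (if j < b then z j / real d else 0) * w j i) = (\<Sum>j<b. z j * w j i) / real d"
        unfolding sum_divide_distrib by (intro sum.cong) auto
      also have "\<dots> = x i" unfolding z[symmetric] using d(1) by simp
      finally show ?thesis ..
    qed
    then show ?thesis by (intro exI[of _ "\<lambda>j. if j < b then z j / real d else 0"]) auto
  qed
  define lc where "lc z i = (\<Sum>j<b. z j * w j i)" for z :: "nat \<Rightarrow> real" and i
  define \<Gamma> where "\<Gamma> = {(z, f). (\<forall>j\<ge>b. z j = 0) \<and> (lc z, f) \<in> B}"
  have lc_inj: "z = z'" if "lc z = lc z'" "\<forall>j\<ge>b. z j = 0" "\<forall>j\<ge>b. z' j = 0" for z z'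
  proof -
    have "(\<Sum>j<b. (z j - z' j) * w j i) = 0" for i
      using fun_cong[OF that(1), of i] unfolding lc_def by (simp add: left_diff_distrib sum_subtractf)
    then have "\<forall>j<b. z j - z' j = 0" by (intro bw_ind)
    then show ?thesis using that(2,3) by (metis ext eq_iff_diff_eq_0 not_le)
  qed
  have \<Gamma>: "disc_group b \<Gamma>" unfolding disc_group_def
  proof (intro conjI allI impI)
    show "add_subgroup \<Gamma>" unfolding add_subgroup_def
    proof (intro conjI allI impI)
      have "lc (\<lambda>_. 0) = (\<lambda>_. 0)" unfolding lc_def by simp
      then show "((\<lambda>_. 0), 0) \<in> \<Gamma>" unfolding \<Gamma>_def using add_subgroupD(1)[OF B] by simp
      fix z f assume z: "(z, f) \<in> \<Gamma>"
      have "lc (\<lambda>i. - z i) = (\<lambda>i. - lc z i)" unfolding lc_def by (simp add: sum_negf)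
      then show "((\<lambda>i. - z i), - f) \<in> \<Gamma>" using z add_subgroupD(3)[OF B, of "lc z" f] unfolding \<Gamma>_def by simp
      fix z' g assume z': "(z', g) \<in> \<Gamma>"
      have "lc (\<lambda>i. z i + z' i) = (\<lambda>i. lc z i + lc z' i)" unfolding lc_def by (simp add: distrib_right sum.distrib)
      then show "((\<lambda>i. z i + z' i), f + g) \<in> \<Gamma>"
        using z z' add_subgroupD(2)[OF B, of "lc z" f "lc z'" g] unfolding \<Gamma>_def by simp
    qed
    show "z j = 0" if "(z, f) \<in> \<Gamma>" "b \<le> j" for z f j using that unfolding \<Gamma>_def by auto
    show "(unit_vec j, 0) \<in> \<Gamma>" if "j < b" for j
    proof -
      have "lc (unit_vec j) = w j"
        unfolding lc_def using that sum_unit_vec[of "{..<b}" "\<lambda>j'. w j' _" j] by (auto simp: mult.commute fun_eq_iff)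
      then show ?thesis using bw(1)[OF that] that unfolding \<Gamma>_def B0_def unit_vec_def by auto
    qed
    fix R :: real
    \<comment> \<open>Coefficients bounded by \<open>R\<close> give vectors bounded by
      \<open>R'\<close>. Thus a bounded part of \<Gamma> injects into bounded parts of
      \<open>B\<close>, which are finite for each component because elements closer than
      \<open>e\<close> differ by a short element of \<open>B0\<close>, hence by 0.\<close>
    define R' where "R' = (\<Sum>i<n. \<Sum>j<b. R * \<bar>w j i\<bar>)"
    have fin: "finite {x. (x, f) \<in> B \<and> (\<forall>i. \<bar>x i\<bar> \<le> \<bar>R'\<bar>)}" for f
    proof (rule bounded_separated_finite[OF e(1)])
      fix x assume x: "x \<in> {x. (x, f) \<in> B \<and> (\<forall>i. \<bar>x i\<bar> \<le> \<bar>R'\<bar>)}"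
      then have "x \<in> E" using AE unfolding B_def by blast
      then show "x i = 0" if "i \<ge> n" for i using that unfolding E_def by blast
      show "\<bar>x i\<bar> \<le> \<bar>R'\<bar>" for i using x by blast
      fix y assume y: "y \<in> {x. (x, f) \<in> B \<and> (\<forall>i. \<bar>x i\<bar> \<le> \<bar>R'\<bar>)}" and c: "\<And>i. \<bar>x i - y i\<bar> < e"
      have "(\<lambda>i. x i - y i) \<in> B0" unfolding B0_def using add_subgroup_diff[OF B, of x f y f] x y by simp
      then have "(\<lambda>i. x i - y i) = (\<lambda>_. 0)" using e(2) c by blast
      then show "x = y" by (metis eq_iff_diff_eq_0 ext)
    qed
    have "(\<lambda>(z, f). (lc z, f)) ` {(z, f) \<in> \<Gamma>. \<forall>j. \<bar>z j\<bar> \<le> R}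
        \<subseteq> (\<Union>f. {x. (x, f) \<in> B \<and> (\<forall>i. \<bar>x i\<bar> \<le> \<bar>R'\<bar>)} \<times> {f})"
    proof clarify
      fix z f assume z: "(z, f) \<in> \<Gamma>" "\<forall>j. \<bar>z j\<bar> \<le> R"
      have zB: "(lc z, f) \<in> B" using z(1) unfolding \<Gamma>_def by blast
      have "\<bar>lc z i\<bar> \<le> \<bar>R'\<bar>" for i
      proof (cases "i < n")
        case True
        have "\<bar>lc z i\<bar> \<le> (\<Sum>j<b. R * \<bar>w j i\<bar>)"
          unfolding lc_def by (rule order_trans[OF sum_abs], rule sum_mono) (use z(2) in \<open>auto simp: abs_mult intro!: mult_right_mono\<close>)
        also have "\<dots> \<le> R'" unfolding R'_def
          using True z(2) by (intro member_le_sum[of _ _ "\<lambda>i. \<Sum>j<b. R * \<bar>w j i\<bar>"])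
            (auto intro!: sum_nonneg mult_nonneg_nonneg intro: order_trans[OF abs_ge_zero])
        finally show ?thesis by linarith
      next
        case False
        have "lc z \<in> E" using zB AE unfolding B_def by blast
        then show ?thesis using False unfolding E_def by auto
      qed
      then show "(lc z, f) \<in> (\<Union>f. {x. (x, f) \<in> B \<and> (\<forall>i. \<bar>x i\<bar> \<le> \<bar>R'\<bar>)} \<times> {f})" using zB by blast
    qed
    moreover have "finite (\<Union>f. {x. (x, f) \<in> B \<and> (\<forall>i. \<bar>x i\<bar> \<le> \<bar>R'\<bar>)} \<times> {f})"
      by (intro finite_UN_I finite_cartesian_product fin) auto
    ultimately have "finite ((\<lambda>(z, f). (lc z, f)) ` {(z, f) \<in> \<Gamma>. \<forall>j. \<bar>z j\<bar> \<le> R})" by (rule finite_subset)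
    moreover have "inj_on (\<lambda>(z, f). (lc z, f)) {(z, f) \<in> \<Gamma>. \<forall>j. \<bar>z j\<bar> \<le> R}"
      unfolding inj_on_def \<Gamma>_def using lc_inj by auto
    ultimately show "finite {(z, f) \<in> \<Gamma>. \<forall>j. \<bar>z j\<bar> \<le> R}" by (rule finite_imageD)
  qed
  define \<theta> where "\<theta> i j = (if i < n \<and> i \<notin> P then if j \<in> P then v j i else if n \<le> j \<and> j < n + b then w (j - n) i else 0 else 0)" for i j
  have \<theta>P: "\<theta> i j = v j i" if "i < n" "i \<notin> P" "j \<in> P" for i j using that unfolding \<theta>_def by simp
  have \<theta>b: "\<theta> i (n + j) = w j i" if "i < n" "i \<notin> P" "j < b" for i j
    using that Pv(1) unfolding \<theta>_def by auto
  have row: "(\<Sum>j\<in>P. \<theta> i j * x j) + (\<Sum>j<b. \<theta> i (n + j) * z j) = (\<Sum>j\<in>P. x j * v j i) + lc z i"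
    if "i < n" "i \<notin> P" for i x z
    unfolding lc_def using that \<theta>P \<theta>b by (intro arg_cong2[where f = "(+)"] sum.cong) auto
  \<comment> \<open>Subtracting this element of the vector space part clears the coordinates in
    \<open>P\<close> and leads from \<open>A\<close> into \<open>B\<close>.\<close>
  have Vx: "((\<lambda>i. \<Sum>p\<in>P. x p * v p i), 0) \<in> A" for x
    by (rule add_subgroup_sum[OF A _ finP]) (use Pv(2) in \<open>auto simp: A0_def\<close>)
  have Vq: "(\<Sum>p\<in>P. x p * v p q) = x q" if "q \<in> P" for x q
  proof -
    have "(\<Sum>p\<in>P. x p * v p q) = (\<Sum>p\<in>P. x p * unit_vec p q)" using Pv(3) that by (intro sum.cong) auto
    then show ?thesis using that finP by (simp add: sum_unit_vec')
  qed
  have latA: "lat P b \<Gamma> \<theta> = A"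
  proof (intro set_eqI iffI)
    fix q assume "q \<in> lat P b \<Gamma> \<theta>"
    then obtain x f z where q: "q = (x, f)" "\<forall>i\<ge>n. x i = 0" "(z, f) \<in> \<Gamma>"
      "\<And>i. i < n \<Longrightarrow> i \<notin> P \<Longrightarrow> x i = (\<Sum>j\<in>P. x j * v j i) + lc z i"
      unfolding lat_def using row by fastforce
    have zB: "(lc z, f) \<in> B" using q(3) unfolding \<Gamma>_def by blast
    have zA: "(lc z, f) \<in> A" using zB unfolding B_def by blast
    have "(\<Sum>p\<in>P. x p * v p i) + lc z i = x i" for i
    proof -
      consider "i \<in> P" | "i < n" "i \<notin> P" | "i \<ge> n" by linarith
      then show ?thesis
      proof cases
        case 1 then show ?thesis using Vq zB unfolding B_def by auto
      next
        case 2 then show ?thesis using q(4) by simp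
      next
        case 3
        have "(\<lambda>i. \<Sum>p\<in>P. x p * v p i) \<in> E" "lc z \<in> E" using AE Vx zA by blast+
        then show ?thesis using 3 q(2) unfolding E_def by auto
      qed
    qed
    then have "(\<lambda>i. (\<Sum>p\<in>P. x p * v p i) + lc z i) = x" by blast
    then show "q \<in> A" using add_subgroupD(2)[OF A Vx[of x] zA] unfolding q(1) by simp
  next
    fix q assume "q \<in> A"
    then obtain x f where q: "q = (x, f)" "(x, f) \<in> A" by (cases q) auto
    have yA: "((\<lambda>i. x i - (\<Sum>p\<in>P. x p * v p i)), f) \<in> A" using add_subgroup_diff[OF A q(2) Vx[of x]] by simp
    then have yB: "((\<lambda>i. x i - (\<Sum>p\<in>P. x p * v p i)), f) \<in> B" unfolding B_def using Vq by auto
    then obtain z where z: "\<forall>j\<ge>b. z j = 0" "\<And>i. x i - (\<Sum>p\<in>P. x p * v p i) = lc z i"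
      using spanB unfolding lc_def by blast
    then have "lc z = (\<lambda>i. x i - (\<Sum>p\<in>P. x p * v p i))" by auto
    then have "(z, f) \<in> \<Gamma>" unfolding \<Gamma>_def using z yB by simp
    moreover have "x i = (\<Sum>j\<in>P. \<theta> i j * x j) + (\<Sum>j<b. \<theta> i (n + j) * z j)" if "i < n" "i \<notin> P" for i
      unfolding row[OF that] using z(2)[of i] by simp
    moreover have "\<forall>i\<ge>n. x i = 0" using AE[OF q(2)] unfolding E_def by blast
    ultimately show "q \<in> lat P b \<Gamma> \<theta>" unfolding lat_def q(1) by blast
  qed
  have Heq: "H = sub_of P b \<Gamma> \<theta>"
  proof (intro set_eqI iffI)
    fix g assume g: "g \<in> H"
    then obtain x where "x \<in> E" "pr x (snd (snd (snd g))) = g" using pr_lift HG(1) by (metis subsetD)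
    then have "(x, snd (snd (snd g))) \<in> A" unfolding A_def using g by simp
    then show "g \<in> sub_of P b \<Gamma> \<theta>" unfolding sub_of_def latA
      using \<open>pr x (snd (snd (snd g))) = g\<close> by (intro image_eqI[of _ _ "(x, snd (snd (snd g)))"]) auto
  qed (auto simp: sub_of_def latA A_def)
  define R where "R t z \<longleftrightarrow> (z, 0) \<in> \<Gamma> \<and>
    (\<forall>i\<in>{..<n} - P. unit_vec t i = (\<Sum>j\<in>P. \<theta> i j * unit_vec t j) + (\<Sum>j<b. \<theta> i (n + j) * z j))" for t z
  have "\<exists>z. R t z" if t: "k \<le> t" "t < k + m" for t
  proof -
    have uE: "unit_vec t \<in> E" unfolding E_def unit_vec_def using t by auto
    \<comment> \<open>The torus unit vectors lie over the identity of the group, so they belong to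
      \<open>A\<close>; \<open>zt t\<close> will be their lattice coordinates.\<close>
    have "pr (unit_vec t) (0::'f) = pr (\<lambda>_. 0) 0"
      unfolding pr_eq_iff[OF uE E0] using t by (auto simp: unit_vec_def)
    then have "(unit_vec t, 0) \<in> A" unfolding A_def using uE HG(3) by (simp add: pr_zero)
    then show ?thesis unfolding latA[symmetric] lat_def R_def by blast
  qed
  then obtain zt where R: "\<And>t. k \<le> t \<Longrightarrow> t < k + m \<Longrightarrow> R t (zt t)" by metis
  have zt: "\<And>t. k \<le> t \<Longrightarrow> t < k + m \<Longrightarrow> (zt t, 0) \<in> \<Gamma>"
    "\<And>t i. k \<le> t \<Longrightarrow> t < k + m \<Longrightarrow> i \<in> {..<n} - P \<Longrightarrow>
      unit_vec t i = (\<Sum>j\<in>P. \<theta> i j * unit_vec t j) + (\<Sum>j<b. \<theta> i (n + j) * zt t j)"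
    using R unfolding R_def by blast+
  have ind: "\<forall>j<b. c j = 0" if "\<forall>i\<in>{..<n} - P. (\<Sum>j<b. c j * w j i) = 0" for c
  proof (rule bw_ind)
    fix i assume "i < n"
    show "(\<Sum>j<b. c j * w j i) = 0"
    proof (cases "i \<in> P")
      case True
      then have "w j i = 0" if "j < b" for j using bw(1)[OF that] unfolding B0eq by blast
      then show ?thesis by simp
    next
      case False then show ?thesis using that \<open>i < n\<close> by blast
    qed
  qed
  have "\<exists>c\<ge>0. \<forall>z. (\<Sum>j<b. \<bar>z j\<bar>) \<le> c * (\<Sum>i\<in>{..<n} - P. \<bar>\<Sum>j<b. z j * w j i\<bar>)"
  proof (rule independent_forms_lower_bound[where S = "{..<n} - P" and b = b and w = w])
    show "\<forall>j<b. c j = 0" if "\<forall>s\<in>{..<n} - P. (\<Sum>j<b. c j * w j s) = 0" for c by (rule ind[OF that])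
  qed auto
  then obtain c where c: "c \<ge> 0" "\<And>z. (\<Sum>j<b. \<bar>z j\<bar>) \<le> c * (\<Sum>i\<in>{..<n} - P. \<bar>\<Sum>j<b. z j * w j i\<bar>)"
    by blast
  have "\<theta> \<in> adm P b \<Gamma> zt c"
    unfolding adm_def
  proof (intro CollectI conjI allI impI)
    show "\<theta> i j = 0" if "\<not> (i < n \<and> i \<notin> P \<and> (j \<in> P \<or> (n \<le> j \<and> j < n + b)))" for i j
      using that unfolding \<theta>_def by auto
    fix z :: "nat \<Rightarrow> real"
    have "(\<Sum>i\<in>{..<n} - P. \<bar>\<Sum>j<b. \<theta> i (n + j) * z j\<bar>) = (\<Sum>i\<in>{..<n} - P. \<bar>\<Sum>j<b. z j * w j i\<bar>)"
      using \<theta>b by (intro sum.cong arg_cong[where f = abs]) auto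
    then show "(\<Sum>j<b. \<bar>z j\<bar>) \<le> c * (\<Sum>i\<in>{..<n} - P. \<bar>\<Sum>j<b. \<theta> i (n + j) * z j\<bar>)" using c(2)[of z] by simp
  next
    show "\<theta> i j = 0" if "k + m \<le> i" "j \<in> P" for i j using vInt[OF that(2,1)] that(2) unfolding \<theta>_def by auto
    show "(\<Sum>j<b. \<theta> i (n + j) * z j) \<in> \<int>" if "k + m \<le> i" "(z, f) \<in> \<Gamma>" for i z f
    proof (cases "i < n")
      case True
      have "i \<notin> P" using Pkm that(1) by auto
      then have "(\<Sum>j<b. \<theta> i (n + j) * z j) = lc z i" unfolding lc_def using \<theta>b True by (intro sum.cong) auto
      moreover have "lc z \<in> E" using that(2) AE unfolding \<Gamma>_def B_def by blast
      ultimately show ?thesis using that(1) unfolding E_def by auto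
    next
      case False then show ?thesis unfolding \<theta>_def by simp
    qed
    show "unit_vec t i = (\<Sum>j\<in>P. \<theta> i j * unit_vec t j) + (\<Sum>j<b. \<theta> i (n + j) * zt t j)"
      if "k \<le> t" "t < k + m" "i \<in> {..<n} - P" for t i using zt(2)[OF that] .
  qed
  then show thesis by (intro that[of P b \<Gamma> zt c \<theta>] Pkm \<Gamma> zt(1) c(1) Heq)
qed

end

section \<open>The dimension of the space of closed subgroups\<close>

text \<open>On a compact set a continuous injection is a homeomorphism onto its image. The transfer
  goes through \<open>ind_le\<close>, whose topological invariance is at hand, whereas
  \<open>dec_le\<close> speaks of subsets of a given space.\<close>

lemma dec_le_compact_image:
  fixes f :: "'a::{metric_space,second_countable_topology} \<Rightarrow> 'b::{metric_space,second_countable_topology}"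
  assumes "compact K" "continuous_on K f" "inj_on f K"
  shows "dec_le n (f ` K) \<longleftrightarrow> dec_le n K"
proof -
  have "homeomorphic_map (top_of_set K) (top_of_set (f ` K)) f"
  proof (rule continuous_imp_homeomorphic_map)
    show "compact_space (top_of_set K)" using assms(1) by (simp add: compact_space_subtopology)
    show "Hausdorff_space (top_of_set (f ` K))" by (simp add: Hausdorff_space_subtopology)
    show "continuous_map (top_of_set K) (top_of_set (f ` K)) f" using assms(2) by (simp add: continuous_map_in_subtopology)
  qed (use assms(3) in simp_all)
  then have "top_of_set K homeomorphic_space top_of_set (f ` K)" by (rule homeomorphic_map_imp_homeomorphic_space)
  note hom = this this[unfolded homeomorphic_space_sym[of "top_of_set K"]]
  show ?thesis
  proof
    assume "dec_le n (f ` K)"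
    then show "dec_le n K" by (rule ind_le_imp_dec[OF ind_le_homeomorphic[OF hom(2) dec_imp_ind_le]])
  next
    assume "dec_le n K"
    then show "dec_le n (f ` K)" by (rule ind_le_imp_dec[OF ind_le_homeomorphic[OF hom(1) dec_imp_ind_le]])
  qed
qed

text \<open>Finitely many entries that separate the points of a compact set embed it into a
  Euclidean space.\<close>

lemma dec_le_coordinates:
  fixes K :: "(nat \<Rightarrow> nat \<Rightarrow> real) set"
  assumes "compact K" "finite I" "card I \<le> N"
    "\<And>\<theta> \<theta>'. \<theta> \<in> K \<Longrightarrow> \<theta>' \<in> K \<Longrightarrow> (\<And>i j. (i, j) \<in> I \<Longrightarrow> \<theta> i j = \<theta>' i j) \<Longrightarrow> \<theta> = \<theta>'"
  shows "dec_le (Suc N) K"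
proof -
  obtain h where h: "bij_betw h {0..<card I} I" using ex_bij_betw_nat_finite[OF assms(2)] by blast
  define \<rho> where "\<rho> \<theta> r = (if r < card I then \<theta> (fst (h r)) (snd (h r)) else 0)" for \<theta> :: "nat \<Rightarrow> nat \<Rightarrow> real" and r
  have "continuous_on K (\<lambda>\<theta>. \<rho> \<theta> r)" for r
    unfolding \<rho>_def using continuous_on_subset[OF continuous_on_coord2 subset_UNIV]
    by (cases "r < card I") auto
  then have cont: "continuous_on K \<rho>" by (rule continuous_on_coordinatewise_then_product)
  have inj: "inj_on \<rho> K"
  proof (rule inj_onI, rule assms(4))
    fix \<theta> \<theta>' i j assume "\<rho> \<theta> = \<rho> \<theta>'" "(i, j) \<in> I"
    moreover then obtain r where "r < card I" "h r = (i, j)" using h unfolding bij_betw_def by force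
    ultimately show "\<theta> i j = \<theta>' i j" using fun_cong[of "\<rho> \<theta>" "\<rho> \<theta>'" r] unfolding \<rho>_def by simp
  qed
  have "\<rho> ` K \<subseteq> {x. \<forall>i\<ge>card I. x i = 0}" unfolding \<rho>_def by auto
  then have "dec_le (Suc (card I)) (\<rho> ` K)" using dec_le_subset[OF dec_le_Euclidean] by blast
  then have "dec_le (Suc (card I)) K" using dec_le_compact_image[OF assms(1) cont inj] by blast
  then show ?thesis using dec_le_mono assms(3) by (metis Suc_le_mono)
qed

section \<open>Counting the free parameters\<close>

context lat_data
begin

text \<open>Entries in rows of integral coordinates are zero or integral, so matrices that differ by
  less than 1 agree there. In the other rows the kernel equations for torus directions t outside
  \<open>P\<close> determine the lattice columns in \<open>U\<close>, and those for t in
  \<open>P\<close> determine the columns common to \<open>P\<close> and \<open>T\<close>. What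
  remains are the columns \<open>J\<close>, of number at most |P| + b - m \<le> n - m = k + l, in at
  most k + m rows. The matrix \<theta>0 supplies |P| + b \<le> n and the independence of the kernel
  vectors.\<close>

lemma free_coordinates:
  assumes \<theta>0: "\<theta>0 \<in> A"
  obtains I where "finite I" "card I \<le> (k + l) * (k + m)"
    "\<And>\<theta> \<theta>'. \<theta> \<in> A \<Longrightarrow> \<theta>' \<in> A \<Longrightarrow> \<forall>(i, j)\<in>I. \<theta> i j = \<theta>' i j \<Longrightarrow>
      \<forall>i<n. \<forall>j<n + b. \<bar>\<theta> i j - \<theta>' i j\<bar> < 1 \<Longrightarrow> \<theta> = \<theta>'"
proof -
  have "b \<le> card ({..<n} - P)"
  proof (rule independent_forms_card[where w = "\<lambda>j i. \<theta>0 i (n + j)"])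
    fix c assume "\<forall>s\<in>{..<n} - P. (\<Sum>j<b. c j * \<theta>0 s (n + j)) = 0"
    then have "(\<Sum>i\<in>{..<n} - P. \<bar>\<Sum>j<b. \<theta>0 i (n + j) * c j\<bar>) = 0" by (intro sum.neutral) (auto simp: mult.commute)
    then have "(\<Sum>j<b. \<bar>c j\<bar>) \<le> 0" using admD(2)[OF \<theta>0, of c] by simp
    then have "(\<Sum>j<b. \<bar>c j\<bar>) = 0" by (simp add: sum_nonneg order.antisym)
    then show "\<forall>j<b. c j = 0" by (simp add: sum_nonneg_eq_0_iff)
  qed simp
  moreover have "card ({..<n} - P) = n - card P" using P finP by (subst card_Diff_subset) auto
  moreover have "card P \<le> n" using card_mono[OF _ P] by simp
  ultimately have bP: "b + card P \<le> n" by linarith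
  define T where "T = {k..<k + m}"
  have finT: "finite T" and cardT: "card T = m" unfolding T_def by auto
  obtain h where h: "bij_betw h {0..<card (T - P)} (T - P)" using ex_bij_betw_nat_finite[of "T - P"] finT by blast
  have hT: "h j \<in> T" "h j \<notin> P" if "j < card (T - P)" for j using h that unfolding bij_betw_def by auto
  have ztrow: "(\<Sum>s<b. \<theta> i (n + s) * zt t s) = unit_vec t i"
    if "\<theta> \<in> A" "t \<in> T" "t \<notin> P" "i < n" "i \<notin> P" for \<theta> t i
  proof -
    have "(\<Sum>j\<in>P. \<theta> i j * unit_vec t j) = 0" using that(3) finP by (simp add: sum_unit_vec)
    then show ?thesis using admD(5)[OF that(1), of t i] that unfolding T_def by auto
  qed
  have "\<exists>U\<subseteq>{..<b}. card U = card (T - P) \<and>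
     (\<forall>u. (\<forall>j<card (T - P). (\<Sum>s\<in>U. u s * zt (h j) s) = 0) \<longrightarrow> (\<forall>s\<in>U. u s = 0))"
  proof (rule independent_forms_pivots[where w = "\<lambda>j s. zt (h j) s"])
    fix c assume c: "\<forall>s\<in>{..<b}. (\<Sum>j<card (T - P). c j * zt (h j) s) = 0"
    show "\<forall>j<card (T - P). c j = 0"
    proof (intro allI impI)
      fix r assume r: "r < card (T - P)"
      have hr: "h r < n" "h r \<notin> P" using hT[OF r] unfolding T_def by auto
      \<comment> \<open>Applying \<theta>0 to the kernel vectors recovers unit vectors, so a
        vanishing combination of the \<open>zt (h j)\<close> has vanishing coefficients.\<close>
      have "(\<Sum>j<card (T - P). c j * unit_vec (h j) (h r)) = (\<Sum>j<card (T - P). c j * (\<Sum>s<b. \<theta>0 (h r) (n + s) * zt (h j) s))"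
        by (intro sum.cong refl arg_cong2[where f = "(*)"] ztrow[OF \<theta>0 _ _ hr, symmetric]) (auto simp: hT)
      also have "\<dots> = (\<Sum>s<b. \<theta>0 (h r) (n + s) * (\<Sum>j<card (T - P). c j * zt (h j) s))"
        unfolding sum_distrib_left by (subst sum.swap) (simp add: ac_simps)
      also have "\<dots> = 0" using c by simp
      finally have "(\<Sum>j<card (T - P). c j * unit_vec (h j) (h r)) = 0" .
      moreover have "unit_vec (h j) (h r) = unit_vec r j" if "j < card (T - P)" for j
        using h r that unfolding bij_betw_def inj_on_def unit_vec_def by auto
      ultimately have "(\<Sum>j<card (T - P). c j * unit_vec r j) = 0" by simp
      then show "c r = 0" using r by (simp add: sum_unit_vec)
    qed
  qed simp
  then obtain U where U: "U \<subseteq> {..<b}" "card U = card (T - P)"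
    "\<And>u. (\<forall>j<card (T - P). (\<Sum>s\<in>U. u s * zt (h j) s) = 0) \<Longrightarrow> (\<forall>s\<in>U. u s = 0)" by blast
  define J where "J = (P - T) \<union> (+) n ` ({..<b} - U)"
  define I where "I = ({..<k + m} - P) \<times> J"
  have finJ: "finite J" unfolding J_def using finP by auto
  have "card J \<le> card (P - T) + card ((+) n ` ({..<b} - U))" unfolding J_def by (rule card_Un_le)
  also have "\<dots> \<le> card (P - T) + card ({..<b} - U)" by (simp add: card_image_le)
  also have "card ({..<b} - U) = b - card (T - P)" using U by (subst card_Diff_subset) (auto intro: finite_subset)
  finally have "card J \<le> card (P - T) + (b - card (T - P))" .
  moreover have "card U \<le> b" using card_mono[OF _ U(1)] by simp
  moreover have "card P = card (P - T) + card (P \<inter> T)"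
    using card_Diff_subset_Int[of P T] finP card_mono[of P "P \<inter> T"] by simp
  moreover have "m = card (T - P) + card (P \<inter> T)"
    using card_Diff_subset_Int[of T P] finP finT card_mono[of T "T \<inter> P"] cardT by (simp add: Int_commute)
  ultimately have "card J \<le> k + l" using bP U(2) by linarith
  then have "card I \<le> (k + m) * (k + l)"
    unfolding I_def card_cartesian_product by (intro mult_mono card_mono[of "{..<k+m}", simplified]) auto
  moreover have "finite I" unfolding I_def using finJ by simp
  moreover have "\<theta> = \<theta>'" if \<theta>: "\<theta> \<in> A" "\<theta>' \<in> A" and eq: "\<forall>(i, j)\<in>I. \<theta> i j = \<theta>' i j"
    and close: "\<forall>i<n. \<forall>j<n + b. \<bar>\<theta> i j - \<theta>' i j\<bar> < 1" for \<theta> \<theta>'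
  proof -
    have intb: "\<theta> i (n + j) \<in> \<int>" if "\<theta> \<in> A" "k + m \<le> i" "j < b" for \<theta> i j
      using admD(4)[OF that(1,2) disc_groupD(3)[OF \<Gamma> that(3)]] that(3) by (simp add: sum_unit_vec)
    have b_eq: "\<theta> i (n + j) = \<theta>' i (n + j)" if i: "i < n" "i \<notin> P" and j: "j < b" for i j
    proof (cases "k + m \<le> i")
      case True
      obtain y z where "\<theta> i (n + j) = of_int y" "\<theta>' i (n + j) = of_int z"
        using intb[OF \<theta>(1) True j] intb[OF \<theta>(2) True j] by (auto elim!: Ints_cases)
      moreover have "\<bar>\<theta> i (n + j) - \<theta>' i (n + j)\<bar> < 1" using close i(1) j by auto
      ultimately show ?thesis by (simp add: abs_less_iff)
    next
      case False
      \<comment> \<open>In row \<open>i\<close> both matrices satisfy the same kernel equations, so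
        the difference \<open>u\<close> solves the homogeneous ones; it vanishes off
        \<open>U\<close> by assumption and on \<open>U\<close> because these columns are
        pivots.\<close>
      define u where "u s = \<theta> i (n + s) - \<theta>' i (n + s)" for s
      have u0: "u s = 0" if "s < b" "s \<notin> U" for s
        using eq False i that unfolding u_def I_def J_def by auto
      have "(\<Sum>s\<in>U. u s * zt (h r) s) = 0" if r: "r < card (T - P)" for r
      proof -
        have "(\<Sum>s\<in>U. u s * zt (h r) s) = (\<Sum>s<b. u s * zt (h r) s)"
          using U(1) u0 by (intro sum.mono_neutral_left) auto
        also have "\<dots> = (\<Sum>s<b. \<theta> i (n + s) * zt (h r) s) - (\<Sum>s<b. \<theta>' i (n + s) * zt (h r) s)"
          unfolding u_def by (simp add: left_diff_distrib sum_subtractf)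
        also have "\<dots> = 0" using ztrow[OF \<theta>(1) hT[OF r] i] ztrow[OF \<theta>(2) hT[OF r] i] by simp
        finally show ?thesis .
      qed
      then have "\<forall>s\<in>U. u s = 0" using U(3) by blast
      then have "u j = 0" using u0 j by blast
      then show ?thesis unfolding u_def by simp
    qed
    have P_eq: "\<theta> i p = \<theta>' i p" if i: "i < n" "i \<notin> P" and p: "p \<in> P" for i p
    proof -
      consider "k + m \<le> i" | "i < k + m" "p \<notin> T" | "p \<in> T" by linarith
      then show ?thesis
      proof cases
        case 1 then show ?thesis using admD(3)[OF \<theta>(1) _ p] admD(3)[OF \<theta>(2) _ p] by simp
      next
        case 2 then show ?thesis using eq i p unfolding I_def J_def by auto
      next
        case 3
        have "unit_vec p i = \<eta> i p + (\<Sum>s<b. \<eta> i (n + s) * zt p s)" if "\<eta> \<in> A" for \<eta>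
          using admD(5)[OF that, of p i] 3 i p finP unfolding T_def by (simp add: sum_unit_vec)
        from this[OF \<theta>(1)] this[OF \<theta>(2)]
        have "\<theta> i p + (\<Sum>s<b. \<theta> i (n + s) * zt p s) = \<theta>' i p + (\<Sum>s<b. \<theta>' i (n + s) * zt p s)" by simp
        moreover have "(\<Sum>s<b. \<theta> i (n + s) * zt p s) = (\<Sum>s<b. \<theta>' i (n + s) * zt p s)"
          using b_eq[OF i] by (intro sum.cong) auto
        ultimately show ?thesis by simp
      qed
    qed
    show ?thesis
    proof (intro ext)
      fix i j
      show "\<theta> i j = \<theta>' i j"
      proof (cases "i < n \<and> i \<notin> P \<and> (j \<in> P \<or> (n \<le> j \<and> j < n + b))")
        case True
        then show ?thesis using b_eq[of i "j - n"] P_eq[of i j] by auto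
      next
        case False then show ?thesis using admD(1)[OF \<theta>(1) False] admD(1)[OF \<theta>(2) False] by simp
      qed
    qed
  qed
  ultimately show thesis by (intro that[of I]) (simp_all add: mult.commute)
qed

text \<open>Closed boxes about a countable dense set of centres cover all admissible matrices.
  Within a box the admissible matrices form a compact set, on which \<open>Th\<close> is injective
  once \<epsilon> is small.\<close>

definition piece :: "(nat \<Rightarrow> nat \<Rightarrow> real) \<Rightarrow> real \<Rightarrow> (nat \<Rightarrow> nat \<Rightarrow> real) set" where
  "piece q \<epsilon> = {\<theta> \<in> A. \<forall>i<n. \<forall>j<n + b. \<bar>\<theta> i j - q i j\<bar> \<le> \<epsilon>}"

lemma compact_piece: "compact (piece q \<epsilon>)"
proof -
  define lo hi where "lo i j = (if i < n \<and> j < n + b then q i j - \<epsilon> else 0)"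
    and "hi i j = (if i < n \<and> j < n + b then q i j + \<epsilon> else 0)" for i j
  \<comment> \<open>Entries outside the index range of the box vanish for admissible matrices, so
    bounding the finitely many others makes the piece compact.\<close>
  have "j < n + b" if "j \<in> P" for j using that P by force
  then have "\<theta> i j = 0" if "\<theta> \<in> A" "\<not> (i < n \<and> j < n + b)" for \<theta> i j
    using admD(1)[OF that(1), of i j] that(2) by blast
  note out = this
  have H: "lo i j \<le> \<theta> i j \<and> \<theta> i j \<le> hi i j \<longleftrightarrow> (i < n \<longrightarrow> j < n + b \<longrightarrow> \<bar>\<theta> i j - q i j\<bar> \<le> \<epsilon>)" if "\<theta> \<in> A" for \<theta> i j
  proof (cases "i < n \<and> j < n + b")
    case True then show ?thesis unfolding lo_def hi_def by (auto simp: abs_le_iff)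
  next
    case False then show ?thesis using out[OF that False] unfolding lo_def hi_def by auto
  qed
  have eq: "piece q \<epsilon> = {\<theta>. \<forall>i j. lo i j \<le> \<theta> i j \<and> \<theta> i j \<le> hi i j} \<inter> A"
  proof (intro set_eqI)
    fix \<theta> show "\<theta> \<in> piece q \<epsilon> \<longleftrightarrow> \<theta> \<in> {\<theta>. \<forall>i j. lo i j \<le> \<theta> i j \<and> \<theta> i j \<le> hi i j} \<inter> A"
      by (cases "\<theta> \<in> A") (simp_all add: piece_def H)
  qed
  show ?thesis unfolding eq by (rule compact_Int_closed[OF compact_box2 closed_adm])
qed

lemma piece_close:
  assumes "\<theta> \<in> piece q \<epsilon>" "\<theta>' \<in> piece q \<epsilon>" "i < n" "j < n + b"
  shows "\<bar>\<theta> i j - \<theta>' i j\<bar> \<le> 2 * \<epsilon>"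
proof -
  have "\<bar>\<theta> i j - q i j\<bar> \<le> \<epsilon>" "\<bar>\<theta>' i j - q i j\<bar> \<le> \<epsilon>" using assms unfolding piece_def by auto
  then show ?thesis by linarith
qed

lemma piece_dimension:
  assumes "2 * \<epsilon> < 1"
  shows "dec_le (Suc ((k + l) * (k + m))) (piece q \<epsilon>)"
\<comment> \<open>An empty piece is treated apart, since \<open>free_coordinates\<close> starts from
  an admissible matrix.\<close>
proof (cases "piece q \<epsilon> = {}")
  case True
  show ?thesis unfolding True by (rule dec_le_mono[of 0]) simp_all
next
  case False
  then obtain \<theta>0 where "\<theta>0 \<in> A" unfolding piece_def by blast
  then obtain I where I: "finite I" "card I \<le> (k + l) * (k + m)"
    "\<And>\<theta> \<theta>'. \<theta> \<in> A \<Longrightarrow> \<theta>' \<in> A \<Longrightarrow> \<forall>(i, j)\<in>I. \<theta> i j = \<theta>' i j \<Longrightarrow> \<forall>i<n. \<forall>j<n + b. \<bar>\<theta> i j - \<theta>' i j\<bar> < 1 \<Longrightarrow> \<theta> = \<theta>'"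
    by (rule free_coordinates) (rule that)
  show ?thesis
  proof (rule dec_le_coordinates[OF compact_piece I(1,2)])
    fix \<theta> \<theta>' assume t: "\<theta> \<in> piece q \<epsilon>" "\<theta>' \<in> piece q \<epsilon>" "\<And>i j. (i, j) \<in> I \<Longrightarrow> \<theta> i j = \<theta>' i j"
    show "\<theta> = \<theta>'"
      by (rule I(3)) (use t piece_close[OF t(1,2)] assms in \<open>force simp: piece_def\<close>)+
  qed
qed

text \<open>Two members of a piece differ by at most 2\<epsilon> per entry; summed over at most n
  rows and multiplied by \<open>c\<close> this stays below the gap \<gamma>.\<close>

lemma piece_injective:
  assumes "\<gamma> > 0" "\<And>z. (z, 0) \<in> \<Gamma> \<Longrightarrow> (\<Sum>j<b. \<bar>z j\<bar>) < \<gamma> \<Longrightarrow> \<forall>j<b. z j = 0" "\<epsilon> \<ge> 0" "c * (real n * (2 * \<epsilon>)) < \<gamma>"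
  shows "inj_on Th (piece q \<epsilon>)"
proof (rule inj_onI)
  fix \<theta> \<theta>' assume t: "\<theta> \<in> piece q \<epsilon>" "\<theta>' \<in> piece q \<epsilon>" "Th \<theta> = Th \<theta>'"
  have A: "\<theta> \<in> A" "\<theta>' \<in> A" using t unfolding piece_def by auto
  show "\<theta> = \<theta>'"
  proof (rule Th_locally_injective[OF A t(3) assms(1,2)])
    fix j assume "j < b"
    have "(\<Sum>i\<in>{..<n} - P. \<bar>\<theta> i (n + j) - \<theta>' i (n + j)\<bar>) \<le> (\<Sum>i\<in>{..<n} - P. 2 * \<epsilon>)"
      using piece_close[OF t(1,2)] \<open>j < b\<close> by (intro sum_mono) auto
    also have "\<dots> \<le> (\<Sum>i\<in>{..<n}. 2 * \<epsilon>)" using assms(3) by (intro sum_mono2) auto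
    also have "\<dots> = real n * (2 * \<epsilon>)" by simp
    finally have "c * (\<Sum>i\<in>{..<n} - P. \<bar>\<theta> i (n + j) - \<theta>' i (n + j)\<bar>) \<le> c * (real n * (2 * \<epsilon>))"
      using c by (rule mult_left_mono)
    then show "c * (\<Sum>i\<in>{..<n} - P. \<bar>\<theta> i (n + j) - \<theta>' i (n + j)\<bar>) < \<gamma>" using assms(4) by linarith
  qed
qed

end


text \<open>Countably many compact pieces, each parametrised by at most \<open>(k + l) * (k + m)\<close> real coordinates, cover the space.\<close>

lemma (in params) SG_dimension_le:
  fixes S :: "(nat \<Rightarrow> real) set" and h
  assumes h: "homeomorphic_map (SG k l m :: 'f::{finite,ab_group_add} Gelem set topology) (top_of_set S) h"
  shows "dec_le (Suc ((k + l) * (k + m))) S"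
proof -
  let ?X = "SG k l m :: 'f Gelem set topology"
  let ?T = "{k..<k + m}"
  obtain D :: "(nat \<Rightarrow> nat \<Rightarrow> real) set" where D: "countable D" "\<And>X. open X \<Longrightarrow> X \<noteq> {} \<Longrightarrow> \<exists>d\<in>D. d \<in> X"
    using countable_dense_exists by blast
  \<comment> \<open>The conditions on the mesh 1/(s + 1) are those of
    \<open>piece_injective\<close>, with the natural number \<open>r\<close> as constant
    \<open>c\<close>, and that of \<open>piece_dimension\<close>.\<close>
  define good where "good P b \<Gamma> zt r s \<longleftrightarrow> lat_data k m P b \<Gamma> zt (real r) \<and>
     (\<exists>\<gamma>>0. (\<forall>z. (z, 0) \<in> \<Gamma> \<longrightarrow> (\<Sum>j<b. \<bar>z j\<bar>) < \<gamma> \<longrightarrow> (\<forall>j<b. z j = 0)) \<and> real r * (real n * (2 * (1 / real (Suc s)))) < \<gamma>) \<and>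
     2 * (1 / real (Suc s)) < 1"
    for P b and \<Gamma> :: "((nat \<Rightarrow> real) \<times> 'f) set" and zt and r s :: nat
  define pc where "pc P b \<Gamma> zt r s q = (if good P b \<Gamma> zt r s
      then h ` sub_of P b \<Gamma> ` lat_data.piece k l m P b \<Gamma> zt (real r) q (1 / real (Suc s)) else {})"
    for P b and \<Gamma> :: "((nat \<Rightarrow> real) \<times> 'f) set" and zt and r s :: nat and q
  \<comment> \<open>Every index ranges over a countable set: \<open>P\<close> over a finite one,
    \<open>b\<close>, \<open>r\<close>, \<open>s\<close> over the naturals, \<Gamma> over the
    discrete groups, \<open>zt\<close> over functions from the finitely many torus indices to a
    countable set, and the centres over \<open>D\<close>.\<close>
  define \<F> where "\<F> = (\<Union>P\<in>Pow {..<k + m}. \<Union>b. \<Union>\<Gamma>\<in>{\<Gamma>. disc_group b \<Gamma>}. \<Union>zt\<in>(?T \<rightarrow>\<^sub>E fst ` \<Gamma>). \<Union>r. \<Union>s. pc P b \<Gamma> zt r s ` D)"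
  have "countable \<F>"
    unfolding \<F>_def
    by (intro countable_UN countable_PiE countable_image D(1) countable_disc_groups)
       (auto intro: countable_finite disc_group_countable)
  moreover have pc: "compact (pc P b \<Gamma> zt r s q) \<and> pc P b \<Gamma> zt r s q \<subseteq> S \<and> dec_le (Suc ((k + l) * (k + m))) (pc P b \<Gamma> zt r s q)"
    for P b \<Gamma> zt r s q
  proof (cases "good P b \<Gamma> zt r s")
    case False
    have "dec_le (Suc ((k + l) * (k + m))) ({} :: (nat \<Rightarrow> real) set)" by (rule dec_le_mono[of 0]) simp_all
    then show ?thesis using False unfolding pc_def by simp
  next
    case True
    then interpret lat_data k l m P b \<Gamma> zt "real r" unfolding good_def by blast
    let ?K = "piece q (1 / real (Suc s))"
    have KA: "?K \<subseteq> A" unfolding piece_def by blast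
    obtain \<gamma> where \<gamma>: "\<gamma> > 0" "\<And>z. (z, 0) \<in> \<Gamma> \<Longrightarrow> (\<Sum>j<b. \<bar>z j\<bar>) < \<gamma> \<Longrightarrow> (\<forall>j<b. z j = 0)"
      "real r * (real n * (2 * (1 / real (Suc s)))) < \<gamma>" and s1: "2 * (1 / real (Suc s)) < 1"
      using True unfolding good_def by blast
    have inj: "inj_on Th ?K" by (rule piece_injective[OF \<gamma>(1,2) _ \<gamma>(3)]) auto
    have contTh: "continuous_map (top_of_set ?K) ?X Th" by (rule Th_continuous[OF compact_piece KA])
    have ThX: "Th ` ?K \<subseteq> topspace ?X" using contTh by (auto simp: continuous_map_def)
    have "continuous_map (top_of_set ?K) (top_of_set S) (h \<circ> Th)"
      by (rule continuous_map_compose[OF contTh homeomorphic_imp_continuous_map[OF h]])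
    then have cont: "continuous_on ?K (h \<circ> Th)" by (simp add: continuous_map_in_subtopology)
    have "inj_on h (topspace ?X)" using homeomorphic_imp_injective_map[OF h] .
    then have injh: "inj_on (h \<circ> Th) ?K" using inj ThX by (meson comp_inj_on inj_on_subset)
    have e: "pc P b \<Gamma> zt r s q = (h \<circ> Th) ` ?K" unfolding pc_def using True by (simp add: image_comp)
    show ?thesis unfolding e
    proof (intro conjI)
      show "compact ((h \<circ> Th) ` ?K)" by (rule compact_continuous_image[OF cont compact_piece])
      show "(h \<circ> Th) ` ?K \<subseteq> S" using ThX homeomorphic_imp_surjective_map[OF h] by auto
      show "dec_le (Suc ((k + l) * (k + m))) ((h \<circ> Th) ` ?K)"
        using dec_le_compact_image[OF compact_piece cont injh] piece_dimension[OF s1] by blast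
    qed
  qed
  have sub: "F \<subseteq> S" and cF: "compact F" and dF: "dec_le (Suc ((k + l) * (k + m))) F" if F: "F \<in> \<F>" for F
  proof -
    obtain P b \<Gamma> zt r s q where "F = pc P b \<Gamma> zt r s q" using F unfolding \<F>_def by blast
    then show "F \<subseteq> S" "compact F" "dec_le (Suc ((k + l) * (k + m))) F" using pc by blast+
  qed
  have "S \<subseteq> \<Union>\<F>"
  proof
    fix y assume "y \<in> S"
    then obtain H where H: "H \<in> topspace ?X" "y = h H" using homeomorphic_imp_surjective_map[OF h] by auto
    then have HC: "H \<in> closed_subgroups k l m" unfolding SG_def by auto
    obtain P b \<Gamma> zt0 c \<theta> where d: "P \<subseteq> {..<k + m}" "disc_group b \<Gamma>"
      "\<And>t. k \<le> t \<Longrightarrow> t < k + m \<Longrightarrow> (zt0 t, 0) \<in> \<Gamma>" "c \<ge> 0" "\<theta> \<in> adm P b \<Gamma> zt0 c" "H = sub_of P b \<Gamma> \<theta>"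
      by (fact closed_subgroup_eq_sub_of[OF HC])
    \<comment> \<open>Restricting to the torus indices places the choice in the countable set of
      extensional functions.\<close>
    define zt where "zt = restrict zt0 ?T"
    obtain r :: nat where r: "c \<le> real r" using real_arch_simple by blast
    have zt: "(zt t, 0) \<in> \<Gamma>" if "k \<le> t" "t < k + m" for t using d(3)[OF that] that unfolding zt_def by simp
    have L: "lat_data k m P b \<Gamma> zt (real r)"
      by unfold_locales (use d zt in auto)
    interpret lat_data k l m P b \<Gamma> zt "real r" by (rule L)
    have \<theta>A: "\<theta> \<in> A"
    proof -
      have "(\<Sum>j<b. \<bar>z j\<bar>) \<le> real r * (\<Sum>i\<in>{..<n} - P. \<bar>\<Sum>j<b. \<theta> i (n + j) * z j\<bar>)" for z
      proof -
        have "(\<Sum>j<b. \<bar>z j\<bar>) \<le> c * (\<Sum>i\<in>{..<n} - P. \<bar>\<Sum>j<b. \<theta> i (n + j) * z j\<bar>)"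
          using d(5) unfolding adm_def by blast
        also have "\<dots> \<le> real r * (\<Sum>i\<in>{..<n} - P. \<bar>\<Sum>j<b. \<theta> i (n + j) * z j\<bar>)"
          by (rule mult_right_mono[OF r]) (auto intro: sum_nonneg)
        finally show ?thesis .
      qed
      moreover have "zt t = zt0 t" if "k \<le> t" "t < k + m" for t using that unfolding zt_def by simp
      ultimately show ?thesis using d(5) unfolding adm_def by simp
    qed
    obtain \<gamma> where \<gamma>: "\<gamma> > 0" "\<And>z. (z, 0) \<in> \<Gamma> \<Longrightarrow> (\<Sum>j<b. \<bar>z j\<bar>) < \<gamma> \<Longrightarrow> \<forall>j<b. z j = 0"
      using disc_group_gap[OF d(2)] by blast
    \<comment> \<open>\<open>M\<close> times the mesh is the sum of the two quantities that
      \<open>good\<close> bounds; both are nonnegative, so it suffices to keep the sum below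
      \<open>min \<gamma> 1\<close>.\<close>
    define M where "M = real r * (real n * 2) + 2"
    have M: "M > 0" unfolding M_def by (intro add_nonneg_pos mult_nonneg_nonneg) auto
    obtain s where s: "1 / real (Suc s) < min \<gamma> 1 / M" using nat_approx_posE[of "min \<gamma> 1 / M"] M \<gamma>(1) by auto
    have "M * (1 / real (Suc s)) < min \<gamma> 1" using s M by (simp add: field_simps)
    moreover have "M * (1 / real (Suc s)) = real r * (real n * (2 * (1 / real (Suc s)))) + 2 * (1 / real (Suc s))"
      unfolding M_def by (simp add: algebra_simps add_divide_distrib)
    moreover have "0 \<le> real r * (real n * (2 * (1 / real (Suc s))))" "0 \<le> 2 * (1 / real (Suc s))" by simp_all
    ultimately have "real r * (real n * (2 * (1 / real (Suc s)))) < \<gamma>" "2 * (1 / real (Suc s)) < 1" by linarith+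
    then have good: "good P b \<Gamma> zt r s" unfolding good_def using L \<gamma> by blast
    define W where "W = (\<Inter>i\<in>{..<n}. \<Inter>j\<in>{..<n + b}. {q :: nat \<Rightarrow> nat \<Rightarrow> real. \<bar>\<theta> i j - q i j\<bar> < 1 / real (Suc s)})"
    have "open W" unfolding W_def
      by (intro open_INT ballI finite_lessThan open_Collect_less continuous_intros continuous_on_coord2)
    moreover have "\<theta> \<in> W" unfolding W_def by simp
    ultimately obtain q where q: "q \<in> D" "q \<in> W" using D(2)[of W] by blast
    then have "\<forall>i<n. \<forall>j<n + b. \<bar>\<theta> i j - q i j\<bar> \<le> 1 / real (Suc s)"
      unfolding W_def by (auto simp del: of_nat_Suc intro: less_imp_le)
    then have "\<theta> \<in> piece q (1 / real (Suc s))" unfolding piece_def using \<theta>A by blast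
    then have "h (sub_of P b \<Gamma> \<theta>) \<in> pc P b \<Gamma> zt r s q"
      unfolding pc_def if_P[OF good] by (intro imageI)
    then have y: "y \<in> pc P b \<Gamma> zt r s q" unfolding H(2) d(6) .
    have "zt t \<in> fst ` \<Gamma>" if "t \<in> ?T" for t using zt[of t] that by (force intro: image_eqI[of _ _ "(zt t, 0)"])
    then have "zt \<in> (?T \<rightarrow>\<^sub>E fst ` \<Gamma>)" unfolding zt_def by (intro PiE_I) auto
    then have "pc P b \<Gamma> zt r s q \<in> \<F>" unfolding \<F>_def
      by (intro UN_I[of P] UN_I[of b] UN_I[of \<Gamma>] UN_I[of zt] UN_I[of r] UN_I[of s]) (use d(1,2) q(1) in auto)
    then show "y \<in> \<Union>\<F>" using y by blast
  qed
  then have SF: "\<Union>\<F> = S" using sub by blast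
  have "dec_le (Suc ((k + l) * (k + m))) (\<Union>\<F>)"
  proof (rule dec_le_countable_closed_Union_set[OF \<open>countable \<F>\<close> _ dF])
    fix F assume F: "F \<in> \<F>"
    then have "F = S \<inter> F" "closed F" using sub cF compact_imp_closed by blast+
    then show "closedin (top_of_set (\<Union>\<F>)) F" unfolding SF closedin_closed by blast
  qed
  then show ?thesis unfolding SF .
qed

section \<open>A cube in the space of closed subgroups\<close>

lemma Euclidean_space_eq_top_of_set: "Euclidean_space N = top_of_set {x. \<forall>i\<ge>N. x i = 0}"
  unfolding Euclidean_space_def by (simp add: euclidean_product_topology)

text \<open>Coordinatewise this is the logit function ln x - ln (1 - x), with the logistic function
  as inverse.\<close>

lemma open_cube_homeomorphic_Euclidean_space:
  "top_of_set {x \<in> unit_cube N. \<forall>i<N. 0 < x i \<and> x i < 1} homeomorphic_space Euclidean_space N"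
proof -
  let ?O = "{x \<in> unit_cube N. \<forall>i<N. 0 < x i \<and> x i < 1}" and ?E = "{x :: nat \<Rightarrow> real. \<forall>i\<ge>N. x i = 0}"
  define f where "f x i = (if i < N then ln (x i) - ln (1 - x i) else 0)" for x :: "nat \<Rightarrow> real" and i
  define g where "g y i = (if i < N then exp (y i) / (1 + exp (y i)) else 0)" for y :: "nat \<Rightarrow> real" and i
  have c: "continuous_on S (\<lambda>x :: nat \<Rightarrow> real. x i)" for S i
    by (rule continuous_on_subset[OF continuous_on_product_coordinates subset_UNIV])
  have "continuous_on ?O f"
  proof (rule continuous_on_coordinatewise_then_product)
    fix i
    show "continuous_on ?O (\<lambda>x. f x i)"
    proof (cases "i < N")
      case True
      then have "\<forall>x\<in>?O. x i \<noteq> 0 \<and> 1 - x i \<noteq> 0" by force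
      then show ?thesis unfolding f_def using True by (auto intro!: continuous_intros c)
    qed (simp add: f_def)
  qed
  moreover have "continuous_on ?E g"
  proof (rule continuous_on_coordinatewise_then_product)
    fix i
    have "1 + exp (t::real) \<noteq> 0" for t using exp_gt_zero[of t] by linarith
    then show "continuous_on ?E (\<lambda>y. g y i)"
      unfolding g_def by (cases "i < N") (auto intro!: continuous_intros c)
  qed
  moreover have "f ` ?O \<subseteq> ?E" unfolding f_def by auto
  moreover have g01: "0 < exp t / (1 + exp t)" "exp t / (1 + exp t) < 1" for t :: real
    using exp_gt_zero[of t] by (auto simp: divide_less_eq add_pos_pos)
  have "g ` ?E \<subseteq> ?O"
  proof clarify
    fix y :: "nat \<Rightarrow> real"
    show "g y \<in> unit_cube N \<and> (\<forall>i<N. 0 < g y i \<and> g y i < 1)"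
      unfolding unit_cube_def g_def using g01 by (auto intro: less_imp_le)
  qed
  moreover have "g (f x) = x" if "x \<in> ?O" for x
  proof
    fix i
    show "g (f x) i = x i"
    proof (cases "i < N")
      case True
      then have "0 < x i" "x i < 1" using that by auto
      then have "exp (ln (x i) - ln (1 - x i)) = x i / (1 - x i)" by (simp add: exp_diff)
      moreover have "x i / (1 - x i) / (1 + x i / (1 - x i)) = x i" using \<open>x i < 1\<close> by (simp add: field_simps)
      ultimately show ?thesis unfolding f_def g_def using True by simp
    next
      case False then show ?thesis using that unfolding g_def unit_cube_def by auto
    qed
  qed
  moreover have "f (g y) = y" if "y \<in> ?E" for y
  proof
    fix i
    show "f (g y) i = y i"
    proof (cases "i < N")
      case True
      have "1 - exp (y i) / (1 + exp (y i)) = 1 / (1 + exp (y i))"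
      proof -
        have "1 + exp (y i) \<noteq> 0" using exp_gt_zero[of "y i"] by linarith
        then show ?thesis by (simp add: divide_simps)
      qed
      then have "ln (exp (y i) / (1 + exp (y i))) - ln (1 - exp (y i) / (1 + exp (y i))) = y i"
      proof -
        have "0 < 1 + exp (y i)" using exp_gt_zero[of "y i"] by linarith
        then have "ln (exp (y i) / (1 + exp (y i))) = y i - ln (1 + exp (y i))"
          "ln (1 / (1 + exp (y i))) = - ln (1 + exp (y i))" by (simp_all add: ln_div)
        with \<open>1 - exp (y i) / (1 + exp (y i)) = 1 / (1 + exp (y i))\<close> show ?thesis by simp
      qed
      then show ?thesis unfolding f_def g_def using True by simp
    next
      case False then show ?thesis using that unfolding f_def by auto
    qed
  qed
  ultimately have "homeomorphic_maps (top_of_set ?O) (top_of_set ?E) f g"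
    unfolding homeomorphic_maps_def by (simp add: continuous_map_in_subtopology image_subset_iff_funcset)
  then show ?thesis unfolding Euclidean_space_eq_top_of_set homeomorphic_space_def by blast
qed

context params
begin

text \<open>With \<open>P\<close> empty, b = n and the identity matrix as lattice block, this group
  yields the subgroup \<int>^k \<times> \<int>^l of G, as the torus part is absorbed by the
  kernel.\<close>

definition std_lattice :: "((nat \<Rightarrow> real) \<times> 'f::{finite,ab_group_add}) set" where
  "std_lattice = {(z, f). (\<forall>j. z j \<in> \<int>) \<and> (\<forall>j\<ge>n. z j = 0) \<and> f = 0}"

lemma disc_group_std_lattice: "disc_group n std_lattice"
  unfolding disc_group_def
proof (intro conjI allI impI)
  show "add_subgroup std_lattice" unfolding add_subgroup_def std_lattice_def by auto
  show "z j = 0" if "(z, f) \<in> std_lattice" "n \<le> j" for z f j using that unfolding std_lattice_def by auto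
  show "(unit_vec j, 0) \<in> std_lattice" if "j < n" for j using that unfolding std_lattice_def unit_vec_def by auto
  fix R
  have "finite {z :: nat \<Rightarrow> real. (\<forall>j. z j \<in> \<int>) \<and> (\<forall>j\<ge>n. z j = 0) \<and> (\<forall>j. \<bar>z j\<bar> \<le> R)}"
  proof (rule bounded_separated_finite[of 1 _ n R])
    fix x y :: "nat \<Rightarrow> real"
    assume xy: "x \<in> {z. (\<forall>j. z j \<in> \<int>) \<and> (\<forall>j\<ge>n. z j = 0) \<and> (\<forall>j. \<bar>z j\<bar> \<le> R)}"
      "y \<in> {z. (\<forall>j. z j \<in> \<int>) \<and> (\<forall>j\<ge>n. z j = 0) \<and> (\<forall>j. \<bar>z j\<bar> \<le> R)}" "\<And>i. \<bar>x i - y i\<bar> < 1"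
    have "x i - y i = 0" for i
    proof -
      have "x i - y i \<in> \<int>" using xy by auto
      then show ?thesis using xy(3)[of i] by (meson Ints_nonzero_abs_less1)
    qed
    then show "x = y" by (metis eq_iff_diff_eq_0 ext)
  qed auto
  then have "finite ({z :: nat \<Rightarrow> real. (\<forall>j. z j \<in> \<int>) \<and> (\<forall>j\<ge>n. z j = 0) \<and> (\<forall>j. \<bar>z j\<bar> \<le> R)} \<times> {0})" by simp
  then show "finite {(z, f) \<in> std_lattice. \<forall>j. \<bar>z j\<bar> \<le> R}"
    by (rule rev_finite_subset) (auto simp: std_lattice_def)
qed

text \<open>The identity matrix is perturbed in the rows of real and torus coordinates and in the
  columns of real and integral coordinates, which are (k + m) * (k + l) entries. Integral rows stay
  integral, and the torus columns stay unit vectors, so the kernel remains inside the group. A small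
  perturbation keeps the lattice columns independent with constant 2 and stays within the range of
  local injectivity.\<close>

lemma SG_contains_cube:
  obtains F :: "(nat \<Rightarrow> real) \<Rightarrow> 'f::{finite,ab_group_add} Gelem set" where
    "continuous_map (top_of_set (unit_cube ((k + l) * (k + m)))) (SG k l m) F"
    "inj_on F (unit_cube ((k + l) * (k + m)))"
proof -
  let ?N = "(k + l) * (k + m)"
  let ?T = "{k..<k + m}"
  let ?M = "{..<k + m} \<times> ({..<n} - ?T)"
  let ?\<Gamma> = "std_lattice :: ((nat \<Rightarrow> real) \<times> 'f) set"
  have "card ({..<n} - ?T) = n - m" by (subst card_Diff_subset) auto
  then have cM: "card ?M = ?N" unfolding card_cartesian_product by (simp add: mult.commute)
  obtain h where h: "bij_betw h ?M {0..<?N}" using ex_bij_betw_finite_nat[of ?M] unfolding cM by auto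
  \<comment> \<open>For the sum norm the perturbation has norm at most n\<eta> \<le> 1/8. Hence Z -
    Z/8 \<ge> Z/2 gives the constant 2, and for two such matrices the bound 2 * 2 * n\<eta> \<le>
    1/2 stays below the gap 1 of the integral lattice.\<close>
  define \<eta> where "\<eta> = 1 / (8 * (real n + 1))"
  have \<eta>: "\<eta> > 0" "real n * \<eta> \<le> 1/8" unfolding \<eta>_def by (auto simp: field_simps)
  define p where "p x i j = (if i < k + m \<and> j < n \<and> j \<notin> ?T then \<eta> * x (h (i, j)) else 0)" for x :: "nat \<Rightarrow> real" and i j
  define \<sigma> where "\<sigma> x i j = (if i < n \<and> n \<le> j \<and> j < n + n then unit_vec i (j - n) + p x i (j - n) else 0)" for x i j
  have L: "lat_data k m {} n ?\<Gamma> unit_vec 2"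
    by unfold_locales (auto simp: disc_group_std_lattice intro: disc_groupD(3)[OF disc_group_std_lattice])
  interpret lat_data k l m "{}" n ?\<Gamma> unit_vec 2 by (rule L)
  have row: "(\<Sum>j<n. \<sigma> x i (n + j) * z j) = z i + (\<Sum>j<n. p x i j * z j)" if "i < n" for x i z
  proof -
    have "(\<Sum>j<n. \<sigma> x i (n + j) * z j) = (\<Sum>j<n. z j * unit_vec i j) + (\<Sum>j<n. p x i j * z j)"
      unfolding \<sigma>_def sum.distrib[symmetric] using that by (intro sum.cong) (auto simp: algebra_simps)
    then show ?thesis using that by (simp add: sum_unit_vec)
  qed
  have hN: "h (i, j) < ?N" if "i < k + m" "j < n" "j \<notin> ?T" for i j
    using bij_betwE[OF h] that by auto
  have pb: "\<bar>p x i j\<bar> \<le> \<eta>" if "x \<in> unit_cube ?N" for x i j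
    using that hN[of i j] \<eta>(1) unfolding p_def unit_cube_def by (auto simp: abs_mult mult_left_le)
  have \<sigma>A: "\<sigma> x \<in> A" if x: "x \<in> unit_cube ?N" for x
    unfolding adm_def
  proof (intro CollectI conjI allI impI)
    show "\<sigma> x i j = 0" if "\<not> (i < n \<and> i \<notin> {} \<and> (j \<in> {} \<or> n \<le> j \<and> j < n + n))" for i j using that unfolding \<sigma>_def by auto
    show "\<sigma> x i j = 0" if "j \<in> {}" for i j using that by simp
    show "(\<Sum>j<n. \<sigma> x i (n + j) * z j) \<in> \<int>" if "k + m \<le> i" "(z, f) \<in> ?\<Gamma>" for i z f
    proof (cases "i < n")
      case True
      have "p x i j = 0" for j using that(1) unfolding p_def by auto
      then show ?thesis unfolding row[OF True] using that(2) unfolding std_lattice_def by auto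
    next
      case False then show ?thesis unfolding \<sigma>_def by simp
    qed
    show "unit_vec t i = (\<Sum>j\<in>{}. \<sigma> x i j * unit_vec t j) + (\<Sum>j<n. \<sigma> x i (n + j) * unit_vec t j)"
      if "k \<le> t" "t < k + m" "i \<in> {..<n} - {}" for t i
    proof -
      have "p x i t = 0" using that(1,2) unfolding p_def by auto
      then have "(\<Sum>j<n. p x i j * unit_vec t j) = 0" by (simp add: sum_unit_vec)
      then show ?thesis using row[of i x "unit_vec t"] that by simp
    qed
    fix z :: "nat \<Rightarrow> real"
    define Z where "Z = (\<Sum>j<n. \<bar>z j\<bar>)"
    have Z0: "Z \<ge> 0" unfolding Z_def by (rule sum_nonneg) simp
    have "\<bar>z i\<bar> - \<eta> * Z \<le> \<bar>\<Sum>j<n. \<sigma> x i (n + j) * z j\<bar>" if "i < n" for i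
    proof -
      have "\<bar>\<Sum>j<n. p x i j * z j\<bar> \<le> (\<Sum>j<n. \<eta> * \<bar>z j\<bar>)"
        by (rule order_trans[OF sum_abs], rule sum_mono) (auto simp: abs_mult intro: mult_right_mono pb[OF x])
      also have "\<dots> = \<eta> * Z" unfolding Z_def by (simp add: sum_distrib_left)
      finally show ?thesis unfolding row[OF that] by linarith
    qed
    then have "(\<Sum>i<n. \<bar>z i\<bar> - \<eta> * Z) \<le> (\<Sum>i<n. \<bar>\<Sum>j<n. \<sigma> x i (n + j) * z j\<bar>)" by (intro sum_mono) auto
    moreover have "(\<Sum>i<n. \<bar>z i\<bar> - \<eta> * Z) = Z - (real n * \<eta>) * Z" by (simp add: sum_subtractf Z_def[symmetric])
    moreover have "(real n * \<eta>) * Z \<le> 1/8 * Z" by (rule mult_right_mono[OF \<eta>(2) Z0])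
    ultimately have "Z \<le> 2 * (\<Sum>i<n. \<bar>\<Sum>j<n. \<sigma> x i (n + j) * z j\<bar>)" using Z0 by linarith
    then show "(\<Sum>j<n. \<bar>z j\<bar>) \<le> 2 * (\<Sum>i\<in>{..<n} - {}. \<bar>\<Sum>j<n. \<sigma> x i (n + j) * z j\<bar>)" unfolding Z_def by simp
  qed
  have c\<sigma>: "continuous_on (unit_cube ?N) \<sigma>"
  proof (intro continuous_on_coordinatewise_then_product)
    fix i j
    have "continuous_on (unit_cube ?N) (\<lambda>x. p x i r)" for r
      unfolding p_def by (cases "i < k + m \<and> r < n \<and> r \<notin> ?T")
        (auto intro!: continuous_intros continuous_on_subset[OF continuous_on_product_coordinates subset_UNIV])
    then show "continuous_on (unit_cube ?N) (\<lambda>x. \<sigma> x i j)"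
      unfolding \<sigma>_def by (cases "i < n \<and> n \<le> j \<and> j < n + n") (auto intro!: continuous_intros)
  qed
  let ?K = "\<sigma> ` unit_cube ?N"
  have K: "compact ?K" "?K \<subseteq> A" using compact_continuous_image[OF c\<sigma> compact_unit_cube] \<sigma>A by auto
  have inj\<sigma>: "inj_on \<sigma> (unit_cube ?N)"
  proof (rule inj_onI, rule ext)
    fix x y r assume xy: "x \<in> unit_cube ?N" "y \<in> unit_cube ?N" "\<sigma> x = \<sigma> y"
    show "x r = y r"
    proof (cases "r < ?N")
      case True
      then have "r \<in> h ` ?M" using bij_betw_imp_surj_on[OF h] by simp
      then obtain i j where ij: "i < k + m" "j < n" "j \<notin> ?T" "h (i, j) = r" by auto
      have "\<sigma> x i (n + j) = \<sigma> y i (n + j)" unfolding xy(3) ..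
      then show ?thesis using ij \<eta>(1) unfolding \<sigma>_def p_def by auto
    next
      case False then show ?thesis using xy unfolding unit_cube_def by auto
    qed
  qed
  have injTh: "inj_on Th ?K"
  proof (rule inj_onI)
    fix \<theta> \<theta>' assume t: "\<theta> \<in> ?K" "\<theta>' \<in> ?K" "Th \<theta> = Th \<theta>'"
    then obtain x y where xy: "\<theta> = \<sigma> x" "\<theta>' = \<sigma> y" "x \<in> unit_cube ?N" "y \<in> unit_cube ?N" by blast
    have tA: "\<theta> \<in> A" "\<theta>' \<in> A" using t K(2) by blast+
    show "\<theta> = \<theta>'"
    proof (rule Th_locally_injective[OF tA t(3), of 1])
      fix z assume z: "(z, 0) \<in> ?\<Gamma>" "(\<Sum>j<n. \<bar>z j\<bar>) < 1"
      show "\<forall>j<n. z j = 0"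
      proof (intro allI impI)
        fix j assume "j < n"
        then have "\<bar>z j\<bar> \<le> (\<Sum>j<n. \<bar>z j\<bar>)" by (intro member_le_sum[of _ _ "\<lambda>j. \<bar>z j\<bar>"]) auto
        moreover have "z j \<in> \<int>" using z(1) unfolding std_lattice_def by auto
        ultimately show "z j = 0" using z(2) by (meson Ints_nonzero_abs_less1 order_le_less_trans)
      qed
    next
      fix j assume "j < n"
      have "(\<Sum>i\<in>{..<n} - {}. \<bar>\<theta> i (n + j) - \<theta>' i (n + j)\<bar>) \<le> (\<Sum>i\<in>{..<n} - {}. 2 * \<eta>)"
      proof (rule sum_mono)
        fix i assume "i \<in> {..<n} - {}"
        then have "\<theta> i (n + j) - \<theta>' i (n + j) = p x i j - p y i j" unfolding xy \<sigma>_def using \<open>j < n\<close> by simp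
        then show "\<bar>\<theta> i (n + j) - \<theta>' i (n + j)\<bar> \<le> 2 * \<eta>" using pb[OF xy(3), of i j] pb[OF xy(4), of i j] by linarith
      qed
      also have "\<dots> = 2 * (real n * \<eta>)" by simp
      finally show "2 * (\<Sum>i\<in>{..<n} - {}. \<bar>\<theta> i (n + j) - \<theta>' i (n + j)\<bar>) < 1" using \<eta>(2) by linarith
    qed simp
  qed
  have "continuous_map (top_of_set (unit_cube ?N)) (SG k l m) (Th \<circ> \<sigma>)"
    by (rule continuous_map_compose[OF _ Th_continuous[OF K]]) (use c\<sigma> in \<open>simp add: continuous_map_in_subtopology\<close>)
  moreover have "inj_on (Th \<circ> \<sigma>) (unit_cube ?N)" using inj\<sigma> injTh by (rule comp_inj_on)
  ultimately show thesis by (rule that)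
qed

end

theorem theorem8p6:
  fixes k l m :: nat
  defines "X \<equiv> (SG k l m :: 'f::{finite,ab_group_add} Gelem set topology)"
  shows "has_ind_dim X ((k + l) * (k + m)) \<and> has_cov_dim X ((k + l) * (k + m)) \<and>
         (\<exists>S\<subseteq>topspace X. subtopology X S homeomorphic_space Euclidean_space ((k + l) * (k + m)))"
proof -
  interpret params k l m .
  let ?N = "(k + l) * (k + m)"
  obtain S :: "(nat \<Rightarrow> real) set" where XS: "X homeomorphic_space top_of_set S" unfolding X_def using SG_embeds by blast
  then have SX: "top_of_set S homeomorphic_space X" using homeomorphic_space_sym by blast
  obtain h where "homeomorphic_map X (top_of_set S) h" using XS homeomorphic_space by blast
  then have dec: "dec_le (Suc ?N) S" unfolding X_def by (rule SG_dimension_le)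
  have ind_up: "ind_le (Suc ?N) X" by (rule ind_le_homeomorphic[OF SX dec_imp_ind_le[OF dec]])
  have cov_up: "cov_le ?N X" by (rule cov_le_homeomorphic[OF SX dec_imp_cov_le[OF dec]])
  have haus: "Hausdorff_space X"
    using homeomorphic_Hausdorff_space[OF XS] by (simp add: Hausdorff_space_subtopology)
  obtain F :: "(nat \<Rightarrow> real) \<Rightarrow> 'f Gelem set"
    where F: "continuous_map (top_of_set (unit_cube ?N)) X F" "inj_on F (unit_cube ?N)"
    unfolding X_def by (rule SG_contains_cube)
  have not_cov: "\<not> cov_le j X" if "j < ?N" for j by (rule not_cov_le_embedded_cube[OF haus F that])
  have FX: "F ` unit_cube ?N \<subseteq> topspace X" using F(1) by (auto simp: continuous_map_def)
  \<comment> \<open>A bound on the inductive dimension would give a decomposition and thereby the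
    same bound on the covering dimension, which the cube excludes. By the shift in
    \<open>ind_le\<close>, index 0 means emptiness and index \<open>Suc i\<close> means dimension at
    most i.\<close>
  have not_ind: "\<not> ind_le j X" if "j \<le> ?N" for j
  proof (cases j)
    case 0
    have "(\<lambda>_. 0) \<in> unit_cube ?N" unfolding unit_cube_def by simp
    then show ?thesis using FX 0 by auto
  next
    case (Suc i)
    show ?thesis
    proof
      assume "ind_le j X"
      then have "dec_le (Suc i) S" unfolding Suc by (intro ind_le_imp_dec ind_le_homeomorphic[OF XS])
      then have "cov_le i X" by (intro cov_le_homeomorphic[OF SX] dec_imp_cov_le)
      then show False using not_cov[of i] that Suc by simp
    qed
  qed
  \<comment> \<open>The closed cube is embedded by compactness; the open cube inside it gives the
    copy of Euclidean space.\<close>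
  let ?O = "{x \<in> unit_cube ?N. \<forall>i<?N. 0 < x i \<and> x i < 1}"
  have hF: "homeomorphic_map (top_of_set (unit_cube ?N)) (subtopology X (F ` unit_cube ?N)) F"
  proof (rule continuous_imp_homeomorphic_map)
    show "compact_space (top_of_set (unit_cube ?N))" using compact_unit_cube by (simp add: compact_space_subtopology)
    show "Hausdorff_space (subtopology X (F ` unit_cube ?N))" by (rule Hausdorff_space_subtopology[OF haus])
    show "continuous_map (top_of_set (unit_cube ?N)) (subtopology X (F ` unit_cube ?N)) F"
      using F(1) by (simp add: continuous_map_in_subtopology)
  qed (use F(2) FX in auto)
  have hO: "homeomorphic_map (subtopology (top_of_set (unit_cube ?N)) ?O) (subtopology (subtopology X (F ` unit_cube ?N)) (F ` ?O)) F"
    by (rule homeomorphic_map_subtopologies[OF hF]) (use FX in auto)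
  have e: "unit_cube ?N \<inter> ?O = ?O" "F ` unit_cube ?N \<inter> F ` ?O = F ` ?O" by blast+
  have "top_of_set ?O homeomorphic_space subtopology X (F ` ?O)"
    using homeomorphic_map_imp_homeomorphic_space[OF hO] unfolding subtopology_subtopology e .
  then have "subtopology X (F ` ?O) homeomorphic_space Euclidean_space ?N"
    using open_cube_homeomorphic_Euclidean_space homeomorphic_space_sym homeomorphic_space_trans by blast
  moreover have "F ` ?O \<subseteq> topspace X" using FX by auto
  ultimately show ?thesis
    unfolding has_ind_dim_def has_cov_dim_def using ind_up cov_up not_cov not_ind by blast
qed

end
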